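(* Let $k:\mathcal P\otimes\mathcal Q\to\mathbb R$ be differentiable at $P_0\otimes Q_0$ with canonical gradient $\widetilde k=\widetilde k_1\circ\pi_1+\widetilde k_2\circ\pi_2$, $\|\widetilde k\|_{L_2(P_0\otimes Q_0)}\neq0$, let $\alpha\in(0,1)$, and let $(n_1)_n,(n_2)_n\subset\mathbb N$ satisfy $n_1+n_2=n$ for all $n$ and $\lim_{n\to\infty}\frac{n_2}n=d\in(0,1)$. Suppose $$K(P_0\otimes Q_0,\mathcal P\otimes\mathcal Q)=T(P_0\otimes Q_0,\mathcal P\otimes\mathcal Q).$$ Let $\psi_n=1$ if $|T_n|>c$ and $\psi_n=0$ if $|T_n|\le c$, where $$T_n=\frac{\sqrt n}{n_1}\sum_{i=1}^{n_1}\widetilde k_1(\omega_{1,i})+\frac{\sqrt n}{n_2}\sum_{j=1}^{n_2}\widetilde k_2(\omega_{2,j}),\qquad c=u_{1-\frac\alpha2}\Bigl(\frac1{1-d}\int\widetilde k_1^2\,dP_0+\frac1d\int\widetilde k_2^2\,dQ_0\Bigr)^{1/2}.$$ Then $(\psi_n)_n$ is asymptotically optimal within the set of all test sequences for $\mathcal H_2$ against $\mathcal K_2$ that are asymptotically unbiased at level $\alpha$.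
   Context: $\mathcal P,\mathcal Q$ are nonempty families of probability measures on $(\Omega_1,\mathcal A_1)$, $(\Omega_2,\mathcal A_2)$; $\mathcal P\otimes\mathcal Q=\{P\otimes Q:P\in\mathcal P,Q\in\mathcal Q\}$; $(\omega_{1,1},\dots,\omega_{1,n_1},\omega_{2,1},\dots,\omega_{2,n_2})$ is the generic point of $\Omega_1^{n_1}\times\Omega_2^{n_2}$. $\Phi$ is the standard normal distribution function, $u_p=\Phi^{-1}(p)$; tests are measurable $[0,1]$-valued functions. $L_2^{(0)}(P)=\{h\in L_2(P):\int h\,dP=0\}$. With $dP/dQ$ the density quotient (a $[0,\infty]$-valued measurable $L$ with $P(A)=\int_AL\,dQ+P(A\cap\{L=\infty\})$, $Q(L<\infty)=1$), a curve $t\mapsto R_t$, $|t|<\varepsilon$, in a family $\mathcal R$ is $L_2(R_0)$-differentiable with tangent $g\in L_2(R_0)$ if $\|2((dR_t/dR_0)^{1/2}-1)-tg\|_{L_2(R_0)}=o(|t|)$ and $R_t(dR_t/dR_0=\infty)=o(t^2)$ as $t\to0$. The tangent cone $K(R,\mathcal R)$ is the set of tangents of all such curves in $\mathcal R$ with $R_0=R$; the tangent space $T(R,\mathcal R)$ is the $L_2(R)$-closure of its linear span. A functional $k$ on $\mathcal R$ is differentiable at $R\in\mathcal R$ with gradient $\dot k\in L_2^{(0)}(R)$ if $\lim_{t\downarrow0}t^{-1}(k(R_t)-k(R))=\int\dot kg\,dR$ for each $L_2$-differentiable curve in $\mathcal R$ with $R_0=R$ and tangent $g$; the canonical gradient is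 the unique gradient in $T(R,\mathcal R)$. At $P_0\otimes Q_0$ it decomposes uniquely as $\widetilde k(\omega_1,\omega_2)=\widetilde k_1(\omega_1)+\widetilde k_2(\omega_2)$ with $\widetilde k_1\in L_2^{(0)}(P_0)$, $\widetilde k_2\in L_2^{(0)}(Q_0)$. $\mathcal F_2$ is the set of all sequences $(P_{t_n}\otimes Q_{t_n})_n$ (identified with the sequences $(P_{t_n}^{n_1}\otimes Q_{t_n}^{n_2})_n$) such that $t_n\to0$, $\lim_nt_n\sqrt n>0$, and there are $\varepsilon>0$ and an $L_2(P_0\otimes Q_0)$-differentiable curve $f:(-\varepsilon,\varepsilon)\to\mathcal P\otimes\mathcal Q$, $t\mapsto P_t\otimes Q_t$ (through $P_0\otimes Q_0$ at $t=0$) with $f(t_n)=P_{t_n}\otimes Q_{t_n}$ for all $n$. For an element of $\mathcal F_2$ put $\vartheta=\lim_n\sqrt n(k(P_{t_n}\otimes Q_{t_n})-k(P_0\otimes Q_0))$. $\mathcal K_2$ (implicit alternatives) is the set of elements of $\mathcal F_2$ with $\vartheta\ne0$, $\mathcal H_2$ (implicit hypotheses) the set of those with $\vartheta=0$. A sequence of tests $\varphi_n$ on $\Omega_1^{n_1}\times\Omega_2^{n_2}$ is asymptotically unbiased at level $\alpha$ for $\mathcal H_2$ against $\mathcal K_2$ if $\limsup_n\int\varphi_n\,dP_{t_n}^{n_1}\otimes Q_{t_n}^{n_2}\le\alpha$ on $\mathcal H_2$ and $\liminf_n\int\varphi_n\,dP_{t_n}^{n_1}\otimes Q_{t_n}^{n_2}\ge\alpha$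 on $\mathcal K_2$. "$(\psi_n)$ is asymptotically optimal" in this class means: $(\psi_n)$ belongs to the class, and for every $(\varphi_n)$ in the class: $\limsup_n\int\varphi_n\,dP_{t_n}^{n_1}\otimes Q_{t_n}^{n_2}\le\lim_n\int\psi_n\,dP_{t_n}^{n_1}\otimes Q_{t_n}^{n_2}$ for all elements of $\mathcal K_2$, and $\liminf_n\int\varphi_n\,dP_{t_n}^{n_1}\otimes Q_{t_n}^{n_2}\ge\lim_n\int\psi_n\,dP_{t_n}^{n_1}\otimes Q_{t_n}^{n_2}$ for all elements of $\mathcal H_2$ (the limits for $\psi_n$ existing). *)

theory Defs
  imports "HOL-Probability.Probability" "HOL-Library.Landau_Symbols"
begin

text \<open>
  A measurable space is represented by a measure \<open>M\<close> of which only \<open>space M\<close> and \<open>sets M\<close> matter;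
  the probability measures on it are the elements of \<open>space (prob_algebra M)\<close>.
  Elements of $L_2$ are represented by functions; all notions below are invariant under
  modification on null sets.
\<close>

subsection \<open>Square integrable functions\<close>

definition L2 :: "'a measure \<Rightarrow> ('a \<Rightarrow> real) set" where
  "L2 M = {h \<in> borel_measurable M. integrable M (\<lambda>x. (h x)\<^sup>2)}"

definition L2_0 :: "'a measure \<Rightarrow> ('a \<Rightarrow> real) set" where
  "L2_0 M = {h \<in> L2 M. (\<integral>x. h x \<partial>M) = 0}"

text \<open>Only meaningful on \<open>L2 M\<close>: the Bochner integral of a non-integrable function is 0.\<close>

definition L2_norm :: "'a measure \<Rightarrow> ('a \<Rightarrow> real) \<Rightarrow> real" where
  "L2_norm M h = sqrt (\<integral>x. (h x)\<^sup>2 \<partial>M)"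

definition linear_span :: "('a \<Rightarrow> real) set \<Rightarrow> ('a \<Rightarrow> real) set" where
  "linear_span S = {h. \<exists>F c. finite F \<and> F \<subseteq> S \<and> h = (\<lambda>x. \<Sum>g\<in>F. c g * g x)}"

definition L2_closure :: "'a measure \<Rightarrow> ('a \<Rightarrow> real) set \<Rightarrow> ('a \<Rightarrow> real) set" where
  "L2_closure M S = {g \<in> L2 M. \<forall>e>0. \<exists>h\<in>S. L2_norm M (\<lambda>x. g x - h x) < e}"

subsection \<open>Differentiable curves, tangents and gradients\<close>

text \<open>\<open>L\<close> is a version of the density quotient \<open>dP/dQ\<close>; \<open>P\<close> need not be absolutely continuous
  with respect to \<open>Q\<close>. A version always exists and is unique up to \<open>(P + Q)\<close>-null sets.\<close>

definition is_density_quotient :: "'a measure \<Rightarrow> 'a measure \<Rightarrow> ('a \<Rightarrow> ennreal) \<Rightarrow> bool" where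
  "is_density_quotient P Q L \<longleftrightarrow>
     L \<in> borel_measurable Q \<and>
     (\<forall>A\<in>sets Q. emeasure P A =
        (\<integral>\<^sup>+x\<in>A. L x \<partial>Q) + emeasure P (A \<inter> {x \<in> space Q. L x = \<infinity>})) \<and>
     (AE x in Q. L x < \<infinity>)"

text \<open>The curve is given by the values \<open>R t\<close> for \<open>\<bar>t\<bar> < \<epsilon>\<close>. The function whose norm is taken
  lies in \<open>L2 (R 0)\<close>, and \<open>enn2real\<close> alters \<open>L t\<close> only on an \<open>R 0\<close>-null set.\<close>

definition L2_differentiable_curve ::
    "'a measure set \<Rightarrow> real \<Rightarrow> (real \<Rightarrow> 'a measure) \<Rightarrow> ('a \<Rightarrow> real) \<Rightarrow> bool" where
  "L2_differentiable_curve \<R> \<epsilon> R g \<longleftrightarrow>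
     \<epsilon> > 0 \<and> (\<forall>t. \<bar>t\<bar> < \<epsilon> \<longrightarrow> R t \<in> \<R>) \<and> g \<in> L2 (R 0) \<and>
     (\<exists>L. (\<forall>t. \<bar>t\<bar> < \<epsilon> \<longrightarrow> is_density_quotient (R t) (R 0) (L t)) \<and>
        (\<lambda>t. L2_norm (R 0) (\<lambda>x. 2 * (sqrt (enn2real (L t x)) - 1) - t * g x))
          \<in> o[at 0](\<lambda>t. \<bar>t\<bar>) \<and>
        (\<lambda>t. measure (R t) {x \<in> space (R t). L t x = \<infinity>}) \<in> o[at 0](\<lambda>t. t\<^sup>2))"

definition tangent_cone :: "'a measure \<Rightarrow> 'a measure set \<Rightarrow> ('a \<Rightarrow> real) set" where
  "tangent_cone R0 \<R> = {g. \<exists>\<epsilon> R. L2_differentiable_curve \<R> \<epsilon> R g \<and> R 0 = R0}"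

definition tangent_space :: "'a measure \<Rightarrow> 'a measure set \<Rightarrow> ('a \<Rightarrow> real) set" where
  "tangent_space R0 \<R> = L2_closure R0 (linear_span (tangent_cone R0 \<R>))"

definition is_gradient ::
    "'a measure set \<Rightarrow> ('a measure \<Rightarrow> real) \<Rightarrow> 'a measure \<Rightarrow> ('a \<Rightarrow> real) \<Rightarrow> bool" where
  "is_gradient \<R> k R0 kd \<longleftrightarrow>
     R0 \<in> \<R> \<and> kd \<in> L2_0 R0 \<and>
     (\<forall>\<epsilon> R g. L2_differentiable_curve \<R> \<epsilon> R g \<and> R 0 = R0 \<longrightarrow>
        ((\<lambda>t. (k (R t) - k R0) / t) \<longlongrightarrow> (\<integral>x. kd x * g x \<partial>R0)) (at_right 0))"

definition is_canonical_gradient ::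
    "'a measure set \<Rightarrow> ('a measure \<Rightarrow> real) \<Rightarrow> 'a measure \<Rightarrow> ('a \<Rightarrow> real) \<Rightarrow> bool" where
  "is_canonical_gradient \<R> k R0 kd \<longleftrightarrow> is_gradient \<R> k R0 kd \<and> kd \<in> tangent_space R0 \<R>"

subsection \<open>Two-sample models, implicit alternatives and hypotheses\<close>

definition product_family :: "'a measure set \<Rightarrow> 'b measure set \<Rightarrow> ('a \<times> 'b) measure set"
    (infixr "\<otimes>\<^sub>F" 80) where
  "\<P> \<otimes>\<^sub>F \<Q> = {P \<Otimes>\<^sub>M Q | P Q. P \<in> \<P> \<and> Q \<in> \<Q>}"

text \<open>The law of two independent samples of sizes \<open>m1\<close> and \<open>m2\<close>, with coordinates numbered
  from 1. Its underlying measurable space depends on \<open>P\<close> and \<open>Q\<close> only through their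
  measurable spaces.\<close>

definition two_sample :: "nat \<Rightarrow> nat \<Rightarrow> 'a measure \<Rightarrow> 'b measure
    \<Rightarrow> ((nat \<Rightarrow> 'a) \<times> (nat \<Rightarrow> 'b)) measure" where
  "two_sample m1 m2 P Q = (\<Pi>\<^sub>M i\<in>{1..m1}. P) \<Otimes>\<^sub>M (\<Pi>\<^sub>M j\<in>{1..m2}. Q)"

text \<open>An element of \<open>\<F>\<^sub>2\<close> is recorded by its sequences of factors, which the product measures
  determine.\<close>

definition F2 :: "'a measure set \<Rightarrow> 'b measure set \<Rightarrow> 'a measure \<Rightarrow> 'b measure
    \<Rightarrow> ((nat \<Rightarrow> 'a measure) \<times> (nat \<Rightarrow> 'b measure)) set" where
  "F2 \<P> \<Q> P0 Q0 = {(Ps, Qs).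
     (\<forall>n. Ps n \<in> \<P> \<and> Qs n \<in> \<Q>) \<and>
     (\<exists>\<epsilon> f g t s. L2_differentiable_curve (\<P> \<otimes>\<^sub>F \<Q>) \<epsilon> f g \<and> f 0 = P0 \<Otimes>\<^sub>M Q0 \<and>
        t \<longlonglongrightarrow> 0 \<and> (\<lambda>n. t n * sqrt (real n)) \<longlonglongrightarrow> s \<and> s > 0 \<and>
        (\<forall>n. \<bar>t n\<bar> < \<epsilon> \<and> f (t n) = Ps n \<Otimes>\<^sub>M Qs n))}"

definition is_local_parameter :: "(('a \<times> 'b) measure \<Rightarrow> real) \<Rightarrow> 'a measure \<Rightarrow> 'b measure
    \<Rightarrow> (nat \<Rightarrow> 'a measure) \<Rightarrow> (nat \<Rightarrow> 'b measure) \<Rightarrow> real \<Rightarrow> bool" where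
  "is_local_parameter k P0 Q0 Ps Qs \<theta> \<longleftrightarrow>
     (\<lambda>n. sqrt (real n) * (k (Ps n \<Otimes>\<^sub>M Qs n) - k (P0 \<Otimes>\<^sub>M Q0))) \<longlonglongrightarrow> \<theta>"

definition implicit_alternatives :: "'a measure set \<Rightarrow> 'b measure set \<Rightarrow> (('a \<times> 'b) measure \<Rightarrow> real)
    \<Rightarrow> 'a measure \<Rightarrow> 'b measure \<Rightarrow> ((nat \<Rightarrow> 'a measure) \<times> (nat \<Rightarrow> 'b measure)) set" where
  "implicit_alternatives \<P> \<Q> k P0 Q0 =
     {(Ps, Qs) \<in> F2 \<P> \<Q> P0 Q0. \<exists>\<theta>. is_local_parameter k P0 Q0 Ps Qs \<theta> \<and> \<theta> \<noteq> 0}"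

definition implicit_hypotheses :: "'a measure set \<Rightarrow> 'b measure set \<Rightarrow> (('a \<times> 'b) measure \<Rightarrow> real)
    \<Rightarrow> 'a measure \<Rightarrow> 'b measure \<Rightarrow> ((nat \<Rightarrow> 'a measure) \<times> (nat \<Rightarrow> 'b measure)) set" where
  "implicit_hypotheses \<P> \<Q> k P0 Q0 =
     {(Ps, Qs) \<in> F2 \<P> \<Q> P0 Q0. is_local_parameter k P0 Q0 Ps Qs 0}"

subsection \<open>Asymptotic tests\<close>

type_synonym ('a, 'b) tests = "nat \<Rightarrow> (nat \<Rightarrow> 'a) \<times> (nat \<Rightarrow> 'b) \<Rightarrow> real"

definition test_sequences :: "'a measure \<Rightarrow> 'b measure \<Rightarrow> (nat \<Rightarrow> nat) \<Rightarrow> (nat \<Rightarrow> nat)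
    \<Rightarrow> ('a, 'b) tests set" where
  "test_sequences M1 M2 n1 n2 = {\<phi>. \<forall>n.
     \<phi> n \<in> borel_measurable (two_sample (n1 n) (n2 n) M1 M2) \<and>
     (\<forall>\<omega>\<in>space (two_sample (n1 n) (n2 n) M1 M2). 0 \<le> \<phi> n \<omega> \<and> \<phi> n \<omega> \<le> 1)}"

definition test_power :: "(nat \<Rightarrow> nat) \<Rightarrow> (nat \<Rightarrow> nat) \<Rightarrow> ('a, 'b) tests
    \<Rightarrow> (nat \<Rightarrow> 'a measure) \<Rightarrow> (nat \<Rightarrow> 'b measure) \<Rightarrow> nat \<Rightarrow> real" where
  "test_power n1 n2 \<phi> Ps Qs n = (\<integral>\<omega>. \<phi> n \<omega> \<partial>two_sample (n1 n) (n2 n) (Ps n) (Qs n))"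

definition asymptotically_unbiased :: "(nat \<Rightarrow> nat) \<Rightarrow> (nat \<Rightarrow> nat) \<Rightarrow> real
    \<Rightarrow> ((nat \<Rightarrow> 'a measure) \<times> (nat \<Rightarrow> 'b measure)) set
    \<Rightarrow> ((nat \<Rightarrow> 'a measure) \<times> (nat \<Rightarrow> 'b measure)) set
    \<Rightarrow> ('a, 'b) tests \<Rightarrow> bool" where
  "asymptotically_unbiased n1 n2 \<alpha> H K \<phi> \<longleftrightarrow>
     (\<forall>(Ps, Qs)\<in>H. limsup (\<lambda>n. ereal (test_power n1 n2 \<phi> Ps Qs n)) \<le> ereal \<alpha>) \<and>
     (\<forall>(Ps, Qs)\<in>K. liminf (\<lambda>n. ereal (test_power n1 n2 \<phi> Ps Qs n)) \<ge> ereal \<alpha>)"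

definition asymptotically_optimal :: "(nat \<Rightarrow> nat) \<Rightarrow> (nat \<Rightarrow> nat)
    \<Rightarrow> ((nat \<Rightarrow> 'a measure) \<times> (nat \<Rightarrow> 'b measure)) set
    \<Rightarrow> ((nat \<Rightarrow> 'a measure) \<times> (nat \<Rightarrow> 'b measure)) set
    \<Rightarrow> ('a, 'b) tests set \<Rightarrow> ('a, 'b) tests \<Rightarrow> bool" where
  "asymptotically_optimal n1 n2 H K C \<psi> \<longleftrightarrow>
     \<psi> \<in> C \<and>
     (\<forall>(Ps, Qs)\<in>H \<union> K. convergent (test_power n1 n2 \<psi> Ps Qs)) \<and>
     (\<forall>\<phi>\<in>C.
        (\<forall>(Ps, Qs)\<in>K. limsup (\<lambda>n. ereal (test_power n1 n2 \<phi> Ps Qs n))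
                        \<le> ereal (lim (test_power n1 n2 \<psi> Ps Qs))) \<and>
        (\<forall>(Ps, Qs)\<in>H. liminf (\<lambda>n. ereal (test_power n1 n2 \<phi> Ps Qs n))
                        \<ge> ereal (lim (test_power n1 n2 \<psi> Ps Qs))))"

definition std_normal_quantile :: "real \<Rightarrow> real" where
  "std_normal_quantile p = inv (cdf std_normal_distribution) p"

end

theory Submission
  imports Defs
begin

text \<open>
  A differentiable curve of product measures differentiates factorwise: if \<open>\<xi> \<otimes> \<eta>\<close> is the root of
  its density quotient, then the means of \<open>\<xi>\<close> and \<open>\<eta>\<close> differ from 1 by \<open>O(t\<^sup>2)\<close>, so averaging over
  one factor isolates the other. Hence the tangent cone contains the components of its elements
  and, being a linear space by assumption, also the representer \<open>ks\<close> of the derivative of the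
  functional with respect to the inner product of the limit experiment.

  By the Hellinger bound for product measures, the samples drawn along a curve may be replaced, with
  vanishing total variation error, by an explicit exponential tilt of the samples from
  \<open>P0\<close> and \<open>Q0\<close> along truncations of the tangents. Characteristic functions under tilts are
  computed directly, so Levy's theorem gives the limiting powers of the two-sided test without
  contiguity arguments, and tilts in direction \<open>ks\<close> have likelihood ratios which are exactly
  exponential in the test statistic.

  Optimality is a Neyman-Pearson argument with three points \<open>0\<close>, \<open>a\<close> and \<open>- \<epsilon>\<close>: as
  \<open>exp (a z) + l exp (- \<epsilon> z)\<close> is convex, a suitable \<open>l\<close> makes its sublevel set the acceptance
  interval. The asymptotic power of an unbiased test is at most \<open>\<alpha>\<close> at 0 and at least \<open>\<alpha>\<close> at
  \<open>- \<epsilon>\<close>, and the power of the two-sided test is stationary at 0, so \<open>\<epsilon> \<rightarrow> 0\<close> gives the bound at \<open>a\<close>.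
\<close>

section \<open>Square integrable functions\<close>

text \<open>Unbiasedness is assumed only along sequences drawn from curves of the model, so every
  direction in the Neyman-Pearson argument has to be the tangent of such a curve; equality of cone
  and tangent space supplies these curves. The inner product of the limit experiment weights the
  factors by the sampling fractions \<open>1 - d\<close> and \<open>d\<close>, while the canonical
  gradient refers to the unweighted one. Its components are therefore rescaled separately, and
  linearity of the cone alone would not keep the result among the tangents: both components must be
  tangents by themselves. The obstacle for tilts is that tangents are merely square integrable.
  Truncation at \<open>sqrt n\<close> makes the exponentials bounded, and two moments suffice to
  make the truncated means of smaller order than \<open>1 / sqrt n\<close>. On the hypotheses the
  class bounds powers only from above; the lower bound \<alpha> demanded by optimality comes from
  equicontinuity of the powers at 0 along \<open>ks\<close>. No limit point of the tests is ever
  formed: the inequalities hold at finite n, and only normalising constants and the power of the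
  two-sided test pass to the limit.\<close>

lemma L2_measurable: "f \<in> L2 M \<Longrightarrow> f \<in> borel_measurable M"
  by (simp add: L2_def)

lemma L2_square_integrable: "f \<in> L2 M \<Longrightarrow> integrable M (\<lambda>x. (f x)\<^sup>2)"
  by (simp add: L2_def)

lemma L2_mult_integrable:
  assumes "f \<in> L2 M" "g \<in> L2 M"
  shows "integrable M (\<lambda>x. f x * g x)"
proof (rule Bochner_Integration.integrable_bound)
  show "integrable M (\<lambda>x. (f x)\<^sup>2 + (g x)\<^sup>2)"
    using assms by (simp add: L2_def)
  have "\<bar>f x * g x\<bar> \<le> (f x)\<^sup>2 + (g x)\<^sup>2" for x
  proof -
    have "2 * \<bar>f x\<bar> * \<bar>g x\<bar> \<le> (f x)\<^sup>2 + (g x)\<^sup>2"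
      using sum_squares_bound[of "\<bar>f x\<bar>" "\<bar>g x\<bar>"] by simp
    moreover have "0 \<le> \<bar>f x\<bar> * \<bar>g x\<bar>" by simp
    ultimately show ?thesis unfolding abs_mult by linarith
  qed
  then show "AE x in M. norm (f x * g x) \<le> norm ((f x)\<^sup>2 + (g x)\<^sup>2)"
    by simp
qed (use assms in \<open>auto simp: L2_def\<close>)

lemma L2_scale: "f \<in> L2 M \<Longrightarrow> (\<lambda>x. a * f x) \<in> L2 M"
  by (auto simp: L2_def power_mult_distrib)

lemma L2_add:
  assumes "f \<in> L2 M" "g \<in> L2 M"
  shows "(\<lambda>x. f x + g x) \<in> L2 M"
  using assms L2_mult_integrable[OF assms]
  by (auto simp: L2_def power2_sum mult.assoc)

lemma L2_diff:
  assumes "f \<in> L2 M" "g \<in> L2 M"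
  shows "(\<lambda>x. f x - g x) \<in> L2 M"
  using L2_add[OF assms(1) L2_scale[OF assms(2), of "-1"]] by simp

lemma L2_abs: "f \<in> L2 M \<Longrightarrow> (\<lambda>x. \<bar>f x\<bar>) \<in> L2 M"
  by (auto simp: L2_def)

lemma (in finite_measure) L2_const: "(\<lambda>x. a) \<in> L2 M"
  by (simp add: L2_def)

lemma (in finite_measure) L2_integrable: "f \<in> L2 M \<Longrightarrow> integrable M f"
  using L2_mult_integrable[OF _ L2_const[of 1]] by simp

lemma L2_bound:
  assumes "g \<in> L2 M" "f \<in> borel_measurable M" "AE x in M. \<bar>f x\<bar> \<le> \<bar>g x\<bar>"
  shows "f \<in> L2 M"
  unfolding L2_def
proof safe
  show "integrable M (\<lambda>x. (f x)\<^sup>2)"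
  proof (rule Bochner_Integration.integrable_bound)
    show "integrable M (\<lambda>x. (g x)\<^sup>2)" using assms(1) by (simp add: L2_def)
    show "AE x in M. norm ((f x)\<^sup>2) \<le> norm ((g x)\<^sup>2)"
      using assms(3) by eventually_elim (simp add: power2_abs abs_le_square_iff)
  qed (use assms in simp)
qed (use assms in simp)

lemma L2_cong_AE:
  assumes "g \<in> L2 M" "f \<in> borel_measurable M" "AE x in M. f x = g x"
  shows "f \<in> L2 M"
  using assms by (intro L2_bound[OF assms(1,2)]) (auto elim: eventually_mono)

lemma Cauchy_Schwarz_integral:
  assumes f: "f \<in> L2 M" and g: "g \<in> L2 M"
  shows "(\<integral>x. f x * g x \<partial>M)\<^sup>2 \<le> (\<integral>x. (f x)\<^sup>2 \<partial>M) * (\<integral>x. (g x)\<^sup>2 \<partial>M)"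
proof -
  define A where "A = (\<integral>x. (f x)\<^sup>2 \<partial>M)"
  define B where "B = (\<integral>x. f x * g x \<partial>M)"
  define C where "C = (\<integral>x. (g x)\<^sup>2 \<partial>M)"
  have [measurable]: "f \<in> borel_measurable M" "g \<in> borel_measurable M"
    using f g by (auto simp: L2_def)
  have fi: "integrable M (\<lambda>x. (f x)\<^sup>2)" "integrable M (\<lambda>x. (g x)\<^sup>2)" "integrable M (\<lambda>x. f x * g x)"
    using f g L2_mult_integrable[OF f g] by (auto simp: L2_def)
  have A0: "A \<ge> 0" unfolding A_def by simp
  show ?thesis
  proof (cases "A = 0")
    case True
    then have "AE x in M. (f x)\<^sup>2 = 0"
      using integral_nonneg_eq_0_iff_AE[OF fi(1)] by (simp add: A_def)
    then have "B = 0"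
      unfolding B_def by (intro integral_eq_zero_AE) (auto elim: eventually_mono)
    then show ?thesis by (simp add: B_def)
  next
    case False
    \<comment> \<open>The minimiser of \<open>t\<^sup>2 * A - 2 * t * B + C\<close>; the minimum is
      \<open>C - B\<^sup>2 / A\<close>.\<close>
    define t where "t = B / A"
    have "0 \<le> (\<integral>x. (t * f x - g x)\<^sup>2 \<partial>M)" by simp
    also have "\<dots> = (\<integral>x. t\<^sup>2 * (f x)\<^sup>2 - 2 * t * (f x * g x) + (g x)\<^sup>2 \<partial>M)"
      by (intro Bochner_Integration.integral_cong) (auto simp: power2_eq_square algebra_simps)
    also have "\<dots> = t\<^sup>2 * A - 2 * t * B + C"
      using fi by (simp add: A_def B_def C_def)
    also have "\<dots> = C - B\<^sup>2 / A"
      using False by (simp add: t_def power2_eq_square field_simps)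
    finally have "B\<^sup>2 \<le> A * C" using A0 False by (simp add: field_simps)
    then show ?thesis by (simp add: A_def B_def C_def)
  qed
qed

lemma (in prob_space) square_integral_le:
  assumes f: "f \<in> L2 M"
  shows "(\<integral>x. f x \<partial>M)\<^sup>2 \<le> (\<integral>x. (f x)\<^sup>2 \<partial>M)"
  using Cauchy_Schwarz_integral[OF f L2_const[of 1]] by (simp add: prob_space)

lemma L2_0_scale: "f \<in> L2_0 M \<Longrightarrow> (\<lambda>x. a * f x) \<in> L2_0 M"
  using L2_scale[of f M a] by (auto simp: L2_0_def)

lemma L2_0_linear:
  assumes "prob_space M" "f \<in> L2_0 M" "g \<in> L2_0 M"
  shows "(\<lambda>x. f x + b * g x) \<in> L2_0 M"
proof -
  interpret prob_space M by fact
  show ?thesis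
    using assms L2_integrable[of f] L2_integrable[of g] L2_add[of f M "\<lambda>x. b * g x"] L2_scale[of g M b]
    by (auto simp: L2_0_def)
qed

section \<open>Density quotients\<close>

text \<open>Cancelling the finite singular mass on every set leaves an equality of measures: the
  part of P with a density is P restricted to the set where L is finite. In this form quotients can
  be restricted and multiplied by the rules for densities.\<close>

lemma is_density_quotient_iff:
  assumes P: "finite_measure P" and sets: "sets P = sets Q"
  shows "is_density_quotient P Q L \<longleftrightarrow>
    L \<in> borel_measurable Q \<and> density Q L = density P (indicator {x \<in> space Q. L x < \<infinity>}) \<and>
    (AE x in Q. L x < \<infinity>)"
proof -
  interpret P: finite_measure P by fact
  have eq: "(emeasure P A = (\<integral>\<^sup>+x\<in>A. L x \<partial>Q) + emeasure P (A \<inter> {x \<in> space Q. L x = \<infinity>})) \<longleftrightarrow>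
     emeasure (density Q L) A = emeasure (density P (indicator {x \<in> space Q. L x < \<infinity>})) A"
    if L[measurable]: "L \<in> borel_measurable Q" and A[measurable]: "A \<in> sets Q" for A
  proof -
    define F where "F = {x \<in> space Q. L x < \<infinity>}"
    let ?I = "{x \<in> space Q. L x = \<infinity>}"
    have [measurable]: "F \<in> sets P" "A \<in> sets P" "?I \<in> sets P"
      using A by (auto simp: sets F_def)
    have "emeasure P A = emeasure P (F \<inter> A) + emeasure P (A \<inter> ?I)"
      by (subst plus_emeasure)
        (auto intro!: arg_cong[where f="emeasure P"] simp: sets F_def less_top dest: sets.sets_into_space[OF A, THEN subsetD])
    moreover have "emeasure (density P (indicator F)) A = emeasure P (F \<inter> A)"
      by (rule emeasure_restricted) auto
    moreover have "emeasure (density Q L) A = (\<integral>\<^sup>+x\<in>A. L x \<partial>Q)"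
      by (subst emeasure_density) auto
    \<comment> \<open>Cancelling a common summand in \<open>ennreal\<close> requires it to be
      finite.\<close>
    moreover have "emeasure P (A \<inter> ?I) \<noteq> \<infinity>" by simp
    ultimately show ?thesis unfolding F_def[symmetric]
      by (auto simp: add.commute[of _ "emeasure P (A \<inter> _)"])
  qed
  show ?thesis
    unfolding is_density_quotient_def
  proof (intro conj_cong refl)
    assume L: "L \<in> borel_measurable Q"
    show "(\<forall>A\<in>sets Q. emeasure P A = (\<integral>\<^sup>+x\<in>A. L x \<partial>Q) + emeasure P (A \<inter> {x \<in> space Q. L x = \<infinity>})) \<longleftrightarrow>
      density Q L = density P (indicator {x \<in> space Q. L x < \<infinity>})"
    proof
      assume "\<forall>A\<in>sets Q. emeasure P A = (\<integral>\<^sup>+x\<in>A. L x \<partial>Q) + emeasure P (A \<inter> {x \<in> space Q. L x = \<infinity>})"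
      then show "density Q L = density P (indicator {x \<in> space Q. L x < \<infinity>})"
        by (intro measure_eqI) (use eq[OF L] in \<open>simp_all add: sets\<close>)
    qed (use eq[OF L] in simp)
  qed
qed

text \<open>Both quotients are finite Q-almost everywhere, so each density may be restricted to the
  set where the other quotient is finite. Then both are P restricted to the same set, and densities
  with respect to a sigma-finite measure are unique.\<close>

lemma density_quotient_AE_unique:
  assumes P: "finite_measure P" and Q: "sigma_finite_measure Q" and sets: "sets P = sets Q"
    and L: "is_density_quotient P Q L" and L': "is_density_quotient P Q L'"
  shows "AE x in Q. L x = L' x"
proof -
  interpret Q: sigma_finite_measure Q by fact
  note L = L[unfolded is_density_quotient_iff[OF P sets]]
  note L' = L'[unfolded is_density_quotient_iff[OF P sets]]
  have [measurable]: "L \<in> borel_measurable Q" "L' \<in> borel_measurable Q" using L L' by auto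
  have sp: "space P = space Q" using sets by (rule sets_eq_imp_space_eq)
  have [measurable]: "Measurable.pred P (\<lambda>x. L x < \<infinity>)" "Measurable.pred P (\<lambda>x. L' x < \<infinity>)"
    by (simp_all add: measurable_cong_sets[OF sets refl])
  define F where "F = {x \<in> space Q. L x < \<infinity>}"
  define F' where "F' = {x \<in> space Q. L' x < \<infinity>}"
  have [measurable]: "F \<in> sets P" "F' \<in> sets P" "F \<in> sets Q" "F' \<in> sets Q"
    by (simp_all add: sets F_def F'_def)
  note L = L[folded F_def] and L' = L'[folded F'_def]
  have "density Q L = density (density Q L) (indicator F')"
    by (subst density_density_eq) (use L' in \<open>auto intro!: density_cong simp: F'_def indicator_def AE_conj_iff elim: eventually_mono\<close>)
  also have "\<dots> = density (density P (indicator F)) (indicator F')" using L by simp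
  also have "\<dots> = density (density P (indicator F')) (indicator F)"
    by (subst (1 2) density_density_eq) (auto simp: mult.commute)
  also have "\<dots> = density (density Q L') (indicator F)" using L' by simp
  also have "\<dots> = density Q L'"
    by (subst density_density_eq) (use L in \<open>auto intro!: density_cong simp: F_def indicator_def AE_conj_iff elim: eventually_mono\<close>)
  finally show ?thesis by (intro Q.density_unique) auto
qed

text \<open>Exhaustion: the supremum of the P-mass over Q-null sets is attained by the union of a
  maximising sequence. Such a set carries the whole singular part of P, since any further Q-null set
  of positive P-mass would exceed the supremum.\<close>

lemma maximal_null_set:
  assumes "finite_measure P" and sets: "sets P = sets Q"
  obtains N where "N \<in> null_sets Q" "\<And>A. A \<in> null_sets Q \<Longrightarrow> emeasure P (A - N) = 0"
proof -
  interpret P: finite_measure P by fact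
  define s where "s = (SUP N\<in>null_sets Q. measure P N)"
  have bdd: "bdd_above (measure P ` null_sets Q)"
    by (rule bdd_aboveI[of _ "measure P (space P)"]) (auto intro: P.bounded_measure)
  have "\<exists>N\<in>null_sets Q. s - 1 / real (Suc k) < measure P N" for k
    unfolding s_def by (rule less_cSUP_iff[THEN iffD1]) (use bdd in \<open>auto simp: null_sets_def intro!: exI[of _ "{}"]\<close>)
  then obtain N where N: "\<And>k. N k \<in> null_sets Q" "\<And>k. s - 1 / real (Suc k) < measure P (N k)"
    by metis
  define U where "U = (\<Union>k. N k)"
  have U: "U \<in> null_sets Q" unfolding U_def using N(1) by (intro null_sets_UN)
  have sU: "s \<le> measure P U"
  proof (rule field_le_epsilon)
    fix e :: real assume "e > 0"
    then obtain k where k: "1 / real (Suc k) < e" using reals_Archimedean by (auto simp: inverse_eq_divide)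
    have "measure P (N k) \<le> measure P U"
      using U by (intro P.finite_measure_mono) (auto simp: U_def sets null_sets_def)
    then show "s \<le> measure P U + e" using N(2)[of k] k by linarith
  qed
  show thesis
  proof (rule that[OF U])
    fix A assume A: "A \<in> null_sets Q"
    have ss: "U \<in> sets P" "A - U \<in> sets P"
      using A U by (auto simp: null_sets_def sets)
    have "measure P (U \<union> (A - U)) \<le> s"
      unfolding s_def using A U by (intro cSUP_upper bdd) (simp add: null_sets.Un)
    moreover have "measure P (U \<union> (A - U)) = measure P U + measure P (A - U)"
      using ss by (intro P.finite_measure_Union) auto
    ultimately have "measure P (A - U) = 0" using sU by (smt (verit) measure_nonneg)
    then show "emeasure P (A - U) = 0" by (simp add: P.emeasure_eq_measure)
  qed
qed

text \<open>Lebesgue decomposition: off the maximal null set N the measure P is absolutely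
  continuous and has a Radon-Nikodym derivative; on N the quotient is set to \<infinity>.\<close>

lemma density_quotient_exists:
  assumes P: "finite_measure P" and Q: "sigma_finite_measure Q" and sets: "sets P = sets Q"
  obtains L where "is_density_quotient P Q L"
proof -
  interpret P: finite_measure P by fact
  interpret Q: sigma_finite_measure Q by fact
  obtain N where N: "N \<in> null_sets Q" "\<And>A. A \<in> null_sets Q \<Longrightarrow> emeasure P (A - N) = 0"
    using maximal_null_set[OF P sets] by blast
  have sp: "space P = space Q" using sets by (rule sets_eq_imp_space_eq)
  have Ns[measurable]: "N \<in> sets Q" "N \<in> sets P" using N by (auto simp: sets null_sets_def)
  let ?D = "density P (indicator (space Q - N))"
  have [measurable]: "space Q - N \<in> sets P" using Ns by (simp add: sp[symmetric])
  have em: "emeasure ?D A = emeasure P (A - N)" if "A \<in> sets Q" for A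
  proof -
    have "emeasure ?D A = emeasure P ((space Q - N) \<inter> A)"
      using that by (intro emeasure_restricted) (auto simp: sets)
    also have "(space Q - N) \<inter> A = A - N" using sets.sets_into_space[OF that] by auto
    finally show ?thesis .
  qed
  have ac: "absolutely_continuous Q ?D"
    unfolding absolutely_continuous_def
  proof
    fix A assume A: "A \<in> null_sets Q"
    then show "A \<in> null_sets ?D" using N(2)[OF A] em[of A] by (auto simp: null_sets_def sets)
  qed
  have finD: "finite_measure ?D"
    by rule (use em[of "space Q"] in \<open>auto simp: sp P.emeasure_eq_measure\<close>)
  define r where "r = RN_deriv Q ?D"
  have [measurable]: "r \<in> borel_measurable Q" by (simp add: r_def)
  have dr: "density Q r = ?D"
    unfolding r_def using Q.density_RN_deriv[OF ac] by (simp add: sets)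
  have rfin: "AE x in Q. r x < \<infinity>"
    unfolding r_def using Q.RN_deriv_finite[OF finite_measure.axioms(1)[OF finD] ac]
    by (auto simp: sets less_top elim: eventually_mono)
  define L where "L x = (if x \<in> N then \<infinity> else r x)" for x
  have [measurable]: "L \<in> borel_measurable Q" unfolding L_def by measurable
  have LrQ: "AE x in Q. L x = r x"
    using AE_not_in[OF N(1)] by eventually_elim (simp add: L_def)
  have Lfin: "AE x in Q. L x < \<infinity>"
    using LrQ rfin by eventually_elim simp
  \<comment> \<open>The derivative may be infinite on a Q-null set outside N. Maximality of N makes
    this set P-null too, so the set where L is finite and the complement of N agree P-almost
    everywhere.\<close>
  have "{x \<in> space Q. r x = \<infinity>} \<in> null_sets Q"
    using AE_iff_null_sets[of "{x \<in> space Q. r x = \<infinity>}" Q] rfin by (auto elim: eventually_mono)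
  then have nul: "emeasure P ({x \<in> space Q. r x = \<infinity>} - N) = 0" by (rule N(2))
  have "density Q L = ?D"
    unfolding dr[symmetric] by (rule density_cong) (use LrQ in auto)
  also have "\<dots> = density P (indicator {x \<in> space Q. L x < \<infinity>})"
  proof (rule density_cong)
    have "AE x in P. x \<notin> {x \<in> space Q. r x = \<infinity>} - N"
      by (rule AE_not_in) (use nul in \<open>auto simp: null_sets_def sets\<close>)
    then show "AE x in P. (indicator (space Q - N) x :: ennreal) = indicator {x \<in> space Q. L x < \<infinity>} x"
      by eventually_elim (auto simp: L_def indicator_def less_top)
  qed (auto simp: sets measurable_cong_sets[OF sets refl])
  finally have "is_density_quotient P Q L"
    by (subst is_density_quotient_iff[OF P sets]) (use Lfin in auto)
  then show thesis by (rule that)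
qed

text \<open>The quotient is finite Q-almost everywhere, so \<open>enn2real\<close> loses nothing,
  and the integral is the mass of the part of P dominated by Q. Its defect from 1 is how singular
  masses are read off from roots of quotients.\<close>

lemma enn2real_density_quotient_integral:
  assumes P: "prob_space P" and sets: "sets P = sets Q" and L: "is_density_quotient P Q L"
  shows "integrable Q (\<lambda>x. enn2real (L x))"
    and "(\<integral>x. enn2real (L x) \<partial>Q) = 1 - measure P {x \<in> space P. L x = \<infinity>}"
proof -
  interpret P: prob_space P by fact
  have sp: "space P = space Q" using sets by (rule sets_eq_imp_space_eq)
  note L = L[unfolded is_density_quotient_iff[OF P.finite_measure_axioms sets]]
  have [measurable]: "L \<in> borel_measurable Q" "L \<in> borel_measurable P" using L measurable_cong_sets[OF sets refl] by auto
  have "(\<integral>\<^sup>+x. ennreal (enn2real (L x)) \<partial>Q) = (\<integral>\<^sup>+x. L x \<partial>Q)"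
    by (rule nn_integral_cong_AE) (use L in \<open>auto elim: eventually_mono\<close>)
  also have "\<dots> = emeasure (density Q L) (space Q)"
    by (subst emeasure_density) (auto intro!: nn_integral_cong)
  also have "\<dots> = emeasure P {x \<in> space P. L x < \<infinity>}"
    using L by (simp add: sp emeasure_density sets.sets_into_space measurable_cong_sets[OF sets refl])
      (subst emeasure_density, auto simp: sp[symmetric] indicator_inter_arith[symmetric] intro!: arg_cong[where f="emeasure P"])
  also have "\<dots> = ennreal (measure P {x \<in> space P. L x < \<infinity>})" by (simp add: P.emeasure_eq_measure)
  also have "measure P {x \<in> space P. L x < \<infinity>} = 1 - measure P {x \<in> space P. L x = \<infinity>}"
  proof -
    have "{x \<in> space P. L x < \<infinity>} = space P - {x \<in> space P. L x = \<infinity>}" by (auto simp: less_top)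
    then show ?thesis by (simp add: P.prob_compl[symmetric])
  qed
  finally have *: "(\<integral>\<^sup>+x. ennreal (enn2real (L x)) \<partial>Q) = ennreal (1 - measure P {x \<in> space P. L x = \<infinity>})" .
  then show "integrable Q (\<lambda>x. enn2real (L x))"
    by (intro integrableI_nonneg) auto
  show "(\<integral>x. enn2real (L x) \<partial>Q) = 1 - measure P {x \<in> space P. L x = \<infinity>}"
    by (rule integral_eq_nn_integral[THEN trans]) (use * in \<open>auto simp: P.prob_le_1\<close>)
qed

section \<open>Marginals and product integrands under a product measure\<close>

lemma (in prob_space) distr_pair_snd:
  assumes "sigma_finite_measure N"
  shows "distr (M \<Otimes>\<^sub>M N) N snd = N"
proof (rule measure_eqI)
  interpret N: sigma_finite_measure N by fact
  fix A assume A: "A \<in> sets (distr (M \<Otimes>\<^sub>M N) N snd)"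
  then have "emeasure (distr (M \<Otimes>\<^sub>M N) N snd) A = emeasure (M \<Otimes>\<^sub>M N) (space M \<times> A)"
    by (auto simp: emeasure_distr space_pair_measure dest: sets.sets_into_space intro!: arg_cong2[where f=emeasure])
  with A show "emeasure (distr (M \<Otimes>\<^sub>M N) N snd) A = emeasure N A"
    by (simp add: N.emeasure_pair_measure_Times emeasure_space_1)
qed simp

context pair_prob_space
begin

lemma distr_fst: "distr (M1 \<Otimes>\<^sub>M M2) M1 fst = M1"
  by (rule M2.distr_pair_fst)

lemma distr_snd: "distr (M1 \<Otimes>\<^sub>M M2) M2 snd = M2"
  by (rule M1.distr_pair_snd) (rule M2.sigma_finite_measure_axioms)

lemma AE_fst: "AE x in M1. R x \<Longrightarrow> AE z in M1 \<Otimes>\<^sub>M M2. R (fst z)"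
  by (rule AE_distrD[of fst _ M1]) (simp_all only: distr_fst measurable_fst)

lemma AE_snd: "AE x in M2. R x \<Longrightarrow> AE z in M1 \<Otimes>\<^sub>M M2. R (snd z)"
  by (rule AE_distrD[of snd _ M2]) (simp_all only: distr_snd measurable_snd)

lemma integral_of_fst:
  fixes f :: "_ \<Rightarrow> _::{banach, second_countable_topology}"
  assumes "f \<in> borel_measurable M1"
  shows "(\<integral>z. f (fst z) \<partial>(M1 \<Otimes>\<^sub>M M2)) = (\<integral>x. f x \<partial>M1)"
  using integral_distr[of fst "M1 \<Otimes>\<^sub>M M2" M1 f] assms by (simp add: distr_fst)

lemma integral_of_snd:
  fixes f :: "_ \<Rightarrow> _::{banach, second_countable_topology}"
  assumes "f \<in> borel_measurable M2"
  shows "(\<integral>z. f (snd z) \<partial>(M1 \<Otimes>\<^sub>M M2)) = (\<integral>x. f x \<partial>M2)"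
  using integral_distr[of snd "M1 \<Otimes>\<^sub>M M2" M2 f] assms by (simp add: distr_snd)

lemma integrable_of_fst:
  fixes f :: "_ \<Rightarrow> _::{banach, second_countable_topology}"
  assumes "integrable M1 f"
  shows "integrable (M1 \<Otimes>\<^sub>M M2) (\<lambda>z. f (fst z))"
  using integrable_distr_eq[of fst "M1 \<Otimes>\<^sub>M M2" M1 f] assms by (simp add: distr_fst)

lemma integrable_of_snd:
  fixes f :: "_ \<Rightarrow> _::{banach, second_countable_topology}"
  assumes "integrable M2 f"
  shows "integrable (M1 \<Otimes>\<^sub>M M2) (\<lambda>z. f (snd z))"
  using integrable_distr_eq[of snd "M1 \<Otimes>\<^sub>M M2" M2 f] assms by (simp add: distr_snd)

lemma L2_of_fst: "f \<in> L2 M1 \<Longrightarrow> (\<lambda>z. f (fst z)) \<in> L2 (M1 \<Otimes>\<^sub>M M2)"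
  using integrable_of_fst[of "\<lambda>x. (f x)\<^sup>2"] by (auto simp: L2_def)

lemma L2_of_snd: "f \<in> L2 M2 \<Longrightarrow> (\<lambda>z. f (snd z)) \<in> L2 (M1 \<Otimes>\<^sub>M M2)"
  using integrable_of_snd[of "\<lambda>x. (f x)\<^sup>2"] by (auto simp: L2_def)

lemma
  fixes f g :: "_ \<Rightarrow> _::{real_normed_field, banach, second_countable_topology}"
  assumes f: "integrable M1 f" and g: "integrable M2 g"
  shows integrable_times: "integrable (M1 \<Otimes>\<^sub>M M2) (\<lambda>z. f (fst z) * g (snd z))"
    and integral_times: "(\<integral>z. f (fst z) * g (snd z) \<partial>(M1 \<Otimes>\<^sub>M M2)) = (\<integral>x. f x \<partial>M1) * (\<integral>y. g y \<partial>M2)"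
proof -
  have [measurable]: "f \<in> borel_measurable M1" "g \<in> borel_measurable M2" using f g by auto
  show *: "integrable (M1 \<Otimes>\<^sub>M M2) (\<lambda>z. f (fst z) * g (snd z))"
  proof (rule integrableI_bounded)
    have "(\<integral>\<^sup>+z. ennreal (norm (f (fst z) * g (snd z))) \<partial>(M1 \<Otimes>\<^sub>M M2)) =
        (\<integral>\<^sup>+x. \<integral>\<^sup>+y. ennreal (norm (f x)) * ennreal (norm (g y)) \<partial>M2 \<partial>M1)"
      by (subst M2.nn_integral_fst[symmetric]) (auto simp: norm_mult ennreal_mult)
    also have "\<dots> = (\<integral>\<^sup>+x. ennreal (norm (f x)) \<partial>M1) * (\<integral>\<^sup>+y. ennreal (norm (g y)) \<partial>M2)"
      by (simp add: nn_integral_cmult nn_integral_multc)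
    also have "\<dots> < \<infinity>"
      using f g by (simp add: integrable_iff_bounded ennreal_mult_less_top)
    finally show "(\<integral>\<^sup>+z. ennreal (norm (f (fst z) * g (snd z))) \<partial>(M1 \<Otimes>\<^sub>M M2)) < \<infinity>" .
  qed simp
  show "(\<integral>z. f (fst z) * g (snd z) \<partial>(M1 \<Otimes>\<^sub>M M2)) = (\<integral>x. f x \<partial>M1) * (\<integral>y. g y \<partial>M2)"
    using f g by (subst integral_fst'[OF *, symmetric]) simp
qed

end

text \<open>The product of the quotients has to be redirected to \<open>\<infinity>\<close> because \<open>\<infinity> * 0 = 0\<close> in \<^typ>\<open>ennreal\<close>.\<close>

lemma density_quotient_pair:
  assumes P: "prob_space P" "prob_space P'" "sets P = sets P'"
    and Q: "prob_space Q" "prob_space Q'" "sets Q = sets Q'"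
    and p: "is_density_quotient P P' p" and q: "is_density_quotient Q Q' q"
  shows "is_density_quotient (P \<Otimes>\<^sub>M Q) (P' \<Otimes>\<^sub>M Q')
    (\<lambda>z. if p (fst z) = \<infinity> \<or> q (snd z) = \<infinity> then \<infinity> else p (fst z) * q (snd z))"
    (is "is_density_quotient _ _ ?L")
proof -
  interpret P: prob_space P by fact
  interpret P': prob_space P' by fact
  interpret Q: prob_space Q by fact
  interpret Q': prob_space Q' by fact
  interpret PQ: pair_prob_space P Q ..
  interpret PQ': pair_prob_space P' Q' ..
  have sets: "sets (P \<Otimes>\<^sub>M Q) = sets (P' \<Otimes>\<^sub>M Q')"
    using P Q by (intro sets_pair_measure_cong)
  note p = p[unfolded is_density_quotient_iff[OF P.finite_measure_axioms P(3)]]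
  note q = q[unfolded is_density_quotient_iff[OF Q.finite_measure_axioms Q(3)]]
  have sp: "space P = space P'" "space Q = space Q'"
    using P Q by (auto dest: sets_eq_imp_space_eq)
  have [measurable]: "p \<in> borel_measurable P'" "p \<in> borel_measurable P"
      "q \<in> borel_measurable Q'" "q \<in> borel_measurable Q"
    using p q measurable_cong_sets[OF P(3) refl] measurable_cong_sets[OF Q(3) refl] by auto
  define Fp where "Fp = {x \<in> space P'. p x < \<infinity>}"
  define Fq where "Fq = {x \<in> space Q'. q x < \<infinity>}"
  have [measurable]: "Fp \<in> sets P'" "Fp \<in> sets P" "Fq \<in> sets Q'" "Fq \<in> sets Q"
    unfolding P(3) Q(3) Fp_def Fq_def by measurable
  note p = p[folded Fp_def] and q = q[folded Fq_def]
  have [measurable]: "?L \<in> borel_measurable (P' \<Otimes>\<^sub>M Q')" by measurable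
  have finp: "finite_measure (density P (indicator Fp))" "finite_measure (density Q (indicator Fq))"
    by (auto intro!: finite_measureI simp: emeasure_restricted)
  have ae: "AE z in P' \<Otimes>\<^sub>M Q'. p (fst z) < \<infinity> \<and> q (snd z) < \<infinity>"
    using PQ'.AE_fst[of "\<lambda>x. p x < \<infinity>"] PQ'.AE_snd[of "\<lambda>x. q x < \<infinity>"] p q
    by (simp add: AE_conj_iff)
  \<comment> \<open>The redirection to \<infinity> takes place on a null set of the base measure and
    leaves the density unchanged.\<close>
  have "density (P' \<Otimes>\<^sub>M Q') ?L = density (P' \<Otimes>\<^sub>M Q') (\<lambda>(x, y). p x * q y)"
  proof (rule density_cong)
    show "AE z in P' \<Otimes>\<^sub>M Q'. ?L z = (case z of (x, y) \<Rightarrow> p x * q y)"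
      using ae by eventually_elim (auto simp: less_top split: prod.split)
  qed auto
  also have "\<dots> = density P' p \<Otimes>\<^sub>M density Q' q"
    by (rule pair_measure_density[symmetric])
      (use p q finp finite_measure.axioms(1) Q'.sigma_finite_measure_axioms in auto)
  also have "\<dots> = density P (indicator Fp) \<Otimes>\<^sub>M density Q (indicator Fq)" using p q by simp
  also have "\<dots> = density (P \<Otimes>\<^sub>M Q) (\<lambda>(x, y). indicator Fp x * indicator Fq y)"
    by (rule pair_measure_density)
      (use p q finp finite_measure.axioms(1) Q.sigma_finite_measure_axioms in auto)
  \<comment> \<open>Thanks to the redirection, the product quotient is finite exactly on
    \<open>Fp \<times> Fq\<close>.\<close>
  also have "\<dots> = density (P \<Otimes>\<^sub>M Q) (indicator {x \<in> space (P' \<Otimes>\<^sub>M Q'). ?L x < \<infinity>})"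
  proof (rule density_cong)
    show "AE x in P \<Otimes>\<^sub>M Q. (case x of (x, y) \<Rightarrow> indicator Fp x * indicator Fq y) =
        (indicator {x \<in> space (P' \<Otimes>\<^sub>M Q'). ?L x < \<infinity>} x :: ennreal)"
      by (rule AE_I2) (auto simp: Fp_def Fq_def space_pair_measure sp indicator_def less_top ennreal_mult_less_top)
  qed (auto simp: sets measurable_cong_sets[OF sets refl])
  finally have "density (P' \<Otimes>\<^sub>M Q') ?L = density (P \<Otimes>\<^sub>M Q) (indicator {x \<in> space (P' \<Otimes>\<^sub>M Q'). ?L x < \<infinity>})" .
  moreover have "AE z in P' \<Otimes>\<^sub>M Q'. ?L z < \<infinity>"
    using ae by eventually_elim (auto simp: ennreal_mult_less_top)
  ultimately show ?thesis
    by (subst is_density_quotient_iff[OF PQ.finite_measure_axioms sets]) auto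
qed

section \<open>Differentiable curves of product measures\<close>

text \<open>The remainders below are bounded by sums of integrals of squares, so the condition on
  norms is traded for one on squared norms divided by \<open>t\<^sup>2\<close>.\<close>

lemma L2_norm_smallo_iff:
  "(\<lambda>t. L2_norm M (f t)) \<in> o[at 0](\<lambda>t. \<bar>t\<bar>) \<longleftrightarrow> ((\<lambda>t. (\<integral>x. (f t x)\<^sup>2 \<partial>M) / t\<^sup>2) \<longlongrightarrow> 0) (at 0)"
proof -
  let ?I = "\<lambda>t. \<integral>x. (f t x)\<^sup>2 \<partial>M"
  have eq: "sqrt (?I t / t\<^sup>2) = L2_norm M (f t) / \<bar>t\<bar>" for t
    by (simp add: L2_norm_def real_sqrt_divide)
  have "(\<lambda>t. L2_norm M (f t)) \<in> o[at 0](\<lambda>t. \<bar>t\<bar>) \<longleftrightarrow> ((\<lambda>t. sqrt (?I t / t\<^sup>2)) \<longlongrightarrow> 0) (at 0)"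
    unfolding eq
    by (rule iffI, erule smalloD_tendsto, rule smalloI_tendsto) (auto simp: eventually_at_filter)
  also have "\<dots> \<longleftrightarrow> ((\<lambda>t. ?I t / t\<^sup>2) \<longlongrightarrow> 0) (at 0)"
  proof
    assume "((\<lambda>t. sqrt (?I t / t\<^sup>2)) \<longlongrightarrow> 0) (at 0)"
    from tendsto_power[OF this, of 2] show "((\<lambda>t. ?I t / t\<^sup>2) \<longlongrightarrow> 0) (at 0)"
      by simp
  next
    assume "((\<lambda>t. ?I t / t\<^sup>2) \<longlongrightarrow> 0) (at 0)"
    from tendsto_real_sqrt[OF this] show "((\<lambda>t. sqrt (?I t / t\<^sup>2)) \<longlongrightarrow> 0) (at 0)"
      by simp
  qed
  finally show ?thesis .
qed

lemma smallo_power2_iff: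
  "f \<in> o[at 0](\<lambda>t. t\<^sup>2) \<longleftrightarrow> ((\<lambda>t. f t / t\<^sup>2) \<longlongrightarrow> 0) (at (0::real))" for f :: "real \<Rightarrow> real"
  by (rule iffI, erule smalloD_tendsto, rule smalloI_tendsto) (auto simp: eventually_at_filter)

context pair_prob_space
begin

text \<open>The conditional expectation of g given the first coordinate under the product
  measure.\<close>

definition partial_fst :: "('a \<times> 'b \<Rightarrow> real) \<Rightarrow> 'a \<Rightarrow> real" where
  "partial_fst g x = (\<integral>y. g (x, y) \<partial>M2)"

definition partial_snd :: "('a \<times> 'b \<Rightarrow> real) \<Rightarrow> 'b \<Rightarrow> real" where
  "partial_snd g y = (\<integral>x. g (x, y) \<partial>M1)"

text \<open>Conditional expectation contracts the L2 norm: Jensen's inequality on almost every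
  section, followed by Fubini.\<close>

lemma L2_partial_fst:
  assumes g: "g \<in> L2 (M1 \<Otimes>\<^sub>M M2)"
  shows "partial_fst g \<in> L2 M1"
    and "(\<integral>x. (partial_fst g x)\<^sup>2 \<partial>M1) \<le> (\<integral>z. (g z)\<^sup>2 \<partial>(M1 \<Otimes>\<^sub>M M2))"
    and "(\<integral>x. partial_fst g x \<partial>M1) = (\<integral>z. g z \<partial>(M1 \<Otimes>\<^sub>M M2))"
    and "AE x in M1. (\<lambda>y. g (x, y)) \<in> L2 M2"
proof -
  have [measurable]: "g \<in> borel_measurable (M1 \<Otimes>\<^sub>M M2)" using g by (simp add: L2_def)
  have gi: "integrable (M1 \<Otimes>\<^sub>M M2) g" "integrable (M1 \<Otimes>\<^sub>M M2) (\<lambda>z. (g z)\<^sup>2)"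
    using L2_integrable[OF g] L2_square_integrable[OF g] by auto
  show 1: "AE x in M1. (\<lambda>y. g (x, y)) \<in> L2 M2"
    using AE_integrable_fst'[OF gi(2)] AE_space
    by eventually_elim (auto simp: L2_def intro: measurable_Pair2)
  have le: "AE x in M1. (partial_fst g x)\<^sup>2 \<le> (\<integral>y. (g (x, y))\<^sup>2 \<partial>M2)"
    using 1 by eventually_elim (auto simp: partial_fst_def intro!: M2.square_integral_le)
  have m[measurable]: "partial_fst g \<in> borel_measurable M1" unfolding partial_fst_def by measurable
  have int: "integrable M1 (\<lambda>x. (partial_fst g x)\<^sup>2)"
    by (rule Bochner_Integration.integrable_bound[OF integrable_fst'[OF gi(2)]])
      (use le in \<open>auto elim!: eventually_mono\<close>)
  then show "partial_fst g \<in> L2 M1" by (simp add: L2_def)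
  have "(\<integral>x. (partial_fst g x)\<^sup>2 \<partial>M1) \<le> (\<integral>x. \<integral>y. (g (x, y))\<^sup>2 \<partial>M2 \<partial>M1)"
    by (rule integral_mono_AE[OF int integrable_fst'[OF gi(2)] le])
  also have "\<dots> = (\<integral>z. (g z)\<^sup>2 \<partial>(M1 \<Otimes>\<^sub>M M2))"
    by (rule integral_fst'[OF gi(2)])
  finally show "(\<integral>x. (partial_fst g x)\<^sup>2 \<partial>M1) \<le> (\<integral>z. (g z)\<^sup>2 \<partial>(M1 \<Otimes>\<^sub>M M2))" .
  show "(\<integral>x. partial_fst g x \<partial>M1) = (\<integral>z. g z \<partial>(M1 \<Otimes>\<^sub>M M2))"
    unfolding partial_fst_def by (rule integral_fst'[OF gi(1)])
qed

lemma swap_pair_prob_space: "pair_prob_space M2 M1" ..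

text \<open>Statements on the second factor are reduced to those on the first by exchanging the
  coordinates.\<close>

lemma partial_snd_swap: "partial_snd g = pair_prob_space.partial_fst M1 (\<lambda>(y, x). g (x, y))"
  by (intro ext) (simp add: partial_snd_def pair_prob_space.partial_fst_def[OF swap_pair_prob_space])

lemma integral_swap:
  fixes f :: "_ \<Rightarrow> _::{banach, second_countable_topology}"
  assumes "f \<in> borel_measurable (M1 \<Otimes>\<^sub>M M2)"
  shows "(\<integral>z. (case z of (y, x) \<Rightarrow> f (x, y)) \<partial>(M2 \<Otimes>\<^sub>M M1)) = (\<integral>z. f z \<partial>(M1 \<Otimes>\<^sub>M M2))"
  by (rule integral_product_swap[OF assms])

lemma L2_swap: "g \<in> L2 (M1 \<Otimes>\<^sub>M M2) \<Longrightarrow> (\<lambda>(y, x). g (x, y)) \<in> L2 (M2 \<Otimes>\<^sub>M M1)"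
  using integrable_product_swap[of "\<lambda>z. (g z)\<^sup>2"]
  by (auto simp: L2_def case_prod_unfold measurable_pair_swap)

text \<open>Averaging over the second factor shows that \<open>\<xi>\<close> itself is close to its linear
  approximation, because the mean of \<open>\<eta>\<close> differs from 1 only by a second order term.\<close>

lemma root_product_mean:
  fixes \<xi> :: "'a \<Rightarrow> real" and \<eta> :: "'b \<Rightarrow> real" and t :: real
  assumes \<xi>: "\<xi> \<in> L2 M1" "\<And>x. 0 \<le> \<xi> x" "(\<integral>x. (\<xi> x)\<^sup>2 \<partial>M1) \<le> 1"
    and \<eta>: "\<eta> \<in> L2 M2" "\<And>y. 0 \<le> \<eta> y" "(\<integral>y. (\<eta> y)\<^sup>2 \<partial>M2) \<le> 1"
    and g: "g \<in> L2 (M1 \<Otimes>\<^sub>M M2)"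
    and E: "E = (\<integral>z. (2 * (\<xi> (fst z) * \<eta> (snd z) - 1) - t * g z)\<^sup>2 \<partial>(M1 \<Otimes>\<^sub>M M2))"
    and \<delta>: "\<delta> = 1 - (\<integral>x. \<xi> x \<partial>M1) * (\<integral>y. \<eta> y \<partial>M2)"
  shows "0 \<le> \<delta>"
    and "\<delta> \<le> (1 - (\<integral>x. (\<xi> x)\<^sup>2 \<partial>M1) * (\<integral>y. (\<eta> y)\<^sup>2 \<partial>M2)) / 2 + E / 4 + t\<^sup>2 * (\<integral>z. (g z)\<^sup>2 \<partial>(M1 \<Otimes>\<^sub>M M2)) / 4"
    and "(2 * \<delta> + t * (\<integral>z. g z \<partial>(M1 \<Otimes>\<^sub>M M2)))\<^sup>2 \<le> E"
    and "(\<integral>x. (2 * (\<xi> x - 1) - t * partial_fst g x)\<^sup>2 \<partial>M1) \<le> 2 * E + 8 * \<delta>\<^sup>2"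
    and "(\<integral>x. (\<xi> x - 1)\<^sup>2 \<partial>M1) \<le> 2 * \<delta>"
    and "(\<integral>y. (\<eta> y - 1)\<^sup>2 \<partial>M2) \<le> 2 * \<delta>"
proof -
  define l where "l = (\<integral>x. \<xi> x \<partial>M1)"
  define m where "m = (\<integral>y. \<eta> y \<partial>M2)"
  have [measurable]: "g \<in> borel_measurable (M1 \<Otimes>\<^sub>M M2)" "\<xi> \<in> borel_measurable M1" "\<eta> \<in> borel_measurable M2"
    using g \<xi> \<eta> by (auto simp: L2_def)
  have gi: "integrable (M1 \<Otimes>\<^sub>M M2) g" "integrable (M1 \<Otimes>\<^sub>M M2) (\<lambda>z. (g z)\<^sup>2)"
    using L2_integrable[OF g] L2_square_integrable[OF g] by auto
  have \<xi>i: "integrable M1 \<xi>" "integrable M1 (\<lambda>x. (\<xi> x)\<^sup>2)" and \<eta>i: "integrable M2 \<eta>" "integrable M2 (\<lambda>x. (\<eta> x)\<^sup>2)"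
    using M1.L2_integrable[OF \<xi>(1)] M2.L2_integrable[OF \<eta>(1)] L2_square_integrable[OF \<xi>(1)]
      L2_square_integrable[OF \<eta>(1)] by auto
  have l: "0 \<le> l" "l \<le> 1"
  proof -
    show "0 \<le> l" using \<xi> by (simp add: l_def)
    have "l\<^sup>2 \<le> 1" using M1.square_integral_le[OF \<xi>(1)] \<xi>(3) by (simp add: l_def)
    then show "l \<le> 1" using power2_le_imp_le[of l 1] by simp
  qed
  have m: "0 \<le> m" "m \<le> 1"
  proof -
    show "0 \<le> m" using \<eta> by (simp add: m_def)
    have "m\<^sup>2 \<le> 1" using M2.square_integral_le[OF \<eta>(1)] \<eta>(3) by (simp add: m_def)
    then show "m \<le> 1" using power2_le_imp_le[of m 1] by simp
  qed
  have \<delta>': "\<delta> = 1 - l * m" by (simp add: \<delta> l_def m_def)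
  have ml: "l * m \<le> m" "l * m \<le> l" using l m mult_right_mono[OF l(2) m(1)] mult_left_mono[OF m(2) l(1)] by auto
  show \<delta>0: "0 \<le> \<delta>" using mult_le_one[OF l(2) m] by (simp add: \<delta>')
  let ?R = "\<lambda>z. \<xi> (fst z) * \<eta> (snd z)"
  let ?D = "\<lambda>z. 2 * (?R z - 1) - t * g z"
  have RL2: "?R \<in> L2 (M1 \<Otimes>\<^sub>M M2)"
    using integrable_times[OF \<xi>i(2) \<eta>i(2)] by (auto simp: L2_def power_mult_distrib)
  have Ri: "integrable (M1 \<Otimes>\<^sub>M M2) ?R" "(\<integral>z. ?R z \<partial>(M1 \<Otimes>\<^sub>M M2)) = l * m"
    using integrable_times[OF \<xi>i(1) \<eta>i(1)] integral_times[OF \<xi>i(1) \<eta>i(1)] by (auto simp: l_def m_def)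
  have R2: "(\<integral>z. (?R z)\<^sup>2 \<partial>(M1 \<Otimes>\<^sub>M M2)) = (\<integral>x. (\<xi> x)\<^sup>2 \<partial>M1) * (\<integral>y. (\<eta> y)\<^sup>2 \<partial>M2)"
    using integral_times[OF \<xi>i(2) \<eta>i(2)] by (simp add: power_mult_distrib)
  have R1: "(\<lambda>z. ?R z - 1) \<in> L2 (M1 \<Otimes>\<^sub>M M2)" by (rule L2_diff[OF RL2 L2_const])
  have DL2: "?D \<in> L2 (M1 \<Otimes>\<^sub>M M2)" by (intro L2_diff L2_scale R1 g)
  have D2i: "integrable (M1 \<Otimes>\<^sub>M M2) (\<lambda>z. (?D z)\<^sup>2)" using DL2 by (simp add: L2_def)
  have R12: "(\<integral>z. (?R z - 1)\<^sup>2 \<partial>(M1 \<Otimes>\<^sub>M M2)) = (\<integral>x. (\<xi> x)\<^sup>2 \<partial>M1) * (\<integral>y. (\<eta> y)\<^sup>2 \<partial>M2) + 1 - 2 * (l * m)"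
  proof -
    have "(\<integral>z. (?R z - 1)\<^sup>2 \<partial>(M1 \<Otimes>\<^sub>M M2)) = (\<integral>z. (?R z)\<^sup>2 + 1 - 2 * ?R z \<partial>(M1 \<Otimes>\<^sub>M M2))"
      by (intro Bochner_Integration.integral_cong) (auto simp: power2_eq_square algebra_simps)
    also have "\<dots> = (\<integral>z. (?R z)\<^sup>2 \<partial>(M1 \<Otimes>\<^sub>M M2)) + 1 - 2 * (l * m)"
      using RL2[THEN L2_square_integrable] Ri by (simp add: prob_space)
    finally show ?thesis by (simp add: R2)
  qed
  \<comment> \<open>By \<open>R12\<close> the squared distance of the root from 1 is
    \<open>2 * \<delta>\<close> minus the defect of the product of second moments from 1. An L2
    bound on it therefore bounds \<delta> itself, not only its square; this is the source of the
    second order.\<close>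
  have "4 * (\<integral>z. (?R z - 1)\<^sup>2 \<partial>(M1 \<Otimes>\<^sub>M M2)) = (\<integral>z. 4 * (?R z - 1)\<^sup>2 \<partial>(M1 \<Otimes>\<^sub>M M2))" by simp
  also have "\<dots> \<le> (\<integral>z. 2 * (?D z)\<^sup>2 + 2 * (t\<^sup>2 * (g z)\<^sup>2) \<partial>(M1 \<Otimes>\<^sub>M M2))"
  proof (rule integral_mono)
    show "4 * (?R z - 1)\<^sup>2 \<le> 2 * (?D z)\<^sup>2 + 2 * (t\<^sup>2 * (g z)\<^sup>2)" for z
    proof -
      have "2 * (?D z)\<^sup>2 + 2 * (t\<^sup>2 * (g z)\<^sup>2) - 4 * (?R z - 1)\<^sup>2 = (?D z - t * g z)\<^sup>2"
        by (simp add: power2_eq_square algebra_simps)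
      also have "\<dots> \<ge> 0" by simp
      finally show ?thesis by simp
    qed
  qed (use R1 D2i gi in \<open>auto simp: L2_def\<close>)
  also have "\<dots> = 2 * E + 2 * (t\<^sup>2 * (\<integral>z. (g z)\<^sup>2 \<partial>(M1 \<Otimes>\<^sub>M M2)))"
    using D2i gi by (simp add: E)
  finally show "\<delta> \<le> (1 - (\<integral>x. (\<xi> x)\<^sup>2 \<partial>M1) * (\<integral>y. (\<eta> y)\<^sup>2 \<partial>M2)) / 2 + E / 4 + t\<^sup>2 * (\<integral>z. (g z)\<^sup>2 \<partial>(M1 \<Otimes>\<^sub>M M2)) / 4"
    unfolding R12 \<delta>' by (simp add: field_simps)
  have "(\<integral>z. ?D z \<partial>(M1 \<Otimes>\<^sub>M M2)) = - (2 * \<delta> + t * (\<integral>z. g z \<partial>(M1 \<Otimes>\<^sub>M M2)))"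
    using Ri gi by (simp add: \<delta>' prob_space algebra_simps)
  then show "(2 * \<delta> + t * (\<integral>z. g z \<partial>(M1 \<Otimes>\<^sub>M M2)))\<^sup>2 \<le> E"
    using square_integral_le[OF DL2] unfolding E by (simp only: power2_minus)
  \<comment> \<open>Averaging leaves the mean m in front of \<xi>. Replacing m by 1 costs
    \<open>2 * (1 - m) * \<xi> x\<close>, and \<open>1 - m \<le> \<delta>\<close> because the mean
    of \<xi> is at most 1.\<close>
  have pD: "partial_fst ?D x = 2 * (m * \<xi> x - 1) - t * partial_fst g x" if "(\<lambda>y. g (x, y)) \<in> L2 M2" for x
    using M2.L2_integrable[OF that] \<eta>i by (simp add: partial_fst_def m_def M2.prob_space)
  have pL2: "partial_fst g \<in> L2 M1" by (rule L2_partial_fst(1)[OF g])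
  have xL2: "(\<lambda>x. 2 * (\<xi> x - 1) - t * partial_fst g x) \<in> L2 M1"
    by (intro L2_diff L2_scale pL2 M1.L2_const \<xi>)
  have pDL2: "partial_fst ?D \<in> L2 M1" by (rule L2_partial_fst(1)[OF DL2])
  have "(\<integral>x. (2 * (\<xi> x - 1) - t * partial_fst g x)\<^sup>2 \<partial>M1) \<le>
      (\<integral>x. 2 * (partial_fst ?D x)\<^sup>2 + 8 * (1 - m)\<^sup>2 * (\<xi> x)\<^sup>2 \<partial>M1)"
  proof (rule integral_mono_AE)
    show "AE x in M1. (2 * (\<xi> x - 1) - t * partial_fst g x)\<^sup>2 \<le> 2 * (partial_fst ?D x)\<^sup>2 + 8 * (1 - m)\<^sup>2 * (\<xi> x)\<^sup>2"
      using L2_partial_fst(4)[OF g]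
    proof eventually_elim
      fix x assume x: "(\<lambda>y. g (x, y)) \<in> L2 M2"
      define u where "u = partial_fst ?D x"
      define v where "v = 2 * (1 - m) * \<xi> x"
      have "2 * (\<xi> x - 1) - t * partial_fst g x = u + v" unfolding u_def v_def pD[OF x] by (simp add: algebra_simps)
      moreover have "2 * u\<^sup>2 + 2 * v\<^sup>2 - (u + v)\<^sup>2 = (u - v)\<^sup>2" by (simp add: power2_eq_square algebra_simps)
      moreover have "2 * v\<^sup>2 = 8 * (1 - m)\<^sup>2 * (\<xi> x)\<^sup>2" by (simp add: v_def power2_eq_square algebra_simps)
      ultimately show "(2 * (\<xi> x - 1) - t * partial_fst g x)\<^sup>2 \<le> 2 * (partial_fst ?D x)\<^sup>2 + 8 * (1 - m)\<^sup>2 * (\<xi> x)\<^sup>2"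
        unfolding u_def[symmetric] by (smt (verit) zero_le_power2)
    qed
  qed (use xL2 pDL2 \<xi>i in \<open>auto simp: L2_def\<close>)
  also have "\<dots> = 2 * (\<integral>x. (partial_fst ?D x)\<^sup>2 \<partial>M1) + 8 * (1 - m)\<^sup>2 * (\<integral>x. (\<xi> x)\<^sup>2 \<partial>M1)"
    using pDL2 \<xi>i by (simp add: L2_def)
  also have "\<dots> \<le> 2 * E + 8 * \<delta>\<^sup>2"
  proof (intro add_mono mult_left_mono)
    show "(\<integral>x. (partial_fst ?D x)\<^sup>2 \<partial>M1) \<le> E" unfolding E by (rule L2_partial_fst(2)[OF DL2])
    have "(1 - m)\<^sup>2 \<le> \<delta>\<^sup>2" using m ml by (intro power_mono) (auto simp: \<delta>')
    moreover have "(1 - m)\<^sup>2 * (\<integral>x. (\<xi> x)\<^sup>2 \<partial>M1) \<le> (1 - m)\<^sup>2" using \<xi>(3) by (intro mult_left_le) auto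
    ultimately show "8 * (1 - m)\<^sup>2 * (\<integral>x. (\<xi> x)\<^sup>2 \<partial>M1) \<le> 8 * \<delta>\<^sup>2" by simp
  qed simp
  finally show "(\<integral>x. (2 * (\<xi> x - 1) - t * partial_fst g x)\<^sup>2 \<partial>M1) \<le> 2 * E + 8 * \<delta>\<^sup>2" .
  have "(\<integral>x. (\<xi> x - 1)\<^sup>2 \<partial>M1) = (\<integral>x. (\<xi> x)\<^sup>2 + 1 - 2 * \<xi> x \<partial>M1)"
    by (intro Bochner_Integration.integral_cong) (auto simp: power2_eq_square algebra_simps)
  also have "\<dots> = (\<integral>x. (\<xi> x)\<^sup>2 \<partial>M1) + 1 - 2 * l" using \<xi>i by (simp add: l_def M1.prob_space)
  finally show "(\<integral>x. (\<xi> x - 1)\<^sup>2 \<partial>M1) \<le> 2 * \<delta>" using \<xi>(3) ml by (simp add: \<delta>')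
  have "(\<integral>x. (\<eta> x - 1)\<^sup>2 \<partial>M2) = (\<integral>x. (\<eta> x)\<^sup>2 + 1 - 2 * \<eta> x \<partial>M2)"
    by (intro Bochner_Integration.integral_cong) (auto simp: power2_eq_square algebra_simps)
  also have "\<dots> = (\<integral>x. (\<eta> x)\<^sup>2 \<partial>M2) + 1 - 2 * m" using \<eta>i by (simp add: m_def M2.prob_space)
  finally show "(\<integral>x. (\<eta> x - 1)\<^sup>2 \<partial>M2) \<le> 2 * \<delta>" using \<eta>(3) ml by (simp add: \<delta>')
qed

lemma L2_partial_snd:
  assumes g: "g \<in> L2 (M1 \<Otimes>\<^sub>M M2)"
  shows "partial_snd g \<in> L2 M2"
    and "(\<integral>y. partial_snd g y \<partial>M2) = (\<integral>z. g z \<partial>(M1 \<Otimes>\<^sub>M M2))"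
  using pair_prob_space.L2_partial_fst(1,3)[OF swap_pair_prob_space L2_swap[OF g]] integral_swap[of g] g
  by (auto simp: partial_snd_swap L2_def)

lemma root_product_mean_snd:
  fixes \<xi> :: "'a \<Rightarrow> real" and \<eta> :: "'b \<Rightarrow> real" and t :: real
  assumes \<xi>: "\<xi> \<in> L2 M1" "\<And>x. 0 \<le> \<xi> x" "(\<integral>x. (\<xi> x)\<^sup>2 \<partial>M1) \<le> 1"
    and \<eta>: "\<eta> \<in> L2 M2" "\<And>y. 0 \<le> \<eta> y" "(\<integral>y. (\<eta> y)\<^sup>2 \<partial>M2) \<le> 1"
    and g: "g \<in> L2 (M1 \<Otimes>\<^sub>M M2)"
    and E: "E = (\<integral>z. (2 * (\<xi> (fst z) * \<eta> (snd z) - 1) - t * g z)\<^sup>2 \<partial>(M1 \<Otimes>\<^sub>M M2))"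
    and \<delta>: "\<delta> = 1 - (\<integral>x. \<xi> x \<partial>M1) * (\<integral>y. \<eta> y \<partial>M2)"
  shows "(\<integral>y. (2 * (\<eta> y - 1) - t * partial_snd g y)\<^sup>2 \<partial>M2) \<le> 2 * E + 8 * \<delta>\<^sup>2"
proof -
  have [measurable]: "g \<in> borel_measurable (M1 \<Otimes>\<^sub>M M2)" "\<xi> \<in> borel_measurable M1" "\<eta> \<in> borel_measurable M2"
    using g \<xi> \<eta> by (auto simp: L2_def)
  have "E = (\<integral>z. (2 * (\<eta> (fst z) * \<xi> (snd z) - 1) - t * (case z of (y, x) \<Rightarrow> g (x, y)))\<^sup>2 \<partial>(M2 \<Otimes>\<^sub>M M1))"
    unfolding E by (subst integral_swap[symmetric]) (auto simp: case_prod_unfold mult.commute)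
  from pair_prob_space.root_product_mean(4)[OF swap_pair_prob_space \<eta> \<xi> L2_swap[OF g] this, of \<delta>]
  show ?thesis by (simp add: partial_snd_swap \<delta> mult.commute)
qed

text \<open>With \<open>X = \<xi> - 1\<close> and \<open>Y = \<eta> - 1\<close> one has
  \<open>\<xi> * \<eta> - 1 = X + Y + X * Y\<close>. Subtracting the linear approximations of the
  product and of both factors leaves \<open>2 * X * Y\<close> as the only interaction, and its
  squared norm is a product of two terms of order \<delta>. As the left side is a constant times
  \<open>t\<^sup>2\<close>, a bound of smaller order will force g to be additive.\<close>

lemma root_product_additive:
  fixes \<xi> :: "'a \<Rightarrow> real" and \<eta> :: "'b \<Rightarrow> real" and t :: real
  assumes \<xi>: "\<xi> \<in> L2 M1" "\<And>x. 0 \<le> \<xi> x" "(\<integral>x. (\<xi> x)\<^sup>2 \<partial>M1) \<le> 1"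
    and \<eta>: "\<eta> \<in> L2 M2" "\<And>y. 0 \<le> \<eta> y" "(\<integral>y. (\<eta> y)\<^sup>2 \<partial>M2) \<le> 1"
    and g: "g \<in> L2 (M1 \<Otimes>\<^sub>M M2)"
    and E: "E = (\<integral>z. (2 * (\<xi> (fst z) * \<eta> (snd z) - 1) - t * g z)\<^sup>2 \<partial>(M1 \<Otimes>\<^sub>M M2))"
    and \<delta>: "\<delta> = 1 - (\<integral>x. \<xi> x \<partial>M1) * (\<integral>y. \<eta> y \<partial>M2)"
  shows "t\<^sup>2 * (\<integral>z. (g z - (partial_fst g (fst z) + partial_snd g (snd z)))\<^sup>2 \<partial>(M1 \<Otimes>\<^sub>M M2)) \<le> 20 * E + 128 * \<delta>\<^sup>2"
proof -
  note mean = root_product_mean[OF assms]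
  note mean_snd = root_product_mean_snd[OF assms]
  let ?N = "M1 \<Otimes>\<^sub>M M2"
  let ?A = "\<lambda>z. 2 * (\<xi> (fst z) * \<eta> (snd z) - 1) - t * g z"
  let ?B = "\<lambda>x. 2 * (\<xi> x - 1) - t * partial_fst g x"
  let ?C = "\<lambda>y. 2 * (\<eta> y - 1) - t * partial_snd g y"
  let ?X = "\<lambda>x. \<xi> x - 1" and ?Y = "\<lambda>y. \<eta> y - 1"
  have XY: "?X \<in> L2 M1" "?Y \<in> L2 M2" by (intro L2_diff \<xi> \<eta> M1.L2_const M2.L2_const)+
  have BC: "?B \<in> L2 M1" "?C \<in> L2 M2"
    by (intro L2_diff[of "\<lambda>x. 2 * _ x"] L2_scale XY L2_partial_fst(1) L2_partial_snd(1) g)+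
  have A: "?A \<in> L2 ?N"
    using L2_def integrable_times[OF \<xi>(1)[THEN L2_square_integrable] \<eta>(1)[THEN L2_square_integrable]] \<xi>(1) \<eta>(1)
    by (intro L2_diff[of "\<lambda>x. 2 * _ x"] L2_scale L2_diff g L2_const) (auto simp: L2_def power_mult_distrib)
  have XYi: "integrable ?N (\<lambda>z. (?X (fst z))\<^sup>2 * (?Y (snd z))\<^sup>2)"
      "(\<integral>z. (?X (fst z))\<^sup>2 * (?Y (snd z))\<^sup>2 \<partial>?N) = (\<integral>x. (?X x)\<^sup>2 \<partial>M1) * (\<integral>y. (?Y y)\<^sup>2 \<partial>M2)"
    using integrable_times integral_times XY by (auto dest!: L2_square_integrable)
  have BCi: "integrable ?N (\<lambda>z. (?B (fst z))\<^sup>2)" "integrable ?N (\<lambda>z. (?C (snd z))\<^sup>2)"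
    using L2_of_fst[OF BC(1)] L2_of_snd[OF BC(2)] by (auto simp: L2_def)
  have BCI: "(\<integral>z. (?B (fst z))\<^sup>2 \<partial>?N) = (\<integral>x. (?B x)\<^sup>2 \<partial>M1)" "(\<integral>z. (?C (snd z))\<^sup>2 \<partial>?N) = (\<integral>y. (?C y)\<^sup>2 \<partial>M2)"
    using integral_of_fst[of "\<lambda>x. (?B x)\<^sup>2"] integral_of_snd[of "\<lambda>x. (?C x)\<^sup>2"] BC by (auto simp: L2_def)
  have GL2: "(\<lambda>z. g z - (partial_fst g (fst z) + partial_snd g (snd z))) \<in> L2 ?N"
    by (intro L2_diff L2_add g L2_of_fst L2_of_snd L2_partial_fst(1) L2_partial_snd(1))
  have "t\<^sup>2 * (\<integral>z. (g z - (partial_fst g (fst z) + partial_snd g (snd z)))\<^sup>2 \<partial>?N) =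
     (\<integral>z. t\<^sup>2 * (g z - (partial_fst g (fst z) + partial_snd g (snd z)))\<^sup>2 \<partial>?N)" by simp
  also have "\<dots> \<le> (\<integral>z. 4 * (?A z)\<^sup>2 + 4 * (?B (fst z))\<^sup>2 + 4 * (?C (snd z))\<^sup>2 +
      16 * ((?X (fst z))\<^sup>2 * (?Y (snd z))\<^sup>2) \<partial>?N)"
  proof (rule integral_mono)
    fix z
    define a b c e where "a = ?A z" "b = ?B (fst z)" "c = ?C (snd z)" "e = 2 * (?X (fst z) * ?Y (snd z))"
    have "t * (g z - (partial_fst g (fst z) + partial_snd g (snd z))) = b + c + e - a"
      by (simp add: a_b_c_e_def algebra_simps)
    then have "t\<^sup>2 * (g z - (partial_fst g (fst z) + partial_snd g (snd z)))\<^sup>2 = (b + c + e - a)\<^sup>2"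
      by (simp only: power_mult_distrib[symmetric])
    also have "\<dots> \<le> 4 * a\<^sup>2 + 4 * b\<^sup>2 + 4 * c\<^sup>2 + 4 * e\<^sup>2"
    proof -
      have "4 * a\<^sup>2 + 4 * b\<^sup>2 + 4 * c\<^sup>2 + 4 * e\<^sup>2 - (b + c + e - a)\<^sup>2 =
        (b - c)\<^sup>2 + (b - e)\<^sup>2 + (c - e)\<^sup>2 + (a + b)\<^sup>2 + (a + c)\<^sup>2 + (a + e)\<^sup>2"
        by (simp add: power2_eq_square algebra_simps)
      then show ?thesis by (smt (verit) zero_le_power2)
    qed
    also have "4 * e\<^sup>2 = 16 * ((?X (fst z))\<^sup>2 * (?Y (snd z))\<^sup>2)" by (simp add: a_b_c_e_def power_mult_distrib)
    finally show "t\<^sup>2 * (g z - (partial_fst g (fst z) + partial_snd g (snd z)))\<^sup>2 \<le>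
      4 * (?A z)\<^sup>2 + 4 * (?B (fst z))\<^sup>2 + 4 * (?C (snd z))\<^sup>2 + 16 * ((?X (fst z))\<^sup>2 * (?Y (snd z))\<^sup>2)"
      by (simp add: a_b_c_e_def)
  next
    show "integrable ?N (\<lambda>z. t\<^sup>2 * (g z - (partial_fst g (fst z) + partial_snd g (snd z)))\<^sup>2)"
      using GL2 by (auto simp: L2_def)
    show "integrable ?N (\<lambda>z. 4 * (?A z)\<^sup>2 + 4 * (?B (fst z))\<^sup>2 + 4 * (?C (snd z))\<^sup>2 +
      16 * ((?X (fst z))\<^sup>2 * (?Y (snd z))\<^sup>2))"
      by (intro Bochner_Integration.integrable_add integrable_mult_right A[THEN L2_square_integrable] XYi BCi)
  qed
  also have "\<dots> = 4 * E + 4 * (\<integral>x. (?B x)\<^sup>2 \<partial>M1) + 4 * (\<integral>y. (?C y)\<^sup>2 \<partial>M2) +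
      16 * ((\<integral>x. (?X x)\<^sup>2 \<partial>M1) * (\<integral>y. (?Y y)\<^sup>2 \<partial>M2))"
    unfolding E XYi(2)[symmetric] BCI[symmetric]
    using A[THEN L2_square_integrable] XYi(1) BCi
    by (simp only: Bochner_Integration.integral_add Bochner_Integration.integrable_add integrable_mult_right integral_mult_right_zero)
  also have "\<dots> \<le> 4 * E + 4 * (2 * E + 8 * \<delta>\<^sup>2) + 4 * (2 * E + 8 * \<delta>\<^sup>2) + 16 * ((2 * \<delta>) * (2 * \<delta>))"
    using mean mean_snd by (intro add_mono mult_left_mono mult_mono) auto
  also have "\<dots> = 20 * E + 128 * \<delta>\<^sup>2" by (simp add: power2_eq_square)
  finally show ?thesis .
qed

end

section \<open>From curves of products to curves of factors and back\<close>

lemma prob_algebraD: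
  assumes "P \<in> space (prob_algebra M)"
  shows "prob_space P" "sets P = sets M"
  using assms by (auto simp: space_prob_algebra)

text \<open>The factors are the marginals of the product. This identifies the factors recorded in an
  element of \<open>F2\<close> with those extracted from its curve.\<close>

lemma pair_measure_eq_iff:
  assumes P: "prob_space P" "prob_space P'" "sets P = sets P'"
    and Q: "prob_space Q" "prob_space Q'" "sets Q = sets Q'"
  shows "P \<Otimes>\<^sub>M Q = P' \<Otimes>\<^sub>M Q' \<longleftrightarrow> P = P' \<and> Q = Q'"
proof safe
  interpret P: prob_space P by fact
  interpret P': prob_space P' by fact
  interpret Q: prob_space Q by fact
  interpret Q': prob_space Q' by fact
  interpret PQ: pair_prob_space P Q ..
  interpret PQ': pair_prob_space P' Q' ..
  assume eq: "P \<Otimes>\<^sub>M Q = P' \<Otimes>\<^sub>M Q'"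
  have "P = distr (P \<Otimes>\<^sub>M Q) P fst" by (rule PQ.distr_fst[symmetric])
  also have "\<dots> = distr (P' \<Otimes>\<^sub>M Q') P' fst" unfolding eq by (rule distr_cong) (auto simp: P)
  finally show "P = P'" by (simp add: PQ'.distr_fst)
  have "Q = distr (P \<Otimes>\<^sub>M Q) Q snd" by (rule PQ.distr_snd[symmetric])
  also have "\<dots> = distr (P' \<Otimes>\<^sub>M Q') Q' snd" unfolding eq by (rule distr_cong) (auto simp: Q)
  finally show "Q = Q'" by (simp add: PQ'.distr_snd)
qed

definition density_root :: "('a \<Rightarrow> ennreal) \<Rightarrow> 'a \<Rightarrow> real" where
  "density_root p x = sqrt (enn2real (p x))"

lemma density_root_nonneg: "0 \<le> density_root p x"
  by (simp add: density_root_def)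

lemma density_root_power2: "(density_root p x)\<^sup>2 = enn2real (p x)"
  by (simp add: density_root_def)

lemma density_root_L2:
  assumes P: "prob_space P" "sets P = sets P0" and p: "is_density_quotient P P0 p"
  shows "density_root p \<in> L2 P0"
    and "(\<integral>x. (density_root p x)\<^sup>2 \<partial>P0) = 1 - measure P {x \<in> space P. p x = \<infinity>}"
    and "(\<integral>x. (density_root p x)\<^sup>2 \<partial>P0) \<le> 1"
proof -
  have [measurable]: "p \<in> borel_measurable P0" using p by (simp add: is_density_quotient_def)
  note e = enn2real_density_quotient_integral[OF P p]
  have "density_root p \<in> borel_measurable P0" unfolding density_root_def by measurable
  then show "density_root p \<in> L2 P0" using e by (simp add: L2_def density_root_power2)
  show "(\<integral>x. (density_root p x)\<^sup>2 \<partial>P0) = 1 - measure P {x \<in> space P. p x = \<infinity>}"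
    using e by (simp add: density_root_power2)
  then show "(\<integral>x. (density_root p x)\<^sup>2 \<partial>P0) \<le> 1" by simp
qed

lemma density_quotient_self: "sigma_finite_measure P \<Longrightarrow> is_density_quotient P P (\<lambda>x. 1)"
  by (simp add: is_density_quotient_def)

text \<open>The quotient of the product curve is almost everywhere the product of factor quotients,
  so the estimates for product roots apply with both E and the singular mass of order
  \<open>o(t\<^sup>2)\<close>. They give \<delta> of order \<open>t\<^sup>2\<close>; the squared
  remainders of the factors are bounded by combinations of E and \<open>\<delta>\<^sup>2\<close>,
  and their singular masses by that of the product.\<close>

lemma product_curve_factors:
  fixes \<P> :: "'a measure set" and \<Q> :: "'b measure set"
  assumes \<P>: "\<P> \<subseteq> space (prob_algebra M1)" and \<Q>: "\<Q> \<subseteq> space (prob_algebra M2)"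
    and P0: "P0 \<in> \<P>" and Q0: "Q0 \<in> \<Q>"
    and curve: "L2_differentiable_curve (\<P> \<otimes>\<^sub>F \<Q>) \<epsilon> f g" and f0: "f 0 = P0 \<Otimes>\<^sub>M Q0"
  obtains P Q where "P 0 = P0" "Q 0 = Q0" "\<And>t. \<bar>t\<bar> < \<epsilon> \<Longrightarrow> f t = P t \<Otimes>\<^sub>M Q t"
    "L2_differentiable_curve \<P> \<epsilon> P (pair_prob_space.partial_fst Q0 g)"
    "L2_differentiable_curve \<Q> \<epsilon> Q (pair_prob_space.partial_snd P0 g)"
    "AE z in P0 \<Otimes>\<^sub>M Q0. g z = pair_prob_space.partial_fst Q0 g (fst z) + pair_prob_space.partial_snd P0 g (snd z)"
    "(\<integral>z. g z \<partial>(P0 \<Otimes>\<^sub>M Q0)) = 0"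
proof -
  have p0: "prob_space P0" "sets P0 = sets M1" and q0: "prob_space Q0" "sets Q0 = sets M2"
    using \<P> \<Q> P0 Q0 prob_algebraD by blast+
  interpret P0: prob_space P0 by fact
  interpret Q0: prob_space Q0 by fact
  interpret R: pair_prob_space P0 Q0 ..
  let ?N = "P0 \<Otimes>\<^sub>M Q0"
  from curve obtain L where \<epsilon>: "\<epsilon> > 0" and fR: "\<And>t. \<bar>t\<bar> < \<epsilon> \<Longrightarrow> f t \<in> \<P> \<otimes>\<^sub>F \<Q>"
    and g: "g \<in> L2 ?N" and L: "\<And>t. \<bar>t\<bar> < \<epsilon> \<Longrightarrow> is_density_quotient (f t) ?N (L t)"
    and lim: "(\<lambda>t. L2_norm ?N (\<lambda>x. 2 * (sqrt (enn2real (L t x)) - 1) - t * g x)) \<in> o[at 0](\<lambda>t. \<bar>t\<bar>)"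
    and sing: "(\<lambda>t. measure (f t) {x \<in> space (f t). L t x = \<infinity>}) \<in> o[at 0](\<lambda>t. t\<^sup>2)"
    unfolding L2_differentiable_curve_def f0 by auto
  \<comment> \<open>Outside the interval \<open>P0\<close> and \<open>Q0\<close> serve as default
    values, so that factors can be chosen for all t at once.\<close>
  have "\<exists>P Q. P \<in> \<P> \<and> Q \<in> \<Q> \<and> (\<bar>t\<bar> < \<epsilon> \<longrightarrow> f t = P \<Otimes>\<^sub>M Q)" for t
    using fR[of t] P0 Q0 by (auto simp: product_family_def)
  then obtain P Q where PQ: "\<And>t. P t \<in> \<P>" "\<And>t. Q t \<in> \<Q>" "\<And>t. \<bar>t\<bar> < \<epsilon> \<Longrightarrow> f t = P t \<Otimes>\<^sub>M Q t"
    by metis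
  have P: "prob_space (P t)" "sets (P t) = sets P0" and Q: "prob_space (Q t)" "sets (Q t) = sets Q0" for t
    using PQ(1,2)[of t] \<P> \<Q> prob_algebraD p0 q0 by blast+
  have start: "P 0 = P0" "Q 0 = Q0"
    using pair_measure_eq_iff[OF P(1) p0(1) P(2) Q(1) q0(1) Q(2)] PQ(3)[of 0] f0 \<epsilon> by auto
  have "\<exists>p. is_density_quotient (P t) P0 p" for t
    using density_quotient_exists[OF prob_space.finite_measure[OF P(1)] P0.sigma_finite_measure_axioms P(2)] by blast
  then obtain p where p: "\<And>t. is_density_quotient (P t) P0 (p t)" by metis
  have "\<exists>q. is_density_quotient (Q t) Q0 q" for t
    using density_quotient_exists[OF prob_space.finite_measure[OF Q(1)] Q0.sigma_finite_measure_axioms Q(2)] by blast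
  then obtain q where q: "\<And>t. is_density_quotient (Q t) Q0 (q t)" by metis
  note rp = density_root_L2[OF P p] and rq = density_root_L2[OF Q q]
  define E where "E t = (\<integral>z. (2 * (density_root (p t) (fst z) * density_root (q t) (snd z) - 1) - t * g z)\<^sup>2 \<partial>?N)" for t
  define \<delta> where "\<delta> t = 1 - (\<integral>x. density_root (p t) x \<partial>P0) * (\<integral>y. density_root (q t) y \<partial>Q0)" for t
  define s where "s t = 1 - (\<integral>x. (density_root (p t) x)\<^sup>2 \<partial>P0) * (\<integral>y. (density_root (q t) y)\<^sup>2 \<partial>Q0)" for t
  define G where "G = (\<integral>z. (g z)\<^sup>2 \<partial>?N)"
  note mean = R.root_product_mean[OF rp(1) density_root_nonneg rp(3) rq(1) density_root_nonneg rq(3) g E_def \<delta>_def]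
  note mean_snd = R.root_product_mean_snd[OF rp(1) density_root_nonneg rp(3) rq(1) density_root_nonneg rq(3) g E_def \<delta>_def]
  note additive = R.root_product_additive[OF rp(1) density_root_nonneg rp(3) rq(1) density_root_nonneg rq(3) g E_def \<delta>_def]
  have gm[measurable]: "g \<in> borel_measurable ?N" using g by (simp add: L2_def)
  have ft: "prob_space (f t)" "sets (f t) = sets ?N" if "\<bar>t\<bar> < \<epsilon>" for t
  proof -
    interpret Pt: prob_space "P t" by (rule P)
    interpret Qt: prob_space "Q t" by (rule Q)
    interpret Rt: pair_prob_space "P t" "Q t" ..
    show "prob_space (f t)" "sets (f t) = sets ?N"
      using PQ(3)[OF that] Rt.prob_space_axioms sets_pair_measure_cong[OF P(2) Q(2)] by auto
  qed
  \<comment> \<open>Uniqueness identifies L with the redirected product of quotients. Where a factor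
    is infinite both sides of the claim are 0, as \<open>enn2real\<close> sends \<infinity> to
    0.\<close>
  have Lpq: "AE z in ?N. enn2real (L t z) = enn2real (p t (fst z)) * enn2real (q t (snd z))" if t: "\<bar>t\<bar> < \<epsilon>" for t
  proof -
    have "is_density_quotient (f t) ?N
        (\<lambda>z. if p t (fst z) = \<infinity> \<or> q t (snd z) = \<infinity> then \<infinity> else p t (fst z) * q t (snd z))"
      using density_quotient_pair[OF P(1) p0(1) P(2) Q(1) q0(1) Q(2) p q] PQ(3)[OF t] by simp
    from density_quotient_AE_unique[OF prob_space.finite_measure[OF ft(1)[OF t]] R.sigma_finite_measure_axioms ft(2)[OF t] L[OF t] this]
    show ?thesis by eventually_elim (auto simp: enn2real_mult)
  qed
  have [measurable]: "L t \<in> borel_measurable ?N" if "\<bar>t\<bar> < \<epsilon>" for t using L[OF that] by (simp add: is_density_quotient_def)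
  have [measurable]: "density_root (p t) \<in> borel_measurable P0" "density_root (q t) \<in> borel_measurable Q0" for t
    using rp(1) rq(1) by (auto simp: L2_def)
  have [measurable]: "p t \<in> borel_measurable P0" "q t \<in> borel_measurable Q0" for t
    using p q by (auto simp: is_density_quotient_def)
  have E_eq: "E t = (\<integral>x. (2 * (sqrt (enn2real (L t x)) - 1) - t * g x)\<^sup>2 \<partial>?N)" if t: "\<bar>t\<bar> < \<epsilon>" for t
    unfolding E_def
    by (rule integral_cong_AE) (use Lpq[OF t] t in \<open>auto simp: density_root_def real_sqrt_mult elim!: eventually_mono\<close>)
  have s_eq: "s t = measure (f t) {x \<in> space (f t). L t x = \<infinity>}" if t: "\<bar>t\<bar> < \<epsilon>" for t
  proof -
    have "1 - measure (f t) {x \<in> space (f t). L t x = \<infinity>} = (\<integral>z. enn2real (L t z) \<partial>?N)"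
      using enn2real_density_quotient_integral(2)[OF ft[OF t] L[OF t]] by simp
    also have "\<dots> = (\<integral>z. (density_root (p t) (fst z))\<^sup>2 * (density_root (q t) (snd z))\<^sup>2 \<partial>?N)"
      by (rule integral_cong_AE) (use Lpq[OF t] t in \<open>auto simp: density_root_power2 elim!: eventually_mono\<close>)
    also have "\<dots> = 1 - s t"
      unfolding s_def by (subst R.integral_times) (auto intro: rp(1) rq(1) L2_square_integrable)
    finally show ?thesis by simp
  qed
  have small: "\<forall>\<^sub>F t in at 0. \<bar>t\<bar> < \<epsilon>"
    using \<epsilon> by (auto simp: eventually_at intro!: exI[of _ \<epsilon>])
  have Elim: "((\<lambda>t. E t / t\<^sup>2) \<longlongrightarrow> 0) (at 0)"
    using lim[unfolded L2_norm_smallo_iff]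
    by (rule Lim_transform_eventually) (use small E_eq in \<open>auto elim!: eventually_mono\<close>)
  have slim: "((\<lambda>t. s t / t\<^sup>2) \<longlongrightarrow> 0) (at 0)"
    using sing[unfolded smallo_power2_iff]
    by (rule Lim_transform_eventually) (use small s_eq in \<open>auto elim!: eventually_mono\<close>)
  have ne: "\<forall>\<^sub>F t in at 0. t \<noteq> (0::real)" by (simp add: eventually_at_filter)
  \<comment> \<open>\<delta> is of order \<open>t\<^sup>2\<close>, so \<open>\<delta> / t\<close>
    vanishes. This makes \<open>\<delta>\<^sup>2\<close> negligible against \<open>t\<^sup>2\<close>
    and, further down, yields the zero mean of g.\<close>
  have \<delta>lim: "((\<lambda>t. \<delta> t / t) \<longlongrightarrow> 0) (at 0)"
  proof (rule tendsto_rabs_zero_cancel, rule tendsto_sandwich[where f="\<lambda>_. 0"])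
    show "\<forall>\<^sub>F t in at 0. \<bar>\<delta> t / t\<bar> \<le> \<bar>t\<bar> * (s t / t\<^sup>2 / 2 + E t / t\<^sup>2 / 4 + G / 4)"
      using ne
    proof eventually_elim
      fix t :: real assume t: "t \<noteq> 0"
      have "\<bar>\<delta> t / t\<bar> = \<delta> t / \<bar>t\<bar>" using mean(1)[of t] by simp
      also have "\<dots> \<le> (s t / 2 + E t / 4 + t\<^sup>2 * G / 4) / \<bar>t\<bar>"
        using mean(2)[of t] unfolding s_def G_def by (intro divide_right_mono) auto
      also have "\<dots> = \<bar>t\<bar> * (s t / t\<^sup>2 / 2 + E t / t\<^sup>2 / 4 + G / 4)"
      proof -
        define r where "r = \<bar>t\<bar>"
        have "t\<^sup>2 = r\<^sup>2" "r \<noteq> 0" using t by (auto simp: r_def)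
        then show ?thesis unfolding r_def[symmetric] by (simp add: field_simps power2_eq_square)
      qed
      finally show "\<bar>\<delta> t / t\<bar> \<le> \<bar>t\<bar> * (s t / t\<^sup>2 / 2 + E t / t\<^sup>2 / 4 + G / 4)" .
    qed
    have "((\<lambda>t. \<bar>t\<bar> * (s t / t\<^sup>2 / 2 + E t / t\<^sup>2 / 4 + G / 4)) \<longlongrightarrow> \<bar>0\<bar> * (0 / 2 + 0 / 4 + G / 4)) (at 0)"
      by (intro tendsto_intros slim Elim) auto
    then show "((\<lambda>t. \<bar>t\<bar> * (s t / t\<^sup>2 / 2 + E t / t\<^sup>2 / 4 + G / 4)) \<longlongrightarrow> 0) (at 0)" by simp
  qed auto
  have \<delta>2: "((\<lambda>t. (\<delta> t)\<^sup>2 / t\<^sup>2) \<longlongrightarrow> 0) (at 0)"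
    using tendsto_power[OF \<delta>lim, of 2] by (simp add: power_divide)
  have bound_lim: "((\<lambda>t. (a * E t + b * (\<delta> t)\<^sup>2) / t\<^sup>2) \<longlongrightarrow> 0) (at 0)" for a b
    using tendsto_add[OF tendsto_mult_right_zero[OF Elim, of a] tendsto_mult_right_zero[OF \<delta>2, of b]]
    by (simp add: add_divide_distrib)
  have sq: "((\<lambda>t. h t / t\<^sup>2) \<longlongrightarrow> 0) (at 0)"
    if "\<And>t. 0 \<le> h t" "\<And>t. h t \<le> a * E t + b * (\<delta> t)\<^sup>2" for h :: "real \<Rightarrow> real" and a b
    by (rule tendsto_sandwich[OF _ _ tendsto_const bound_lim[of a b]])
      (use that in \<open>auto intro!: always_eventually divide_right_mono\<close>)
  have sing_fst: "((\<lambda>t. measure (P t) {x \<in> space (P t). p t x = \<infinity>} / t\<^sup>2) \<longlongrightarrow> 0) (at 0)"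
  proof (rule tendsto_sandwich[OF _ _ tendsto_const slim])
    have "measure (P t) {x \<in> space (P t). p t x = \<infinity>} \<le> s t" for t
    proof -
      have "(\<integral>x. (density_root (p t) x)\<^sup>2 \<partial>P0) * (\<integral>y. (density_root (q t) y)\<^sup>2 \<partial>Q0) \<le> (\<integral>x. (density_root (p t) x)\<^sup>2 \<partial>P0)"
        by (intro mult_left_le rq) simp
      then show ?thesis by (simp add: s_def rp(2))
    qed
    then show "\<forall>\<^sub>F t in at 0. measure (P t) {x \<in> space (P t). p t x = \<infinity>} / t\<^sup>2 \<le> s t / t\<^sup>2"
      by (intro always_eventually allI divide_right_mono) auto
  qed simp
  have sing_snd: "((\<lambda>t. measure (Q t) {x \<in> space (Q t). q t x = \<infinity>} / t\<^sup>2) \<longlongrightarrow> 0) (at 0)"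
  proof (rule tendsto_sandwich[OF _ _ tendsto_const slim])
    have "measure (Q t) {x \<in> space (Q t). q t x = \<infinity>} \<le> s t" for t
    proof -
      have "(\<integral>x. (density_root (p t) x)\<^sup>2 \<partial>P0) * (\<integral>y. (density_root (q t) y)\<^sup>2 \<partial>Q0) \<le> (\<integral>y. (density_root (q t) y)\<^sup>2 \<partial>Q0)"
        by (intro mult_left_le_one_le rp) simp_all
      then show ?thesis by (simp add: s_def rq(2))
    qed
    then show "\<forall>\<^sub>F t in at 0. measure (Q t) {x \<in> space (Q t). q t x = \<infinity>} / t\<^sup>2 \<le> s t / t\<^sup>2"
      by (intro always_eventually allI divide_right_mono) auto
  qed simp
  show thesis
  proof (rule that[of P Q])
    show "L2_differentiable_curve \<P> \<epsilon> P (R.partial_fst g)"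
      unfolding L2_differentiable_curve_def start
    proof (intro conjI allI impI exI[of _ p])
      show "(\<lambda>t. L2_norm P0 (\<lambda>x. 2 * (sqrt (enn2real (p t x)) - 1) - t * R.partial_fst g x)) \<in> o[at 0](\<lambda>t. \<bar>t\<bar>)"
        unfolding L2_norm_smallo_iff density_root_def[symmetric] by (rule sq[OF _ mean(4)]) simp
      show "(\<lambda>t. measure (P t) {x \<in> space (P t). p t x = \<infinity>}) \<in> o[at 0](\<lambda>t. t\<^sup>2)"
        unfolding smallo_power2_iff by (rule sing_fst)
    qed (use \<epsilon> PQ(1) R.L2_partial_fst(1)[OF g] p in auto)
    show "L2_differentiable_curve \<Q> \<epsilon> Q (R.partial_snd g)"
      unfolding L2_differentiable_curve_def start
    proof (intro conjI allI impI exI[of _ q])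
      show "(\<lambda>t. L2_norm Q0 (\<lambda>x. 2 * (sqrt (enn2real (q t x)) - 1) - t * R.partial_snd g x)) \<in> o[at 0](\<lambda>t. \<bar>t\<bar>)"
        unfolding L2_norm_smallo_iff density_root_def[symmetric] by (rule sq[OF _ mean_snd]) simp
      show "(\<lambda>t. measure (Q t) {x \<in> space (Q t). q t x = \<infinity>}) \<in> o[at 0](\<lambda>t. t\<^sup>2)"
        unfolding smallo_power2_iff by (rule sing_snd)
    qed (use \<epsilon> PQ(2) R.L2_partial_snd(1)[OF g] q in auto)
    let ?D = "\<lambda>z. g z - (R.partial_fst g (fst z) + R.partial_snd g (snd z))"
    have DL2: "?D \<in> L2 ?N"
      by (intro L2_diff L2_add g R.L2_of_fst R.L2_of_snd R.L2_partial_fst(1) R.L2_partial_snd(1))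
    \<comment> \<open>The quotient does not depend on t apart from \<open>t = 0\<close>, so it can
      tend to 0 only by being 0.\<close>
    have "((\<lambda>t. t\<^sup>2 * (\<integral>z. (?D z)\<^sup>2 \<partial>?N) / t\<^sup>2) \<longlongrightarrow> 0) (at (0::real))"
      by (rule sq[OF _ additive]) simp
    then have "((\<lambda>t::real. \<integral>z. (?D z)\<^sup>2 \<partial>?N) \<longlongrightarrow> 0) (at (0::real))"
      by (rule Lim_transform_eventually) (use ne in \<open>eventually_elim, simp\<close>)
    then have "(\<integral>z. (?D z)\<^sup>2 \<partial>?N) = 0" by (simp add: tendsto_const_iff)
    then have "AE z in ?N. (?D z)\<^sup>2 = 0"
      using integral_nonneg_eq_0_iff_AE[OF L2_square_integrable[OF DL2]] by simp
    then show "AE z in ?N. g z = R.partial_fst g (fst z) + R.partial_snd g (snd z)"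
      by eventually_elim simp
    \<comment> \<open>Up to sign \<open>2 * \<delta> + t * \<integral> g\<close> is the mean of the
      remainder. As \<open>\<delta> / t\<close> vanishes, so must the mean of g.\<close>
    have "((\<lambda>t. (2 * \<delta> t + t * (\<integral>z. g z \<partial>?N))\<^sup>2 / t\<^sup>2) \<longlongrightarrow> 0) (at 0)"
      by (rule sq[of _ 1 0]) (use mean(3) in auto)
    then have "((\<lambda>t. (2 * (\<delta> t / t) + (\<integral>z. g z \<partial>?N))\<^sup>2) \<longlongrightarrow> 0) (at 0)"
      by (rule Lim_transform_eventually)
        (use ne in \<open>eventually_elim, simp add: power_divide[symmetric] add_divide_distrib\<close>)
    moreover have "((\<lambda>t. (2 * (\<delta> t / t) + (\<integral>z. g z \<partial>?N))\<^sup>2) \<longlongrightarrow> (2 * 0 + (\<integral>z. g z \<partial>?N))\<^sup>2) (at 0)"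
      by (intro tendsto_intros \<delta>lim)
    ultimately show "(\<integral>z. g z \<partial>?N) = 0"
      using tendsto_unique[of "at (0::real)"] by fastforce
  qed (use PQ start in auto)
qed

text \<open>Every quantity in the definition of a differentiable curve is an integral or a mass of a
  function of \<open>\<pi>\<close>, and image measures preserve both. The maps used are the
  coordinate projections.\<close>

lemma L2_differentiable_curve_comp:
  assumes curve: "L2_differentiable_curve \<P> \<epsilon> P h"
    and R: "\<And>t. \<bar>t\<bar> < \<epsilon> \<Longrightarrow> R t \<in> \<R>" and sets: "\<And>t. \<bar>t\<bar> < \<epsilon> \<Longrightarrow> sets (P t) = sets (P 0)"
    and \<pi>: "\<And>t. \<bar>t\<bar> < \<epsilon> \<Longrightarrow> \<pi> \<in> measurable (R t) (P t)" "\<And>t. \<bar>t\<bar> < \<epsilon> \<Longrightarrow> distr (R t) (P t) \<pi> = P t"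
    and quotient: "\<And>t p. \<bar>t\<bar> < \<epsilon> \<Longrightarrow> is_density_quotient (P t) (P 0) p \<Longrightarrow> is_density_quotient (R t) (R 0) (\<lambda>z. p (\<pi> z))"
  shows "L2_differentiable_curve \<R> \<epsilon> R (\<lambda>z. h (\<pi> z))"
proof -
  from curve obtain p where \<epsilon>: "\<epsilon> > 0" and h: "h \<in> L2 (P 0)"
    and p: "\<And>t. \<bar>t\<bar> < \<epsilon> \<Longrightarrow> is_density_quotient (P t) (P 0) (p t)"
    and lim: "(\<lambda>t. L2_norm (P 0) (\<lambda>x. 2 * (sqrt (enn2real (p t x)) - 1) - t * h x)) \<in> o[at 0](\<lambda>t. \<bar>t\<bar>)"
    and sing: "(\<lambda>t. measure (P t) {x \<in> space (P t). p t x = \<infinity>}) \<in> o[at 0](\<lambda>t. t\<^sup>2)"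
    unfolding L2_differentiable_curve_def by auto
  have small: "\<forall>\<^sub>F t in at 0. \<bar>t\<bar> < \<epsilon>"
    using \<epsilon> by (auto simp: eventually_at intro!: exI[of _ \<epsilon>])
  have \<pi>0[measurable]: "\<pi> \<in> measurable (R 0) (P 0)" and d0: "distr (R 0) (P 0) \<pi> = P 0" using \<pi>[of 0] \<epsilon> by auto
  have [measurable]: "h \<in> borel_measurable (P 0)" using h by (simp add: L2_def)
  have pm: "p t \<in> borel_measurable (P 0)" if "\<bar>t\<bar> < \<epsilon>" for t
    using p[OF that] by (simp add: is_density_quotient_def)
  show ?thesis
    unfolding L2_differentiable_curve_def
  proof (intro conjI allI impI exI[of _ "\<lambda>t z. p t (\<pi> z)"])
    show "(\<lambda>z. h (\<pi> z)) \<in> L2 (R 0)"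
      using integrable_distr_eq[OF \<pi>0, of "\<lambda>x. (h x)\<^sup>2"] h by (auto simp: L2_def d0)
    show "(\<lambda>t. L2_norm (R 0) (\<lambda>z. 2 * (sqrt (enn2real (p t (\<pi> z))) - 1) - t * h (\<pi> z))) \<in> o[at 0](\<lambda>t. \<bar>t\<bar>)"
    proof (subst landau_o.small.in_cong)
      show "\<forall>\<^sub>F t in at 0. L2_norm (R 0) (\<lambda>z. 2 * (sqrt (enn2real (p t (\<pi> z))) - 1) - t * h (\<pi> z)) =
          L2_norm (P 0) (\<lambda>x. 2 * (sqrt (enn2real (p t x)) - 1) - t * h x)"
        using small
      proof eventually_elim
        fix t assume t: "\<bar>t\<bar> < \<epsilon>"
        note [measurable] = pm[OF t]
        show "L2_norm (R 0) (\<lambda>z. 2 * (sqrt (enn2real (p t (\<pi> z))) - 1) - t * h (\<pi> z)) =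
          L2_norm (P 0) (\<lambda>x. 2 * (sqrt (enn2real (p t x)) - 1) - t * h x)"
          using integral_distr[OF \<pi>0, of "\<lambda>x. (2 * (sqrt (enn2real (p t x)) - 1) - t * h x)\<^sup>2"]
          by (simp add: L2_norm_def d0)
      qed
    qed (rule lim)
    show "(\<lambda>t. measure (R t) {z \<in> space (R t). p t (\<pi> z) = \<infinity>}) \<in> o[at 0](\<lambda>t. t\<^sup>2)"
    proof (subst landau_o.small.in_cong)
      show "\<forall>\<^sub>F t in at 0. measure (R t) {z \<in> space (R t). p t (\<pi> z) = \<infinity>} = measure (P t) {x \<in> space (P t). p t x = \<infinity>}"
        using small
      proof eventually_elim
        fix t assume t: "\<bar>t\<bar> < \<epsilon>"
        have [measurable]: "p t \<in> borel_measurable (P t)"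
          using pm[OF t] measurable_cong_sets[OF sets[OF t] refl] by auto
        have "measure (P t) {x \<in> space (P t). p t x = \<infinity>} = measure (distr (R t) (P t) \<pi>) {x \<in> space (P t). p t x = \<infinity>}"
          by (simp add: \<pi>(2)[OF t])
        also have "\<dots> = measure (R t) {z \<in> space (R t). p t (\<pi> z) = \<infinity>}"
          using measurable_space[OF \<pi>(1)[OF t]] by (subst measure_distr[OF \<pi>(1)[OF t]]) (auto intro!: arg_cong[where f="measure (R t)"])
        finally show "measure (R t) {z \<in> space (R t). p t (\<pi> z) = \<infinity>} = measure (P t) {x \<in> space (P t). p t x = \<infinity>}" ..
      qed
    qed (rule sing)
  qed (use \<epsilon> R quotient p in auto)
qed

text \<open>The other factor of the product curve is frozen.\<close>

lemma
  assumes \<P>: "\<P> \<subseteq> space (prob_algebra M1)" and \<Q>: "\<Q> \<subseteq> space (prob_algebra M2)"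
    and P0: "P0 \<in> \<P>" and Q0: "Q0 \<in> \<Q>"
  shows L2_differentiable_curve_fst: "L2_differentiable_curve \<P> \<epsilon> P h \<Longrightarrow> P 0 = P0 \<Longrightarrow>
      (\<lambda>z. h (fst z)) \<in> tangent_cone (P0 \<Otimes>\<^sub>M Q0) (\<P> \<otimes>\<^sub>F \<Q>)"
    and L2_differentiable_curve_snd: "L2_differentiable_curve \<Q> \<epsilon> Q l \<Longrightarrow> Q 0 = Q0 \<Longrightarrow>
      (\<lambda>z. l (snd z)) \<in> tangent_cone (P0 \<Otimes>\<^sub>M Q0) (\<P> \<otimes>\<^sub>F \<Q>)"
proof -
  have p: "prob_space P'" "sets P' = sets M1" if "P' \<in> \<P>" for P' using \<P> that prob_algebraD by blast+
  have q: "prob_space Q'" "sets Q' = sets M2" if "Q' \<in> \<Q>" for Q' using \<Q> that prob_algebraD by blast+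
  interpret P0: prob_space P0 by (rule p[OF P0])
  interpret Q0: prob_space Q0 by (rule q[OF Q0])
  have pair: "pair_prob_space P' Q'" if "P' \<in> \<P>" "Q' \<in> \<Q>" for P' Q'
    using p(1)[OF that(1)] q(1)[OF that(2)]
    by (simp add: pair_prob_space_def pair_sigma_finite_def prob_space_imp_sigma_finite)
  {
    assume curve: "L2_differentiable_curve \<P> \<epsilon> P h" and P: "P 0 = P0"
    then have mem: "\<And>t. \<bar>t\<bar> < \<epsilon> \<Longrightarrow> P t \<in> \<P>" by (simp add: L2_differentiable_curve_def)
    have "L2_differentiable_curve (\<P> \<otimes>\<^sub>F \<Q>) \<epsilon> (\<lambda>t. P t \<Otimes>\<^sub>M Q0) (\<lambda>z. h (fst z))"
    proof (rule L2_differentiable_curve_comp[OF curve])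
      fix t p' assume t: "\<bar>t\<bar> < \<epsilon>" and p': "is_density_quotient (P t) (P 0) p'"
      have s: "sets (P t) = sets P0" using p(2)[OF mem[OF t]] p(2)[OF P0] by simp
      from density_quotient_pair[OF p(1)[OF mem[OF t]] p(1)[OF P0] s q(1)[OF Q0] q(1)[OF Q0] refl p'[unfolded P]
          density_quotient_self[OF Q0.sigma_finite_measure_axioms]]
      show "is_density_quotient (P t \<Otimes>\<^sub>M Q0) (P 0 \<Otimes>\<^sub>M Q0) (\<lambda>z. p' (fst z))"
        unfolding P by (simp add: if_distrib cong: if_cong)
    qed (use mem p P P0 Q0 pair_prob_space.distr_fst[OF pair] in \<open>auto simp: product_family_def\<close>)
    then show "(\<lambda>z. h (fst z)) \<in> tangent_cone (P0 \<Otimes>\<^sub>M Q0) (\<P> \<otimes>\<^sub>F \<Q>)"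
      unfolding tangent_cone_def using P by (intro CollectI exI[of _ \<epsilon>] exI[of _ "\<lambda>t. P t \<Otimes>\<^sub>M Q0"]) auto
  next
    assume curve: "L2_differentiable_curve \<Q> \<epsilon> Q l" and Q: "Q 0 = Q0"
    then have mem: "\<And>t. \<bar>t\<bar> < \<epsilon> \<Longrightarrow> Q t \<in> \<Q>" by (simp add: L2_differentiable_curve_def)
    have "L2_differentiable_curve (\<P> \<otimes>\<^sub>F \<Q>) \<epsilon> (\<lambda>t. P0 \<Otimes>\<^sub>M Q t) (\<lambda>z. l (snd z))"
    proof (rule L2_differentiable_curve_comp[OF curve])
      fix t q' assume t: "\<bar>t\<bar> < \<epsilon>" and q': "is_density_quotient (Q t) (Q 0) q'"
      have s: "sets (Q t) = sets Q0" using q(2)[OF mem[OF t]] q(2)[OF Q0] by simp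
      from density_quotient_pair[OF p(1)[OF P0] p(1)[OF P0] refl q(1)[OF mem[OF t]] q(1)[OF Q0] s
          density_quotient_self[OF P0.sigma_finite_measure_axioms] q'[unfolded Q]]
      show "is_density_quotient (P0 \<Otimes>\<^sub>M Q t) (P0 \<Otimes>\<^sub>M Q 0) (\<lambda>z. q' (snd z))"
        unfolding Q by (simp add: if_distrib cong: if_cong)
    qed (use mem q Q P0 Q0 pair_prob_space.distr_snd[OF pair] in \<open>auto simp: product_family_def\<close>)
    then show "(\<lambda>z. l (snd z)) \<in> tangent_cone (P0 \<Otimes>\<^sub>M Q0) (\<P> \<otimes>\<^sub>F \<Q>)"
      unfolding tangent_cone_def using Q by (intro CollectI exI[of _ \<epsilon>] exI[of _ "\<lambda>t. P0 \<Otimes>\<^sub>M Q t"]) auto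
  }
qed

section \<open>Two-sample products\<close>

text \<open>Finite boxes determine a product measure, and on a box the integral of the product
  density splits by Tonelli.\<close>

lemma PiM_density:
  assumes M: "sigma_finite_measure M" and f[measurable]: "f \<in> borel_measurable M"
    and fin: "sigma_finite_measure (density M f)" and I: "finite I"
  shows "(\<Pi>\<^sub>M i\<in>I. density M f) = density (\<Pi>\<^sub>M i\<in>I. M) (\<lambda>x. \<Prod>i\<in>I. f (x i))"
proof -
  interpret M: product_sigma_finite "\<lambda>_. M" using M by (simp add: product_sigma_finite_def)
  interpret D: product_sigma_finite "\<lambda>_. density M f" using fin by (simp add: product_sigma_finite_def)
  show ?thesis
  proof (rule D.PiM_eqI[OF I, symmetric])
    show "sets (density (\<Pi>\<^sub>M i\<in>I. M) (\<lambda>x. \<Prod>i\<in>I. f (x i))) = sets (\<Pi>\<^sub>M i\<in>I. density M f)"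
      unfolding sets_density by (rule sets_PiM_cong) auto
    fix A assume "\<And>i. i \<in> I \<Longrightarrow> A i \<in> sets (density M f)"
    then have A: "\<And>i. i \<in> I \<Longrightarrow> A i \<in> sets M" by simp
    then have Am: "Pi\<^sub>E I A \<in> sets (\<Pi>\<^sub>M i\<in>I. M)" using I by (intro sets_PiM_I_finite) auto
    have "emeasure (density (\<Pi>\<^sub>M i\<in>I. M) (\<lambda>x. \<Prod>i\<in>I. f (x i))) (Pi\<^sub>E I A) =
        (\<integral>\<^sup>+x. (\<Prod>i\<in>I. f (x i)) * indicator (Pi\<^sub>E I A) x \<partial>(\<Pi>\<^sub>M i\<in>I. M))"
      using Am by (intro emeasure_density) auto
    also have "\<dots> = (\<integral>\<^sup>+x. (\<Prod>i\<in>I. f (x i) * indicator (A i) (x i)) \<partial>(\<Pi>\<^sub>M i\<in>I. M))"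
    proof (rule nn_integral_cong)
      fix x assume x: "x \<in> space (\<Pi>\<^sub>M i\<in>I. M)"
      show "(\<Prod>i\<in>I. f (x i)) * indicator (Pi\<^sub>E I A) x = (\<Prod>i\<in>I. f (x i) * indicator (A i) (x i))"
      proof (cases "x \<in> Pi\<^sub>E I A")
        case True
        then show ?thesis by (auto intro!: prod.cong simp: PiE_def Pi_iff)
      next
        case False
        then obtain i where "i \<in> I" "x i \<notin> A i" using x by (auto simp: space_PiM PiE_def)
        then have "(\<Prod>i\<in>I. f (x i) * indicator (A i) (x i)) = 0" using I by (intro prod_zero) (auto intro!: bexI[of _ i])
        then show ?thesis using False by simp
      qed
    qed
    also have "\<dots> = (\<Prod>i\<in>I. \<integral>\<^sup>+x. f x * indicator (A i) x \<partial>M)"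
      using A by (intro M.product_nn_integral_prod I) auto
    also have "\<dots> = (\<Prod>i\<in>I. emeasure (density M f) (A i))"
      using A by (intro prod.cong refl) (simp add: emeasure_density)
    finally show "emeasure (density (\<Pi>\<^sub>M i\<in>I. M) (\<lambda>x. \<Prod>i\<in>I. f (x i))) (Pi\<^sub>E I A) =
      (\<Prod>i\<in>I. emeasure (density M f) (A i))" .
  qed
qed

lemma sigma_finite_PiM:
  assumes "sigma_finite_measure M" "finite I"
  shows "sigma_finite_measure (\<Pi>\<^sub>M i\<in>I. M)"
proof -
  interpret product_sigma_finite "\<lambda>_. M" using assms by (simp add: product_sigma_finite_def)
  show ?thesis using sigma_finite[OF assms(2)] .
qed

lemma prob_space_two_sample:
  assumes "prob_space P" "prob_space Q"
  shows "prob_space (two_sample m1 m2 P Q)"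
  unfolding two_sample_def by (intro prob_space_pair prob_space_PiM assms)

lemma sets_two_sample:
  assumes "sets P = sets P'" "sets Q = sets Q'"
  shows "sets (two_sample m1 m2 P Q) = sets (two_sample m1 m2 P' Q')"
  unfolding two_sample_def by (intro sets_pair_measure_cong sets_PiM_cong assms refl)

text \<open>The value type is general because the same product serves for real densities, roots and
  indicators and for complex characteristic functions.\<close>

definition sample_prod :: "nat \<Rightarrow> nat \<Rightarrow> ('a \<Rightarrow> 'c::comm_monoid_mult) \<Rightarrow> ('b \<Rightarrow> 'c) \<Rightarrow> (nat \<Rightarrow> 'a) \<times> (nat \<Rightarrow> 'b) \<Rightarrow> 'c" where
  "sample_prod m1 m2 u v \<omega> = (\<Prod>i=1..m1. u (fst \<omega> i)) * (\<Prod>j=1..m2. v (snd \<omega> j))"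

lemma sample_prod_measurable[measurable]:
  fixes u :: "'a \<Rightarrow> 'c::{second_countable_topology, real_normed_field}"
  assumes [measurable]: "u \<in> borel_measurable P" "v \<in> borel_measurable Q"
  shows "sample_prod m1 m2 u v \<in> borel_measurable (two_sample m1 m2 P Q)"
  unfolding sample_prod_def two_sample_def by measurable

lemma sample_prod_mult:
  "sample_prod m1 m2 u v \<omega> * sample_prod m1 m2 u' v' \<omega> =
    sample_prod m1 m2 (\<lambda>x. u x * u' x) (\<lambda>y. v y * v' y) \<omega>"
  for u u' :: "'a \<Rightarrow> 'c::comm_monoid_mult"
  by (simp add: sample_prod_def prod.distrib algebra_simps)

lemma
  fixes u :: "'a \<Rightarrow> 'c::{second_countable_topology, banach, real_normed_field}"
  assumes P: "prob_space P" and Q: "prob_space Q"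
    and u: "integrable P u" and v: "integrable Q v"
  shows integrable_sample_prod: "integrable (two_sample m1 m2 P Q) (sample_prod m1 m2 u v)"
    and integral_sample_prod: "(\<integral>\<omega>. sample_prod m1 m2 u v \<omega> \<partial>two_sample m1 m2 P Q) =
      (\<integral>x. u x \<partial>P) ^ m1 * (\<integral>y. v y \<partial>Q) ^ m2"
proof -
  interpret P: prob_space P by fact
  interpret Q: prob_space Q by fact
  interpret PP: product_sigma_finite "\<lambda>_::nat. P" by (simp add: product_sigma_finite_def P.sigma_finite_measure_axioms)
  interpret QQ: product_sigma_finite "\<lambda>_::nat. Q" by (simp add: product_sigma_finite_def Q.sigma_finite_measure_axioms)
  interpret Pn: prob_space "\<Pi>\<^sub>M i\<in>{1..m1}. P" by (intro prob_space_PiM P)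
  interpret Qn: prob_space "\<Pi>\<^sub>M i\<in>{1..m2}. Q" by (intro prob_space_PiM Q)
  interpret N: pair_prob_space "\<Pi>\<^sub>M i\<in>{1..m1}. P" "\<Pi>\<^sub>M i\<in>{1..m2}. Q" ..
  have i: "integrable (\<Pi>\<^sub>M i\<in>{1..m1}. P) (\<lambda>x. \<Prod>i=1..m1. u (x i))" "integrable (\<Pi>\<^sub>M i\<in>{1..m2}. Q) (\<lambda>x. \<Prod>i=1..m2. v (x i))"
    using u v by (auto intro!: PP.product_integrable_prod QQ.product_integrable_prod)
  show "integrable (two_sample m1 m2 P Q) (sample_prod m1 m2 u v)"
    unfolding two_sample_def sample_prod_def[abs_def] by (rule N.integrable_times[OF i])
  have "(\<integral>\<omega>. sample_prod m1 m2 u v \<omega> \<partial>two_sample m1 m2 P Q) =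
    (\<integral>x. (\<Prod>i=1..m1. u (x i)) \<partial>(\<Pi>\<^sub>M i\<in>{1..m1}. P)) * (\<integral>y. (\<Prod>i=1..m2. v (y i)) \<partial>(\<Pi>\<^sub>M i\<in>{1..m2}. Q))"
    unfolding two_sample_def sample_prod_def[abs_def] by (rule N.integral_times[OF i])
  also have "\<dots> = (\<integral>x. u x \<partial>P) ^ m1 * (\<integral>y. v y \<partial>Q) ^ m2"
    using PP.product_integral_prod[of "{1..m1}" "\<lambda>_. u"] QQ.product_integral_prod[of "{1..m2}" "\<lambda>_. v"] u v
    by (simp del: One_nat_def)
  finally show "(\<integral>\<omega>. sample_prod m1 m2 u v \<omega> \<partial>two_sample m1 m2 P Q) =
      (\<integral>x. u x \<partial>P) ^ m1 * (\<integral>y. v y \<partial>Q) ^ m2" .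
qed

text \<open>The masses of u and v are left free: the lemma is applied to the parts of two laws that
  have a density with respect to a base measure, whose mass may be below 1.\<close>

lemma two_sample_density:
  fixes u :: "'a \<Rightarrow> real" and v :: "'b \<Rightarrow> real"
  assumes P: "prob_space P" and Q: "prob_space Q"
    and u: "integrable P u" "\<And>x. 0 \<le> u x" and v: "integrable Q v" "\<And>y. 0 \<le> v y"
  shows "two_sample m1 m2 (density P u) (density Q v) =
    density (two_sample m1 m2 P Q) (sample_prod m1 m2 u v)"
proof -
  interpret P: prob_space P by fact
  interpret Q: prob_space Q by fact
  have [measurable]: "u \<in> borel_measurable P" "v \<in> borel_measurable Q" using u v by auto
  have fin: "sigma_finite_measure (density P u)" "sigma_finite_measure (density Q v)"
    using u v
    by (auto intro!: finite_measure.axioms(1) finite_measureI simp: emeasure_density nn_integral_eq_integral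
        cong: nn_integral_cong)
  have *: "(\<Pi>\<^sub>M i\<in>{1..m1}. density P u) = density (\<Pi>\<^sub>M i\<in>{1..m1}. P) (\<lambda>x. \<Prod>i=1..m1. ennreal (u (x i)))"
    "(\<Pi>\<^sub>M i\<in>{1..m2}. density Q v) = density (\<Pi>\<^sub>M i\<in>{1..m2}. Q) (\<lambda>x. \<Prod>i=1..m2. ennreal (v (x i)))"
    by (intro PiM_density P.sigma_finite_measure_axioms Q.sigma_finite_measure_axioms fin; simp)+
  have "two_sample m1 m2 (density P u) (density Q v) =
      density (two_sample m1 m2 P Q) (\<lambda>(x, y). (\<Prod>i=1..m1. ennreal (u (x i))) * (\<Prod>j=1..m2. ennreal (v (y j))))"
    unfolding two_sample_def *
    by (rule pair_measure_density)
      (use fin sigma_finite_PiM[OF fin(2), of "{1..m2}"] sigma_finite_PiM[OF Q.sigma_finite_measure_axioms, of "{1..m2}"] * in auto)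
  also have "\<dots> = density (two_sample m1 m2 P Q) (sample_prod m1 m2 u v)"
    by (rule arg_cong[where f="density _"])
      (auto simp: fun_eq_iff sample_prod_def prod_ennreal u v prod_nonneg ennreal_mult[symmetric])
  finally show ?thesis .
qed

section \<open>Total variation between samples through Hellinger affinities\<close>

lemma power_mult_Bernoulli:
  fixes a b :: real
  assumes "0 \<le> a" "a \<le> 1" "0 \<le> b" "b \<le> 1"
  shows "1 - (real m * (1 - a) + real n * (1 - b)) \<le> a ^ m * b ^ n"
proof -
  have "1 - real m * (1 - a) \<le> a ^ m" "1 - real n * (1 - b) \<le> b ^ n"
    using Bernoulli_inequality[of "a - 1" m] Bernoulli_inequality[of "b - 1" n] assms by (auto simp: algebra_simps)
  \<comment> \<open>Expanding this product merges the two Bernoulli bounds into one, in which the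
    defects from 1 add up.\<close>
  moreover have "0 \<le> (1 - a ^ m) * (1 - b ^ n)"
    using assms by (intro mult_nonneg_nonneg) (auto simp: power_le_one)
  ultimately show ?thesis by (simp add: algebra_simps)
qed

text \<open>A and B are roots of densities of mass at most 1. Write
  \<open>A\<^sup>2 - B\<^sup>2 = (A - B) * (A + B)\<close> and apply Cauchy-Schwarz: the squared
  norm of the first factor is at most twice the defect of the affinity, that of the second at most
  4, whence the constant 8.\<close>

lemma integral_test_diff_le:
  assumes "prob_space N" and A: "A \<in> L2 N" "(\<integral>x. (A x)\<^sup>2 \<partial>N) \<le> 1" and B: "B \<in> L2 N" "(\<integral>x. (B x)\<^sup>2 \<partial>N) \<le> 1"
    and \<phi>: "\<phi> \<in> borel_measurable N" "\<And>x. x \<in> space N \<Longrightarrow> 0 \<le> \<phi> x \<and> \<phi> x \<le> (1::real)"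
  shows "\<bar>(\<integral>x. \<phi> x * (A x)\<^sup>2 \<partial>N) - (\<integral>x. \<phi> x * (B x)\<^sup>2 \<partial>N)\<bar> \<le> sqrt (8 * (1 - (\<integral>x. A x * B x \<partial>N)))"
proof -
  interpret prob_space N by fact
  note [measurable] = \<phi>(1) A(1)[THEN L2_measurable] B(1)[THEN L2_measurable]
  have pi: "integrable N (\<lambda>x. \<phi> x * (f x)\<^sup>2)" if "f \<in> L2 N" for f
    by (rule Bochner_Integration.integrable_bound[OF L2_square_integrable[OF that]])
      (use L2_measurable[OF that] \<phi>(2) in \<open>auto intro!: mult_left_le_one_le AE_I2 simp: abs_mult\<close>)
  define C where "C x = \<phi> x * (A x - B x)" for x
  have AB: "(\<lambda>x. A x - B x) \<in> L2 N" "(\<lambda>x. A x + B x) \<in> L2 N" by (intro L2_diff L2_add A B)+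
  have C: "C \<in> L2 N"
    by (rule L2_bound[OF AB(1)]) (use \<phi>(2) in \<open>auto simp: C_def[abs_def] abs_mult intro!: mult_left_le_one_le AE_I2\<close>)
  have ABi: "integrable N (\<lambda>x. A x * B x)" by (rule L2_mult_integrable[OF A(1) B(1)])
  have 1: "(\<integral>x. (C x)\<^sup>2 \<partial>N) \<le> 2 * (1 - (\<integral>x. A x * B x \<partial>N))"
  proof -
    have "(\<integral>x. (C x)\<^sup>2 \<partial>N) \<le> (\<integral>x. (A x - B x)\<^sup>2 \<partial>N)"
    proof (rule integral_mono)
      fix x assume "x \<in> space N"
      then have "(\<phi> x)\<^sup>2 \<le> 1" using \<phi>(2)[of x] by (simp add: power_le_one)
      then show "(C x)\<^sup>2 \<le> (A x - B x)\<^sup>2" by (simp add: C_def power_mult_distrib mult_left_le_one_le)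
    qed (use C AB in \<open>auto simp: L2_def\<close>)
    also have "\<dots> = (\<integral>x. (A x)\<^sup>2 + (B x)\<^sup>2 - 2 * (A x * B x) \<partial>N)"
      by (intro Bochner_Integration.integral_cong) (auto simp: power2_eq_square algebra_simps)
    also have "\<dots> = (\<integral>x. (A x)\<^sup>2 \<partial>N) + (\<integral>x. (B x)\<^sup>2 \<partial>N) - 2 * (\<integral>x. A x * B x \<partial>N)"
      using A B ABi by (auto simp: L2_def)
    finally show ?thesis using A B by simp
  qed
  have 2: "(\<integral>x. (A x + B x)\<^sup>2 \<partial>N) \<le> 4"
  proof -
    have "(\<integral>x. (A x + B x)\<^sup>2 \<partial>N) \<le> (\<integral>x. 2 * (A x)\<^sup>2 + 2 * (B x)\<^sup>2 \<partial>N)"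
    proof (rule integral_mono)
      fix x
      have "2 * (A x)\<^sup>2 + 2 * (B x)\<^sup>2 - (A x + B x)\<^sup>2 = (A x - B x)\<^sup>2" by (simp add: power2_eq_square algebra_simps)
      then show "(A x + B x)\<^sup>2 \<le> 2 * (A x)\<^sup>2 + 2 * (B x)\<^sup>2" by (smt (verit) zero_le_power2)
    qed (use A B AB in \<open>auto simp: L2_def\<close>)
    also have "\<dots> = 2 * (\<integral>x. (A x)\<^sup>2 \<partial>N) + 2 * (\<integral>x. (B x)\<^sup>2 \<partial>N)" using A B by (auto simp: L2_def)
    finally show ?thesis using A B by simp
  qed
  have "(\<integral>x. \<phi> x * (A x)\<^sup>2 \<partial>N) - (\<integral>x. \<phi> x * (B x)\<^sup>2 \<partial>N) = (\<integral>x. \<phi> x * (A x)\<^sup>2 - \<phi> x * (B x)\<^sup>2 \<partial>N)"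
    using pi A B by simp
  also have "\<dots> = (\<integral>x. C x * (A x + B x) \<partial>N)"
    by (intro Bochner_Integration.integral_cong) (auto simp: C_def power2_eq_square algebra_simps)
  finally have eq: "(\<integral>x. \<phi> x * (A x)\<^sup>2 \<partial>N) - (\<integral>x. \<phi> x * (B x)\<^sup>2 \<partial>N) = (\<integral>x. C x * (A x + B x) \<partial>N)" .
  have "(\<integral>x. C x * (A x + B x) \<partial>N)\<^sup>2 \<le> (\<integral>x. (C x)\<^sup>2 \<partial>N) * (\<integral>x. (A x + B x)\<^sup>2 \<partial>N)"
    by (rule Cauchy_Schwarz_integral[OF C AB(2)])
  also have "\<dots> \<le> (2 * (1 - (\<integral>x. A x * B x \<partial>N))) * 4"
    using 2 order_trans[OF _ 1, of 0] by (intro mult_mono 1) (simp_all add: integral_nonneg_AE)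
  finally show ?thesis
    unfolding eq by (intro real_le_rsqrt) simp
qed

text \<open>Two errors add up. Discarding the samples that contain a point with infinite quotient
  costs at most the expected number of such points, \<open>m1 * \<sigma>1 + m2 * \<sigma>2\<close>.
  The rest has the product of the root quotients as root density; affinities are multiplicative over
  independent observations, so the defect of the product is at most the sum of the defects.\<close>

lemma two_sample_test_diff_le:
  fixes P P0 :: "'a measure" and Q Q0 :: "'b measure" and u :: "'a \<Rightarrow> real" and v :: "'b \<Rightarrow> real"
  assumes P: "prob_space P" "prob_space P0" "sets P = sets P0"
    and Q: "prob_space Q" "prob_space Q0" "sets Q = sets Q0"
    and p: "is_density_quotient P P0 p" and q: "is_density_quotient Q Q0 q"
    and u: "integrable P0 u" "\<And>x. 0 \<le> u x" "(\<integral>x. u x \<partial>P0) = 1"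
    and v: "integrable Q0 v" "\<And>y. 0 \<le> v y" "(\<integral>y. v y \<partial>Q0) = 1"
    and \<phi>: "\<phi> \<in> borel_measurable (two_sample m1 m2 P0 Q0)"
      "\<And>\<omega>. \<omega> \<in> space (two_sample m1 m2 P0 Q0) \<Longrightarrow> 0 \<le> \<phi> \<omega> \<and> \<phi> \<omega> \<le> (1::real)"
  defines "\<sigma>1 \<equiv> measure P {x \<in> space P. p x = \<infinity>}" and "\<sigma>2 \<equiv> measure Q {y \<in> space Q. q y = \<infinity>}"
    and "D1 \<equiv> 1 - (\<integral>x. density_root p x * sqrt (u x) \<partial>P0)" and "D2 \<equiv> 1 - (\<integral>y. density_root q y * sqrt (v y) \<partial>Q0)"
  shows "\<bar>(\<integral>\<omega>. \<phi> \<omega> \<partial>two_sample m1 m2 P Q) - (\<integral>\<omega>. \<phi> \<omega> * sample_prod m1 m2 u v \<omega> \<partial>two_sample m1 m2 P0 Q0)\<bar>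
    \<le> (real m1 * \<sigma>1 + real m2 * \<sigma>2) + sqrt (8 * (real m1 * D1 + real m2 * D2))"
proof -
  interpret P: prob_space P by fact
  interpret P0: prob_space P0 by fact
  interpret Q: prob_space Q by fact
  interpret Q0: prob_space Q0 by fact
  let ?N = "two_sample m1 m2 P Q" and ?K = "two_sample m1 m2 P0 Q0"
  interpret N: prob_space ?N by (rule prob_space_two_sample[OF P(1) Q(1)])
  interpret N0: prob_space ?K by (rule prob_space_two_sample[OF P(2) Q(2)])
  have setsN: "sets ?N = sets ?K" by (rule sets_two_sample[OF P(3) Q(3)])
  have spN: "space ?N = space ?K" using setsN by (rule sets_eq_imp_space_eq)
  have \<phi>N[measurable]: "\<phi> \<in> borel_measurable ?N" using \<phi>(1) measurable_cong_sets[OF setsN refl] by auto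
  note \<phi>(1)[measurable]
  note rp = density_root_L2[OF P(1,3) p] and rq = density_root_L2[OF Q(1,3) q]
  have [measurable]: "u \<in> borel_measurable P0" "v \<in> borel_measurable Q0" using u v by auto
  have pm[measurable]: "p \<in> borel_measurable P0" "q \<in> borel_measurable Q0" using p q by (auto simp: is_density_quotient_def)
  define Fp where "Fp = {x \<in> space P0. p x < \<infinity>}"
  define Fq where "Fq = {x \<in> space Q0. q x < \<infinity>}"
  have [measurable]: "Fp \<in> sets P" "Fq \<in> sets Q" unfolding Fp_def Fq_def P(3) Q(3) by measurable
  have dp: "density P0 (\<lambda>x. ennreal ((density_root p x)\<^sup>2)) = density P (\<lambda>x. ennreal (indicator Fp x))"
  proof -
    have "density P0 (\<lambda>x. ennreal ((density_root p x)\<^sup>2)) = density P0 p"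
      using p by (intro density_cong) (auto simp: density_root_power2 is_density_quotient_def elim: eventually_mono)
    also have "\<dots> = density P (indicator Fp)"
      using p[unfolded is_density_quotient_iff[OF P.finite_measure_axioms P(3)]] by (simp add: Fp_def)
    finally show ?thesis by (simp add: ennreal_indicator)
  qed
  have dq: "density Q0 (\<lambda>x. ennreal ((density_root q x)\<^sup>2)) = density Q (\<lambda>x. ennreal (indicator Fq x))"
  proof -
    have "density Q0 (\<lambda>x. ennreal ((density_root q x)\<^sup>2)) = density Q0 q"
      using q by (intro density_cong) (auto simp: density_root_power2 is_density_quotient_def elim: eventually_mono)
    also have "\<dots> = density Q (indicator Fq)"
      using q[unfolded is_density_quotient_iff[OF Q.finite_measure_axioms Q(3)]] by (simp add: Fq_def)
    finally show ?thesis by (simp add: ennreal_indicator)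
  qed
  let ?I = "sample_prod m1 m2 (indicator Fp) (indicator Fq) :: _ \<Rightarrow> real"
  let ?A = "sample_prod m1 m2 (density_root p) (density_root q)"
  let ?B = "sample_prod m1 m2 (\<lambda>x. sqrt (u x)) (\<lambda>y. sqrt (v y))"
  have A2: "(?A \<omega>)\<^sup>2 = sample_prod m1 m2 (\<lambda>x. (density_root p x)\<^sup>2) (\<lambda>x. (density_root q x)\<^sup>2) \<omega>" for \<omega>
    by (simp add: power2_eq_square sample_prod_mult)
  have B2: "(?B \<omega>)\<^sup>2 = sample_prod m1 m2 u v \<omega>" for \<omega>
    by (simp add: power2_eq_square sample_prod_mult u v)
  have rpm[measurable]: "density_root p \<in> borel_measurable P0" "density_root q \<in> borel_measurable Q0"
    using rp(1) rq(1) by (auto simp: L2_def)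
  have A2i: "integrable ?K (\<lambda>\<omega>. (?A \<omega>)\<^sup>2)"
      "(\<integral>\<omega>. (?A \<omega>)\<^sup>2 \<partial>?K) = (\<integral>x. (density_root p x)\<^sup>2 \<partial>P0) ^ m1 * (\<integral>x. (density_root q x)\<^sup>2 \<partial>Q0) ^ m2"
    unfolding A2 by (intro integrable_sample_prod integral_sample_prod P Q L2_square_integrable rp rq)+
  have B2i: "integrable ?K (\<lambda>\<omega>. (?B \<omega>)\<^sup>2)" "(\<integral>\<omega>. (?B \<omega>)\<^sup>2 \<partial>?K) = 1"
    unfolding B2 using integrable_sample_prod[OF P(2) Q(2) u(1) v(1)] integral_sample_prod[OF P(2) Q(2) u(1) v(1)] u(3) v(3)
    by auto
  have AL2: "?A \<in> L2 ?K" using A2i by (simp add: L2_def)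
  have BL2: "?B \<in> L2 ?K" using B2i by (simp add: L2_def)
  have Sp: "0 \<le> \<sigma>1" "\<sigma>1 \<le> 1" "0 \<le> \<sigma>2" "\<sigma>2 \<le> 1" unfolding \<sigma>1_def \<sigma>2_def by auto
  have A2le: "(\<integral>\<omega>. (?A \<omega>)\<^sup>2 \<partial>?K) \<le> 1"
    unfolding A2i using rp(3) rq(3) by (intro mult_le_one power_le_one zero_le_power) auto
  have su: "(\<lambda>x. sqrt (u x)) \<in> L2 P0" "(\<lambda>x. sqrt (v x)) \<in> L2 Q0" using u v by (auto simp: L2_def)
  have ABi: "(\<integral>\<omega>. ?A \<omega> * ?B \<omega> \<partial>?K) = (1 - D1) ^ m1 * (1 - D2) ^ m2"
    unfolding sample_prod_mult D1_def D2_def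
    by (subst integral_sample_prod) (auto intro!: P Q L2_mult_integrable rp rq su)
  \<comment> \<open>Bernoulli needs the affinities in [0, 1]; Cauchy-Schwarz bounds them by 1 since
    all roots have norm at most 1.\<close>
  have rho: "0 \<le> 1 - D1" "1 - D1 \<le> 1" "0 \<le> 1 - D2" "1 - D2 \<le> 1"
  proof -
    show "0 \<le> 1 - D1" "0 \<le> 1 - D2"
      unfolding D1_def D2_def by (auto intro!: integral_nonneg_AE AE_I2 mult_nonneg_nonneg density_root_nonneg u v)
    have "(1 - D1)\<^sup>2 \<le> (\<integral>x. (density_root p x)\<^sup>2 \<partial>P0) * (\<integral>x. (sqrt (u x))\<^sup>2 \<partial>P0)"
      unfolding D1_def using Cauchy_Schwarz_integral[OF rp(1) su(1)] by simp
    also have "\<dots> \<le> 1" using rp(3) u by simp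
    finally show "1 - D1 \<le> 1" using power2_le_imp_le[of "1 - D1" 1] by simp
    have "(1 - D2)\<^sup>2 \<le> (\<integral>x. (density_root q x)\<^sup>2 \<partial>Q0) * (\<integral>x. (sqrt (v x))\<^sup>2 \<partial>Q0)"
      unfolding D2_def using Cauchy_Schwarz_integral[OF rq(1) su(2)] by simp
    also have "\<dots> \<le> 1" using rq(3) v by simp
    finally show "1 - D2 \<le> 1" using power2_le_imp_le[of "1 - D2" 1] by simp
  qed
  have 1: "\<bar>(\<integral>\<omega>. \<phi> \<omega> * (?A \<omega>)\<^sup>2 \<partial>?K) - (\<integral>\<omega>. \<phi> \<omega> * (?B \<omega>)\<^sup>2 \<partial>?K)\<bar> \<le> sqrt (8 * (real m1 * D1 + real m2 * D2))"
  proof -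
    have "\<bar>(\<integral>\<omega>. \<phi> \<omega> * (?A \<omega>)\<^sup>2 \<partial>?K) - (\<integral>\<omega>. \<phi> \<omega> * (?B \<omega>)\<^sup>2 \<partial>?K)\<bar> \<le> sqrt (8 * (1 - (\<integral>\<omega>. ?A \<omega> * ?B \<omega> \<partial>?K)))"
      by (rule integral_test_diff_le[OF N0.prob_space_axioms AL2 A2le BL2 _ \<phi>]) (use B2i in auto)
    also have "\<dots> \<le> sqrt (8 * (real m1 * D1 + real m2 * D2))"
      using power_mult_Bernoulli[OF rho(1,2) rho(3,4), of m1 m2] by (auto simp: ABi)
    finally show ?thesis .
  qed
  \<comment> \<open>The squared product root is the density of the sample law restricted to the
    samples on which all quotients are finite, and \<open>?I\<close> is the indicator of these
    samples.\<close>
  have AI: "(\<integral>\<omega>. \<phi> \<omega> * (?A \<omega>)\<^sup>2 \<partial>?K) = (\<integral>\<omega>. \<phi> \<omega> * ?I \<omega> \<partial>?N)"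
  proof -
    have "(\<integral>\<omega>. \<phi> \<omega> * (?A \<omega>)\<^sup>2 \<partial>?K) = (\<integral>\<omega>. \<phi> \<omega> \<partial>density ?K (\<lambda>\<omega>. (?A \<omega>)\<^sup>2))"
      by (subst integral_real_density) (auto simp: mult.commute)
    also have "density ?K (\<lambda>\<omega>. (?A \<omega>)\<^sup>2) = two_sample m1 m2 (density P0 (\<lambda>x. (density_root p x)\<^sup>2)) (density Q0 (\<lambda>x. (density_root q x)\<^sup>2))"
      unfolding A2 by (rule two_sample_density[symmetric]) (auto intro: P Q L2_square_integrable rp rq)
    also have "\<dots> = two_sample m1 m2 (density P (\<lambda>x. indicator Fp x :: real)) (density Q (\<lambda>x. indicator Fq x :: real))"
      unfolding dp dq ..
    also have "\<dots> = density ?N ?I"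
      by (rule two_sample_density)
        (auto intro!: P Q P.integrable_const_bound[where B=1] Q.integrable_const_bound[where B=1])
    also have "(\<integral>\<omega>. \<phi> \<omega> \<partial>density ?N ?I) = (\<integral>\<omega>. \<phi> \<omega> * ?I \<omega> \<partial>?N)"
      by (subst integral_real_density) (auto simp: mult.commute sample_prod_def prod_nonneg)
    finally show ?thesis .
  qed
  have I01: "0 \<le> ?I \<omega>" "?I \<omega> \<le> 1" for \<omega>
    by (auto simp: sample_prod_def prod_nonneg intro!: mult_le_one prod_le_1)
  have Ii: "integrable ?N ?I" "(\<integral>\<omega>. ?I \<omega> \<partial>?N) = (1 - \<sigma>1) ^ m1 * (1 - \<sigma>2) ^ m2"
  proof -
    have sp: "space P = space P0" "space Q = space Q0" using P(3) Q(3) by (auto dest: sets_eq_imp_space_eq)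
    have pc: "{x \<in> space P. p x = \<infinity>} = space P - Fp" "{x \<in> space Q. q x = \<infinity>} = space Q - Fq"
      by (auto simp: Fp_def Fq_def sp less_top[symmetric])
    have "measure P Fp = 1 - \<sigma>1" "measure Q Fq = 1 - \<sigma>2"
      unfolding \<sigma>1_def \<sigma>2_def pc by (simp_all add: P.prob_compl Q.prob_compl)
    moreover have ii: "integrable P (indicator Fp :: _ \<Rightarrow> real)" "integrable Q (indicator Fq :: _ \<Rightarrow> real)"
      by (auto intro!: P.integrable_const_bound[where B=1] Q.integrable_const_bound[where B=1])
    ultimately show "integrable ?N ?I" "(\<integral>\<omega>. ?I \<omega> \<partial>?N) = (1 - \<sigma>1) ^ m1 * (1 - \<sigma>2) ^ m2"
      using integrable_sample_prod[OF P(1) Q(1) ii] integral_sample_prod[OF P(1) Q(1) ii] by (auto simp: Int_absorb1)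
  qed
  have \<phi>i: "integrable ?N \<phi>" using \<phi>(2) by (intro N.integrable_const_bound[where B=1]) (auto simp: spN)
  have \<phi>Ii: "integrable ?N (\<lambda>\<omega>. \<phi> \<omega> * ?I \<omega>)"
    using \<phi>(2) I01 by (intro N.integrable_const_bound[where B=1]) (auto simp: spN abs_mult intro!: AE_I2 mult_le_one)
  have "(\<integral>\<omega>. \<phi> \<omega> \<partial>?N) - (\<integral>\<omega>. \<phi> \<omega> * ?I \<omega> \<partial>?N) = (\<integral>\<omega>. \<phi> \<omega> * (1 - ?I \<omega>) \<partial>?N)"
    using \<phi>i \<phi>Ii by (simp add: right_diff_distrib)
  moreover have "0 \<le> (\<integral>\<omega>. \<phi> \<omega> * (1 - ?I \<omega>) \<partial>?N)"
    using \<phi>(2) I01 by (intro integral_nonneg_AE AE_I2) (auto simp: spN)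
  moreover have "(\<integral>\<omega>. \<phi> \<omega> * (1 - ?I \<omega>) \<partial>?N) \<le> (\<integral>\<omega>. 1 - ?I \<omega> \<partial>?N)"
  proof (rule integral_mono)
    fix \<omega> assume "\<omega> \<in> space ?N"
    then show "\<phi> \<omega> * (1 - ?I \<omega>) \<le> 1 - ?I \<omega>"
      using \<phi>(2)[of \<omega>] I01[of \<omega>] by (intro mult_left_le_one_le) (auto simp: spN)
  qed (use \<phi>i \<phi>Ii Ii in \<open>auto simp: right_diff_distrib\<close>)
  moreover have "(\<integral>\<omega>. 1 - ?I \<omega> \<partial>?N) = 1 - (1 - \<sigma>1) ^ m1 * (1 - \<sigma>2) ^ m2"
    using Ii by (simp add: N.prob_space)
  moreover have "1 - (real m1 * \<sigma>1 + real m2 * \<sigma>2) \<le> (1 - \<sigma>1) ^ m1 * (1 - \<sigma>2) ^ m2"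
    using power_mult_Bernoulli[of "1 - \<sigma>1" "1 - \<sigma>2" m1 m2] Sp by simp
  ultimately have 2: "\<bar>(\<integral>\<omega>. \<phi> \<omega> \<partial>?N) - (\<integral>\<omega>. \<phi> \<omega> * ?I \<omega> \<partial>?N)\<bar> \<le> real m1 * \<sigma>1 + real m2 * \<sigma>2"
    by linarith
  show ?thesis using 1 2 unfolding AI B2 by linarith
qed

section \<open>Exponential tilts of two-sample products\<close>

text \<open>The third order Taylor remainder at \<open>\<zeta> n / sqrt n\<close>, multiplied by n,
  is of size \<open>1 / sqrt n\<close> because \<open>\<zeta> n\<close> converges and hence stays
  bounded.\<close>

lemma cexp_second_order:
  fixes \<zeta> :: "nat \<Rightarrow> complex"
  assumes \<zeta>: "\<zeta> \<longlonglongrightarrow> z"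
  shows "(\<lambda>n. real n * (exp (\<zeta> n / sqrt (real n)) - 1 - \<zeta> n / sqrt (real n))) \<longlonglongrightarrow> z\<^sup>2 / 2"
proof -
  have z0: "(\<lambda>n. norm (\<zeta> n) / sqrt (real n)) \<longlonglongrightarrow> 0"
    using \<zeta> by (intro real_tendsto_divide_at_top[OF tendsto_norm] filterlim_compose[OF sqrt_at_top filterlim_real_sequentially])
  let ?z = "\<lambda>n. \<zeta> n / complex_of_real (sqrt (real n))"
  let ?R = "\<lambda>n. real n * (exp (?z n) - 1 - ?z n) - (\<zeta> n)\<^sup>2 / 2"
  have "?R \<longlonglongrightarrow> 0"
  proof (rule Lim_null_comparison)
    have "norm (?R n) \<le> exp (norm (\<zeta> n) / sqrt (real n)) * (norm (\<zeta> n))\<^sup>2 * (norm (\<zeta> n) / sqrt (real n)) / 2" if "n > 0" for n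
    proof -
      have n: "real n > 0" using that by simp
      have nz: "norm (?z n) = norm (\<zeta> n) / sqrt (real n)" by (simp add: norm_divide)
      have sq: "of_nat n * ((?z n)\<^sup>2 / 2) = (\<zeta> n)\<^sup>2 / 2"
        using n by (simp add: power_divide of_real_power[symmetric] del: of_real_power)
      have sum: "(\<Sum>k\<le>2. w ^ k / fact k) = 1 + w + w\<^sup>2 / 2" for w :: complex
        by (simp add: numeral_2_eq_2)
      have "?R n = of_nat n * (exp (?z n) - (\<Sum>k\<le>2. ?z n ^ k / fact k))"
        unfolding sq[symmetric] sum by (simp add: algebra_simps)
      then have "norm (?R n) = real n * norm (exp (?z n) - (\<Sum>k\<le>2. ?z n ^ k / fact k))"
        by (simp only: norm_mult norm_of_nat)
      also have "\<dots> \<le> real n * (exp (norm (?z n)) * norm (?z n) ^ Suc 2 / fact 2)"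
        by (intro mult_left_mono Taylor_exp_field) simp
      also have "\<dots> = exp (norm (\<zeta> n) / sqrt (real n)) * (norm (\<zeta> n))\<^sup>2 * (norm (\<zeta> n) / sqrt (real n)) / 2"
      proof -
        have "real n = sqrt (real n) * sqrt (real n)" by simp
        then show ?thesis unfolding nz using n by (simp add: power3_eq_cube power2_eq_square fact_2 eval_nat_numeral)
      qed
      finally show ?thesis .
    qed
    then show "\<forall>\<^sub>F n in sequentially. norm (?R n) \<le> exp (norm (\<zeta> n) / sqrt (real n)) * (norm (\<zeta> n))\<^sup>2 * (norm (\<zeta> n) / sqrt (real n)) / 2"
      by (rule eventually_mono[OF eventually_gt_at_top[of 0]])
    have "(\<lambda>n. exp (norm (\<zeta> n) / sqrt (real n)) * (norm (\<zeta> n))\<^sup>2 * (norm (\<zeta> n) / sqrt (real n)) / 2) \<longlonglongrightarrow> exp 0 * (norm z)\<^sup>2 * 0 / 2"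
      by (intro tendsto_intros z0 \<zeta>) auto
    then show "(\<lambda>n. exp (norm (\<zeta> n) / sqrt (real n)) * (norm (\<zeta> n))\<^sup>2 * (norm (\<zeta> n) / sqrt (real n)) / 2) \<longlonglongrightarrow> 0" by simp
  qed
  from tendsto_add[OF this, of "\<lambda>n. (\<zeta> n)\<^sup>2 / 2" "z\<^sup>2 / 2"] \<zeta> show ?thesis
    by (simp add: tendsto_intros)
qed

text \<open>Bounding the real part by \<open>C * sqrt n\<close> keeps the exponential bounded, so
  the remainder after the linear term is dominated by a constant times \<open>H\<^sup>2\<close> and
  converges by dominated convergence; the linear term vanishes by the condition on the means. The
  imaginary part may be unbounded, since it does not affect the modulus of the exponential; it will
  carry the argument of a characteristic function.\<close>

lemma (in prob_space) exponential_moment_expansion: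
  fixes \<zeta> :: "nat \<Rightarrow> 'a \<Rightarrow> complex"
  assumes \<zeta>m[measurable]: "\<And>n. \<zeta> n \<in> borel_measurable M" "z \<in> borel_measurable M"
    and H: "H \<in> L2 M" "\<And>n. AE x in M. norm (\<zeta> n x) \<le> H x"
    and lim: "AE x in M. (\<lambda>n. \<zeta> n x) \<longlonglongrightarrow> z x"
    and C: "\<And>n x. \<bar>Re (\<zeta> n x)\<bar> \<le> C * sqrt (real n)"
    and mean: "(\<lambda>n. sqrt (real n) * (\<integral>x. \<zeta> n x \<partial>M)) \<longlonglongrightarrow> 0"
  shows "integrable M (\<lambda>x. exp (\<zeta> n x / sqrt (real n)))"
    and "(\<lambda>n. real n * ((\<integral>x. exp (\<zeta> n x / sqrt (real n)) \<partial>M) - 1)) \<longlonglongrightarrow> (\<integral>x. (z x)\<^sup>2 \<partial>M) / 2"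
proof -
  have C0: "\<bar>Re (\<zeta> n x / sqrt (real n))\<bar> \<le> \<bar>C\<bar>" for n x
  proof (cases "n = 0")
    case False
    then have "\<bar>Re (\<zeta> n x / sqrt (real n))\<bar> \<le> C"
      using C[of n x] by (simp add: Re_divide_of_real abs_divide divide_le_eq)
    then show ?thesis by linarith
  qed simp
  have expi: "integrable M (\<lambda>x. exp (\<zeta> n x / sqrt (real n)))" for n
  proof (rule integrable_const_bound[where B="exp \<bar>C\<bar>"])
    show "AE x in M. norm (exp (\<zeta> n x / complex_of_real (sqrt (real n)))) \<le> exp \<bar>C\<bar>"
      using C0[of n, THEN abs_le_D1] by (intro AE_I2) simp
  qed measurable
  then show "integrable M (\<lambda>x. exp (\<zeta> n x / sqrt (real n)))" .
  have \<zeta>i: "integrable M (\<zeta> n)" for n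
    using L2_integrable[OF H(1)] by (rule Bochner_Integration.integrable_bound) (use H(2)[of n] in \<open>auto elim!: eventually_mono\<close>)
  let ?X = "\<lambda>n x. real n * (exp (\<zeta> n x / sqrt (real n)) - 1 - \<zeta> n x / sqrt (real n))"
  have X: "(\<lambda>n. \<integral>x. ?X n x \<partial>M) \<longlonglongrightarrow> (\<integral>x. (z x)\<^sup>2 / 2 \<partial>M)"
  proof (rule integral_dominated_convergence[where w="\<lambda>x. exp \<bar>C\<bar> * (H x)\<^sup>2"])
    show "integrable M (\<lambda>x. exp \<bar>C\<bar> * (H x)\<^sup>2)" using H by (auto simp: L2_def)
    show "AE x in M. (\<lambda>n. ?X n x) \<longlonglongrightarrow> (z x)\<^sup>2 / 2"
      using lim by eventually_elim (rule cexp_second_order)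
    show "AE x in M. norm (?X n x) \<le> exp \<bar>C\<bar> * (H x)\<^sup>2" for n
      using H(2)[of n]
    proof eventually_elim
      fix x assume H: "norm (\<zeta> n x) \<le> H x"
      let ?z = "\<zeta> n x / complex_of_real (sqrt (real n))"
      have sum: "(\<Sum>k\<le>1. w ^ k / fact k) = 1 + w" for w :: complex by simp
      have "norm (?X n x) = real n * norm (exp ?z - (\<Sum>k\<le>1. ?z ^ k / fact k))"
        unfolding sum by (simp only: norm_mult norm_of_real diff_diff_eq abs_of_nat of_nat_0_le_iff)
      also have "\<dots> \<le> real n * (exp \<bar>Re ?z\<bar> * norm ?z ^ Suc 1 / fact 1)"
        by (intro mult_left_mono Taylor_exp) simp
      also have "\<dots> \<le> real n * (exp \<bar>C\<bar> * norm ?z ^ Suc 1 / fact 1)"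
        using C0[of n x] by (intro mult_left_mono divide_right_mono mult_right_mono) (auto simp del: Re_divide_of_real)
      also have "\<dots> \<le> exp \<bar>C\<bar> * (norm (\<zeta> n x))\<^sup>2"
        by (cases "n = 0") (auto simp: norm_divide power_divide field_simps power2_eq_square[symmetric])
      also have "\<dots> \<le> exp \<bar>C\<bar> * (H x)\<^sup>2" using H by (intro mult_left_mono power_mono) auto
      finally show "norm (?X n x) \<le> exp \<bar>C\<bar> * (H x)\<^sup>2" .
    qed
  qed measurable
  have "(\<lambda>n. (\<integral>x. ?X n x \<partial>M) + sqrt (real n) * (\<integral>x. \<zeta> n x \<partial>M)) \<longlonglongrightarrow> (\<integral>x. (z x)\<^sup>2 / 2 \<partial>M) + 0"
    by (intro tendsto_add X mean)
  moreover have "(\<integral>x. ?X n x \<partial>M) + sqrt (real n) * (\<integral>x. \<zeta> n x \<partial>M) =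
      real n * ((\<integral>x. exp (\<zeta> n x / sqrt (real n)) \<partial>M) - 1)" for n
  proof -
    have "(\<integral>x. ?X n x \<partial>M) = real n * ((\<integral>x. exp (\<zeta> n x / sqrt (real n)) \<partial>M) - 1 - (\<integral>x. \<zeta> n x \<partial>M) / sqrt (real n))"
      using expi[of n] \<zeta>i[of n] by (simp add: prob_space)
    moreover have "complex_of_real (real n) * (w / complex_of_real (sqrt (real n))) = sqrt (real n) * w" for w :: complex
    proof -
      have "complex_of_real (real n) = complex_of_real (sqrt (real n)) * complex_of_real (sqrt (real n))"
        by (simp flip: of_real_mult)
      then show ?thesis by (cases "n = 0") simp_all
    qed
    ultimately show ?thesis by (simp add: right_diff_distrib)
  qed
  ultimately show "(\<lambda>n. real n * ((\<integral>x. exp (\<zeta> n x / sqrt (real n)) \<partial>M) - 1)) \<longlonglongrightarrow> (\<integral>x. (z x)\<^sup>2 \<partial>M) / 2"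
    by simp
qed

text \<open>\<open>a ^ m = exp (m * Ln a)\<close> and \<open>Ln a = (a - 1) * q a\<close>, where q
  extends the difference quotient of \<open>Ln\<close> at 1 continuously by the value 1. As
  \<open>a n\<close> tends to 1, the branch cut does no harm.\<close>

lemma power_limit_exp:
  fixes a :: "nat \<Rightarrow> complex" and m :: "nat \<Rightarrow> nat"
  assumes a: "(\<lambda>n. real n * (a n - 1)) \<longlonglongrightarrow> L" and m: "(\<lambda>n. real (m n) / real n) \<longlonglongrightarrow> \<rho>"
  shows "(\<lambda>n. a n ^ m n) \<longlonglongrightarrow> exp (\<rho> * L)"
proof -
  have inv: "(\<lambda>n. complex_of_real (inverse (real n))) \<longlonglongrightarrow> complex_of_real 0"
    by (intro tendsto_of_real LIMSEQ_inverse_real_of_nat_add[of 0, simplified] tendsto_inverse_0_at_top filterlim_real_sequentially)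
  have "(\<lambda>n. complex_of_real (inverse (real n)) * (real n * (a n - 1))) \<longlonglongrightarrow> complex_of_real 0 * L"
    by (intro tendsto_mult inv a)
  then have a1: "(\<lambda>n. a n - 1) \<longlonglongrightarrow> 0"
    using Lim_transform_eventually[OF _ eventually_mono[OF eventually_gt_at_top[of 0]],
      of "\<lambda>n. complex_of_real (inverse (real n)) * (real n * (a n - 1))" 0 "\<lambda>n. a n - 1"]
    by simp
  then have a1': "a \<longlonglongrightarrow> 1" using tendsto_add[OF a1 tendsto_const[of 1]] by simp
  define q where "q z = (if z = 1 then 1 else Ln z / (z - 1))" for z :: complex
  have "(Ln has_field_derivative 1) (at 1)"
    using has_field_derivative_Ln[of 1] by simp
  then have "((\<lambda>z. (Ln z - Ln 1) / (z - 1)) \<longlongrightarrow> 1) (at 1)"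
    by (simp add: has_field_derivative_iff)
  then have "(q \<longlongrightarrow> 1) (at 1)"
    by (rule Lim_transform_eventually) (auto simp: q_def eventually_at_filter)
  moreover have "q 1 = 1" by (simp add: q_def)
  ultimately have "isCont q 1" by (simp add: isCont_def)
  then have q1: "(\<lambda>n. q (a n)) \<longlonglongrightarrow> 1"
    using isCont_tendsto_compose[OF _ a1', of q] \<open>q 1 = 1\<close> by simp
  have lim: "(\<lambda>n. exp ((real (m n) / real n) * ((real n * (a n - 1)) * q (a n)))) \<longlonglongrightarrow> exp (\<rho> * (L * 1))"
    by (intro tendsto_intros m a q1)
  have "\<forall>\<^sub>F n in sequentially. exp ((real (m n) / real n) * ((real n * (a n - 1)) * q (a n))) = a n ^ m n"
  proof -
    have "\<forall>\<^sub>F n in sequentially. a n \<noteq> 0"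
      using tendsto_imp_eventually_ne[OF a1', of 0] by simp
    then show ?thesis
      using eventually_gt_at_top[of 0]
    proof eventually_elim
      fix n :: nat assume "a n \<noteq> 0" "0 < n"
      then have "(real (m n) / real n) * ((real n * (a n - 1)) * q (a n)) = of_nat (m n) * Ln (a n)"
        by (auto simp: q_def)
      then show "exp ((real (m n) / real n) * ((real n * (a n - 1)) * q (a n))) = a n ^ m n"
        using \<open>a n \<noteq> 0\<close> by (simp only: exp_of_nat_mult exp_Ln not_False_eq_True)
    qed
  qed
  from Lim_transform_eventually[OF lim this] show ?thesis by simp
qed

text \<open>Arrays approximating a square integrable function; \<open>\<sqrt>n\<close> times the means vanishes, so that
  \<open>n\<^sup>-\<^sup>\<onehalf>\<close> times the sum over a sample is asymptotically centred.\<close>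

definition L2_array :: "'a measure \<Rightarrow> (nat \<Rightarrow> 'a \<Rightarrow> real) \<Rightarrow> ('a \<Rightarrow> real) \<Rightarrow> bool" where
  "L2_array P hn h \<longleftrightarrow> (\<forall>n. hn n \<in> borel_measurable P) \<and> h \<in> borel_measurable P \<and>
    (\<exists>H\<in>L2 P. \<forall>n. AE x in P. \<bar>hn n x\<bar> \<le> H x) \<and> (AE x in P. (\<lambda>n. hn n x) \<longlonglongrightarrow> h x) \<and>
    (\<lambda>n. sqrt (real n) * (\<integral>x. hn n x \<partial>P)) \<longlonglongrightarrow> 0"

text \<open>Bounds \<open>exp (hn n x / sqrt n)\<close> uniformly in n and x, so that tilts exist
  although the limit has only two moments. At \<open>n = 0\<close> it forces \<open>hn 0\<close> to
  vanish.\<close>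

definition root_n_bounded :: "(nat \<Rightarrow> 'a \<Rightarrow> real) \<Rightarrow> bool" where
  "root_n_bounded hn \<longleftrightarrow> (\<exists>C. \<forall>n x. \<bar>hn n x\<bar> \<le> C * sqrt (real n))"

lemma L2_array_L2:
  assumes "L2_array P hn h"
  shows "h \<in> L2 P" "hn n \<in> L2 P"
proof -
  from assms obtain H where H: "H \<in> L2 P" "\<And>n. AE x in P. \<bar>hn n x\<bar> \<le> H x"
    and m: "\<And>n. hn n \<in> borel_measurable P" "h \<in> borel_measurable P" and lim: "AE x in P. (\<lambda>n. hn n x) \<longlonglongrightarrow> h x"
    unfolding L2_array_def by blast
  have "AE x in P. \<forall>n. \<bar>hn n x\<bar> \<le> H x" using H(2) by (simp add: AE_all_countable)
  with lim have "AE x in P. \<bar>h x\<bar> \<le> \<bar>H x\<bar>"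
  proof eventually_elim
    fix x assume "(\<lambda>n. hn n x) \<longlonglongrightarrow> h x" "\<forall>n. \<bar>hn n x\<bar> \<le> H x"
    then have "\<bar>h x\<bar> \<le> H x" by (intro LIMSEQ_le_const2[OF tendsto_rabs]) auto
    then show "\<bar>h x\<bar> \<le> \<bar>H x\<bar>" by simp
  qed
  then show "h \<in> L2 P" by (rule L2_bound[OF H(1) m(2)])
  have "AE x in P. \<bar>hn n x\<bar> \<le> \<bar>H x\<bar>" using H(2)[of n] by (auto elim: eventually_mono)
  then show "hn n \<in> L2 P" by (rule L2_bound[OF H(1) m(1)])
qed

lemma L2_array_add:
  assumes P: "finite_measure P" and h: "L2_array P hn h" and k: "L2_array P kn k"
  shows "L2_array P (\<lambda>n x. hn n x + b * kn n x) (\<lambda>x. h x + b * k x)"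
proof -
  interpret finite_measure P by fact
  from h obtain H where H: "H \<in> L2 P" "\<And>n. AE x in P. \<bar>hn n x\<bar> \<le> H x" unfolding L2_array_def by blast
  from k obtain K where K: "K \<in> L2 P" "\<And>n. AE x in P. \<bar>kn n x\<bar> \<le> K x" unfolding L2_array_def by blast
  have [measurable]: "hn n \<in> borel_measurable P" "h \<in> borel_measurable P" "kn n \<in> borel_measurable P" "k \<in> borel_measurable P" for n
    using h k unfolding L2_array_def by auto
  have "(\<lambda>n. sqrt (real n) * (\<integral>x. hn n x \<partial>P) + b * (sqrt (real n) * (\<integral>x. kn n x \<partial>P))) \<longlonglongrightarrow> 0 + b * 0"
    using h k unfolding L2_array_def by (intro tendsto_intros) auto
  moreover have "sqrt (real n) * (\<integral>x. hn n x \<partial>P) + b * (sqrt (real n) * (\<integral>x. kn n x \<partial>P)) =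
      sqrt (real n) * (\<integral>x. hn n x + b * kn n x \<partial>P)" for n
    using L2_integrable[OF L2_array_L2(2)[OF h, of n]] L2_integrable[OF L2_array_L2(2)[OF k, of n]]
    by (simp add: algebra_simps)
  ultimately have "(\<lambda>n. sqrt (real n) * (\<integral>x. hn n x + b * kn n x \<partial>P)) \<longlonglongrightarrow> 0" by simp
  moreover have "AE x in P. \<bar>hn n x + b * kn n x\<bar> \<le> H x + \<bar>b\<bar> * K x" for n
    using H(2)[of n] K(2)[of n]
  proof eventually_elim
    fix x assume "\<bar>hn n x\<bar> \<le> H x" "\<bar>kn n x\<bar> \<le> K x"
    then have "\<bar>b * kn n x\<bar> \<le> \<bar>b\<bar> * K x" by (simp add: abs_mult mult_left_mono)
    then show "\<bar>hn n x + b * kn n x\<bar> \<le> H x + \<bar>b\<bar> * K x" using \<open>\<bar>hn n x\<bar> \<le> H x\<close> by linarith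
  qed
  moreover have "(\<lambda>x. H x + \<bar>b\<bar> * K x) \<in> L2 P" by (intro L2_add L2_scale H K)
  moreover have "AE x in P. (\<lambda>n. hn n x + b * kn n x) \<longlonglongrightarrow> h x + b * k x"
    using h k unfolding L2_array_def by (auto intro!: tendsto_intros elim: eventually_elim2)
  ultimately show ?thesis unfolding L2_array_def
    by (intro conjI allI bexI[of _ "\<lambda>x. H x + \<bar>b\<bar> * K x"]) simp_all
qed

lemma root_n_bounded_add:
  assumes "root_n_bounded hn" "root_n_bounded kn"
  shows "root_n_bounded (\<lambda>n x. hn n x + b * kn n x)"
proof -
  obtain C D where "\<And>n x. \<bar>hn n x\<bar> \<le> C * sqrt (real n)" "\<And>n x. \<bar>kn n x\<bar> \<le> D * sqrt (real n)"
    using assms unfolding root_n_bounded_def by blast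
  then have "\<bar>hn n x + b * kn n x\<bar> \<le> C * sqrt (real n) + \<bar>b\<bar> * (D * sqrt (real n))" for n x
    by (intro order_trans[OF abs_triangle_ineq add_mono]) (auto simp: abs_mult mult_left_mono)
  then show ?thesis unfolding root_n_bounded_def by (intro exI[of _ "C + \<bar>b\<bar> * D"]) (simp add: algebra_simps)
qed

definition truncation :: "('a \<Rightarrow> real) \<Rightarrow> nat \<Rightarrow> 'a \<Rightarrow> real" where
  "truncation h n x = (if \<bar>h x\<bar> \<le> sqrt (real n) then h x else 0)"

lemma root_n_bounded_truncation: "root_n_bounded (truncation h)"
  unfolding root_n_bounded_def truncation_def by (intro exI[of _ 1]) simp

text \<open>No recentring takes place. As h has mean 0, the truncated mean is minus the integral of
  h over the tail, where \<open>sqrt n * \<bar>h x\<bar> \<le> (h x)\<^sup>2\<close>. Hence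
  \<open>sqrt n\<close> times the mean is bounded by a tail of the integral of the square, which
  vanishes.\<close>

lemma L2_array_truncation:
  assumes P: "finite_measure P" and h: "h \<in> L2_0 P"
  shows "L2_array P (truncation h) h"
proof -
  interpret finite_measure P by fact
  have hL: "h \<in> L2 P" "(\<integral>x. h x \<partial>P) = 0" using h by (auto simp: L2_0_def)
  have [measurable]: "h \<in> borel_measurable P" using hL by (simp add: L2_def)
  have tm[measurable]: "truncation h n \<in> borel_measurable P" for n unfolding truncation_def by measurable
  have ev: "\<forall>\<^sub>F n in sequentially. \<bar>h x\<bar> \<le> sqrt (real n)" for x
    using filterlim_compose[OF sqrt_at_top filterlim_real_sequentially] by (auto simp: filterlim_at_top)
  have conv: "(\<lambda>n. truncation h n x) \<longlonglongrightarrow> h x" for x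
    by (rule tendsto_eventually, rule eventually_mono[OF ev[of x]]) (simp add: truncation_def)
  have le: "\<bar>truncation h n x\<bar> \<le> \<bar>h x\<bar>" for n x by (simp add: truncation_def)
  have "(\<lambda>n. sqrt (real n) * (\<integral>x. truncation h n x \<partial>P)) \<longlonglongrightarrow> 0"
  proof (rule Lim_null_comparison)
    let ?w = "\<lambda>n x. (h x)\<^sup>2 * (if \<bar>h x\<bar> \<le> sqrt (real n) then 0 else 1)"
    have wi: "integrable P (?w n)" for n
      by (rule Bochner_Integration.integrable_bound[OF L2_square_integrable[OF hL(1)]]) auto
    have "norm (sqrt (real n) * (\<integral>x. truncation h n x \<partial>P)) \<le> (\<integral>x. ?w n x \<partial>P)" for n
    proof -
      have ti: "integrable P (truncation h n)"
        by (rule Bochner_Integration.integrable_bound[OF L2_integrable[OF hL(1)]]) (use le in auto)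
      have "sqrt (real n) * (\<integral>x. truncation h n x \<partial>P) = (\<integral>x. sqrt (real n) * (truncation h n x - h x) \<partial>P)"
        using ti L2_integrable[OF hL(1)] hL(2) by simp
      also have "norm \<dots> \<le> (\<integral>x. norm (sqrt (real n) * (truncation h n x - h x)) \<partial>P)"
        by (rule integral_norm_bound)
      also have "\<dots> \<le> (\<integral>x. ?w n x \<partial>P)"
      proof (rule integral_mono)
        show "norm (sqrt (real n) * (truncation h n x - h x)) \<le> ?w n x" for x
        proof (cases "\<bar>h x\<bar> \<le> sqrt (real n)")
          case False
          then have "sqrt (real n) * \<bar>h x\<bar> \<le> \<bar>h x\<bar> * \<bar>h x\<bar>" by (intro mult_right_mono) auto
          also have "\<dots> = (h x)\<^sup>2" by (simp add: power2_eq_square)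
          finally show ?thesis using False by (simp add: truncation_def abs_mult)
        qed (simp add: truncation_def)
      qed (use wi ti L2_integrable[OF hL(1)] in auto)
      finally show ?thesis .
    qed
    then show "\<forall>\<^sub>F n in sequentially. norm (sqrt (real n) * (\<integral>x. truncation h n x \<partial>P)) \<le> (\<integral>x. ?w n x \<partial>P)" by simp
    have "(\<lambda>n. \<integral>x. ?w n x \<partial>P) \<longlonglongrightarrow> (\<integral>x. 0 \<partial>P)"
    proof (rule integral_dominated_convergence[where w="\<lambda>x. (h x)\<^sup>2"])
      show "AE x in P. (\<lambda>n. ?w n x) \<longlonglongrightarrow> 0"
      proof (rule AE_I2)
        show "(\<lambda>n. ?w n x) \<longlonglongrightarrow> 0" for x
          by (rule tendsto_eventually, rule eventually_mono[OF ev[of x]]) simp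
      qed
    qed (use L2_square_integrable[OF hL(1)] in auto)
    then show "(\<lambda>n. \<integral>x. ?w n x \<partial>P) \<longlonglongrightarrow> 0" by simp
  qed
  then show ?thesis unfolding L2_array_def
    using conv le L2_abs[OF hL(1)] by (auto intro!: bexI[of _ "\<lambda>x. \<bar>h x\<bar>"])
qed

text \<open>Made for the coefficients \<open>n / n1 n\<close> and \<open>n / n2 n\<close> of the
  test statistic. Such an array need not be \<open>root_n_bounded\<close>; it enters as a statistic,
  while tilts are built from truncations.\<close>

lemma L2_array_scale:
  assumes P: "finite_measure P" and h: "h \<in> L2_0 P" and a: "a \<longlonglongrightarrow> a0"
  shows "L2_array P (\<lambda>n x. a n * h x) (\<lambda>x. a0 * h x)"
proof -
  interpret finite_measure P by fact
  have hL: "h \<in> L2 P" "(\<integral>x. h x \<partial>P) = 0" using h by (auto simp: L2_0_def)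
  have [measurable]: "h \<in> borel_measurable P" using hL by (simp add: L2_def)
  obtain B where B: "\<And>n. \<bar>a n\<bar> \<le> B"
    using convergent_imp_Bseq[OF convergentI[OF a]] by (auto simp: Bseq_def)
  show ?thesis
    unfolding L2_array_def
  proof (intro conjI allI bexI)
    show "AE x in P. \<bar>a n * h x\<bar> \<le> B * \<bar>h x\<bar>" for n
      using B[of n] by (intro AE_I2) (simp add: abs_mult mult_right_mono)
    show "(\<lambda>x. B * \<bar>h x\<bar>) \<in> L2 P" by (intro L2_scale L2_abs hL)
    show "AE x in P. (\<lambda>n. a n * h x) \<longlonglongrightarrow> a0 * h x" by (intro AE_I2 tendsto_intros a)
    show "(\<lambda>n. sqrt (real n) * (\<integral>x. a n * h x \<partial>P)) \<longlonglongrightarrow> 0" using hL by simp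
  qed auto
qed

text \<open>The real part of the exponent is the tilt, the imaginary part the argument of the
  characteristic function. Squaring \<open>h + i * w * k\<close> produces the Gaussian term in
  \<open>w\<^sup>2\<close> and a cross term linear in w, which becomes the shift of the mean caused
  by the tilt.\<close>

lemma (in prob_space) tilted_characteristic_function:
  assumes h: "L2_array M hn h" "root_n_bounded hn" and k: "L2_array M kn k"
  shows "integrable M (\<lambda>x. exp (Complex (hn n x) (w * kn n x) / sqrt (real n)))"
    and "(\<lambda>n. real n * ((\<integral>x. exp (Complex (hn n x) (w * kn n x) / sqrt (real n)) \<partial>M) - 1)) \<longlonglongrightarrow>
      Complex ((\<integral>x. (h x)\<^sup>2 \<partial>M) / 2 - w\<^sup>2 * (\<integral>x. (k x)\<^sup>2 \<partial>M) / 2) (w * (\<integral>x. h x * k x \<partial>M))"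
proof -
  from h obtain H where H: "H \<in> L2 M" "\<And>n. AE x in M. \<bar>hn n x\<bar> \<le> H x" unfolding L2_array_def by blast
  from k obtain K where K: "K \<in> L2 M" "\<And>n. AE x in M. \<bar>kn n x\<bar> \<le> K x" unfolding L2_array_def by blast
  have m[measurable]: "hn n \<in> borel_measurable M" "h \<in> borel_measurable M" "kn n \<in> borel_measurable M" "k \<in> borel_measurable M" for n
    using h k unfolding L2_array_def by auto
  obtain C where C: "\<And>n x. \<bar>hn n x\<bar> \<le> C * sqrt (real n)" using h(2) unfolding root_n_bounded_def by blast
  have [measurable]: "(\<lambda>x. Complex (f x) (g x)) \<in> borel_measurable M"
    if [measurable]: "f \<in> borel_measurable M" "g \<in> borel_measurable M" for f g
    unfolding Complex_eq by measurable
  let ?\<zeta> = "\<lambda>n x. Complex (hn n x) (w * kn n x)" and ?z = "\<lambda>x. Complex (h x) (w * k x)"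
  have hi: "integrable M (hn n)" "integrable M (kn n)" for n
    using L2_integrable[OF L2_array_L2(2)[OF h(1), of n]] L2_integrable[OF L2_array_L2(2)[OF k, of n]] .
  have HK: "(\<lambda>x. H x + \<bar>w\<bar> * K x) \<in> L2 M" by (intro L2_add L2_scale H K)
  have dom: "AE x in M. norm (?\<zeta> n x) \<le> H x + \<bar>w\<bar> * K x" for n
    using H(2)[of n] K(2)[of n]
  proof eventually_elim
    fix x assume "\<bar>hn n x\<bar> \<le> H x" "\<bar>kn n x\<bar> \<le> K x"
    then have "\<bar>hn n x\<bar> + \<bar>w * kn n x\<bar> \<le> H x + \<bar>w\<bar> * K x" by (auto simp: abs_mult intro!: add_mono mult_left_mono)
    then show "norm (?\<zeta> n x) \<le> H x + \<bar>w\<bar> * K x" using cmod_le[of "?\<zeta> n x"] by simp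
  qed
  have lim: "AE x in M. (\<lambda>n. ?\<zeta> n x) \<longlonglongrightarrow> ?z x"
    using h(1) k unfolding L2_array_def by (auto intro!: tendsto_Complex tendsto_intros elim: eventually_elim2)
  have mean: "(\<lambda>n. sqrt (real n) * (\<integral>x. ?\<zeta> n x \<partial>M)) \<longlonglongrightarrow> 0"
  proof -
    have "(\<lambda>n. Complex (sqrt (real n) * (\<integral>x. hn n x \<partial>M)) (w * (sqrt (real n) * (\<integral>x. kn n x \<partial>M)))) \<longlonglongrightarrow> Complex 0 (w * 0)"
      using h(1) k unfolding L2_array_def by (intro tendsto_Complex tendsto_intros) auto
    moreover have "(\<integral>x. ?\<zeta> n x \<partial>M) = Complex (\<integral>x. hn n x \<partial>M) (w * (\<integral>x. kn n x \<partial>M))" for n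
      unfolding Complex_eq using hi[of n] by simp
    ultimately show ?thesis by (simp add: Complex_eq algebra_simps)
  qed
  note exp = exponential_moment_expansion[of ?\<zeta> ?z, OF _ _ HK dom lim _ mean, of C]
  show "integrable M (\<lambda>x. exp (?\<zeta> n x / sqrt (real n)))" by (rule exp(1)) (auto simp: C)
  have "(\<lambda>n. real n * ((\<integral>x. exp (?\<zeta> n x / sqrt (real n)) \<partial>M) - 1)) \<longlonglongrightarrow> (\<integral>x. (?z x)\<^sup>2 \<partial>M) / 2"
    by (rule exp(2)) (auto simp: C)
  moreover have "(\<integral>x. (?z x)\<^sup>2 \<partial>M) / 2 =
      Complex ((\<integral>x. (h x)\<^sup>2 \<partial>M) / 2 - w\<^sup>2 * (\<integral>x. (k x)\<^sup>2 \<partial>M) / 2) (w * (\<integral>x. h x * k x \<partial>M))"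
  proof -
    have hk: "h \<in> L2 M" "k \<in> L2 M" using L2_array_L2 h k by auto
    have "(\<integral>x. (?z x)\<^sup>2 \<partial>M) = (\<integral>x. of_real ((h x)\<^sup>2) - w\<^sup>2 * of_real ((k x)\<^sup>2) + 2 * \<i> * w * of_real (h x * k x) \<partial>M)"
      by (intro Bochner_Integration.integral_cong) (auto simp: Complex_eq power2_eq_square algebra_simps)
    also have "\<dots> = of_real (\<integral>x. (h x)\<^sup>2 \<partial>M) - w\<^sup>2 * of_real (\<integral>x. (k x)\<^sup>2 \<partial>M) + 2 * \<i> * w * of_real (\<integral>x. h x * k x \<partial>M)"
      using hk[THEN L2_square_integrable] L2_mult_integrable[OF hk]
      by (simp del: of_real_power of_real_mult)
    finally show ?thesis by (simp add: Complex_eq field_simps)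
  qed
  ultimately show "(\<lambda>n. real n * ((\<integral>x. exp (?\<zeta> n x / sqrt (real n)) \<partial>M) - 1)) \<longlonglongrightarrow>
      Complex ((\<integral>x. (h x)\<^sup>2 \<partial>M) / 2 - w\<^sup>2 * (\<integral>x. (k x)\<^sup>2 \<partial>M) / 2) (w * (\<integral>x. h x * k x \<partial>M))" by simp
qed

section \<open>Normalised tilts and the Hellinger expansions of tilts and curves\<close>

definition tilt_norm :: "'a measure \<Rightarrow> (nat \<Rightarrow> 'a \<Rightarrow> real) \<Rightarrow> nat \<Rightarrow> real" where
  "tilt_norm P hn n = (\<integral>x. exp (hn n x / sqrt (real n)) \<partial>P)"

definition tilt :: "'a measure \<Rightarrow> (nat \<Rightarrow> 'a \<Rightarrow> real) \<Rightarrow> nat \<Rightarrow> 'a \<Rightarrow> real" where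
  "tilt P hn n x = exp (hn n x / sqrt (real n)) / tilt_norm P hn n"

text \<open>Existence and limit of the normaliser are the case \<open>w = 0\<close> of the
  characteristic function under a tilt, read off from the real part.\<close>

lemma (in prob_space)
  assumes h: "L2_array M hn h" "root_n_bounded hn"
  shows tilt_norm_pos: "0 < tilt_norm M hn n"
    and tilt_pos: "0 < tilt M hn n x"
    and integrable_tilt: "integrable M (tilt M hn n)"
    and integral_tilt: "(\<integral>x. tilt M hn n x \<partial>M) = 1"
    and tilt_norm_limit: "(\<lambda>n. real n * (tilt_norm M hn n - 1)) \<longlonglongrightarrow> (\<integral>x. (h x)\<^sup>2 \<partial>M) / 2"
proof -
  have [simp]: "exp (Complex a 0 / complex_of_real b) = of_real (exp (a / b))" for a b
    by (simp add: Complex_eq exp_of_real flip: of_real_divide)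
  have int: "integrable M (\<lambda>x. exp (hn n x / sqrt (real n)))" for n
    using integrable_Re[OF tilted_characteristic_function(1)[OF h h(1), of n 0]] by simp
  have pos: "0 < tilt_norm M hn n" for n
    unfolding tilt_norm_def using integral_less_AE_space[OF integrable_zero int[of n]]
    by (simp add: emeasure_space_1)
  then show "0 < tilt_norm M hn n" .
  then show "0 < tilt M hn n x" by (simp add: tilt_def)
  show "integrable M (tilt M hn n)" unfolding tilt_def[abs_def] using int by simp
  show "(\<integral>x. tilt M hn n x \<partial>M) = 1"
    unfolding tilt_def[abs_def] using pos[of n] by (simp add: tilt_norm_def)
  have "(\<lambda>n. Re (real n * ((\<integral>x. exp (Complex (hn n x) (0 * hn n x) / sqrt (real n)) \<partial>M) - 1))) \<longlonglongrightarrow>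
      Re (Complex ((\<integral>x. (h x)\<^sup>2 \<partial>M) / 2 - 0\<^sup>2 * (\<integral>x. (h x)\<^sup>2 \<partial>M) / 2) (0 * (\<integral>x. h x * h x \<partial>M)))"
    by (rule tendsto_Re[OF tilted_characteristic_function(2)[OF h h(1)]])
  then show "(\<lambda>n. real n * (tilt_norm M hn n - 1)) \<longlonglongrightarrow> (\<integral>x. (h x)\<^sup>2 \<partial>M) / 2"
    by (simp add: tilt_norm_def)
qed

lemma sqrt_real_at_top: "filterlim (\<lambda>n. sqrt (real n)) at_top sequentially"
  by (rule filterlim_compose[OF sqrt_at_top filterlim_real_sequentially])

lemma exp_first_order:
  fixes y :: "nat \<Rightarrow> real"
  assumes y: "y \<longlonglongrightarrow> y0"
  shows "(\<lambda>n. sqrt (real n) * (exp (y n / sqrt (real n)) - 1)) \<longlonglongrightarrow> y0"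
proof -
  have y0: "(\<lambda>n. \<bar>y n\<bar> / sqrt (real n)) \<longlonglongrightarrow> 0"
    by (rule real_tendsto_divide_at_top[OF tendsto_rabs[OF y] sqrt_real_at_top])
  let ?R = "\<lambda>n. sqrt (real n) * (exp (y n / sqrt (real n)) - 1) - y n"
  have "?R \<longlonglongrightarrow> 0"
  proof (rule Lim_null_comparison)
    show "\<forall>\<^sub>F n in sequentially. norm (?R n) \<le> exp (\<bar>y n\<bar> / sqrt (real n)) * \<bar>y n\<bar> * (\<bar>y n\<bar> / sqrt (real n))"
    proof (rule eventually_mono[OF eventually_gt_at_top[of 0]])
      fix n :: nat assume n: "0 < n"
      define x where "x = y n / sqrt (real n)"
      have yx: "y n = sqrt (real n) * x" using n by (simp add: x_def)
      have sum: "(\<Sum>k\<le>1. w ^ k / fact k) = 1 + w" for w :: real by simp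
      have "?R n = sqrt (real n) * (exp x - (1 + x))" unfolding yx using n by (simp add: algebra_simps)
      then have "norm (?R n) = sqrt (real n) * norm (exp x - (\<Sum>k\<le>1. x ^ k / fact k))"
        unfolding sum by (simp only: norm_mult) simp
      also have "\<dots> \<le> sqrt (real n) * (exp (norm x) * norm x ^ Suc 1 / fact 1)"
        by (intro mult_left_mono Taylor_exp_field) simp
      also have "\<dots> = exp (\<bar>y n\<bar> / sqrt (real n)) * \<bar>y n\<bar> * (\<bar>y n\<bar> / sqrt (real n))"
        unfolding yx using n by (simp add: abs_mult)
      finally show "norm (?R n) \<le> exp (\<bar>y n\<bar> / sqrt (real n)) * \<bar>y n\<bar> * (\<bar>y n\<bar> / sqrt (real n))" .
    qed
    have "(\<lambda>n. exp (\<bar>y n\<bar> / sqrt (real n)) * \<bar>y n\<bar> * (\<bar>y n\<bar> / sqrt (real n))) \<longlonglongrightarrow> exp 0 * \<bar>y0\<bar> * 0"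
      by (intro tendsto_intros y0 y)
    then show "(\<lambda>n. exp (\<bar>y n\<bar> / sqrt (real n)) * \<bar>y n\<bar> * (\<bar>y n\<bar> / sqrt (real n))) \<longlonglongrightarrow> 0" by simp
  qed
  from tendsto_add[OF this y] show ?thesis by simp
qed

lemma abs_exp_minus_one_le: "\<bar>exp x - 1\<bar> \<le> exp \<bar>x\<bar> * \<bar>x\<bar>" for x :: real
  using Taylor_exp_field[of x 0] by simp

text \<open>The root of the tilt is \<open>exp (y / sqrt n)\<close> with
  \<open>y = hn / 2 - c\<close>, where c carries the normaliser. The normaliser differs from 1 by
  order \<open>1 / n\<close>, so c vanishes and y tends to \<open>h / 2\<close>; dominated
  convergence makes this an L2 statement. Thus the tilt has, up to \<open>o(1 / n)\<close> in
  squared norm, the root expansion of a curve with tangent h at the parameter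
  \<open>1 / sqrt n\<close>.\<close>

lemma (in prob_space) tilt_root_expansion:
  assumes h: "L2_array M hn h" "root_n_bounded hn"
  shows "(\<lambda>n. real n * (\<integral>x. (2 * (sqrt (tilt M hn n x) - 1) - h x / sqrt (real n))\<^sup>2 \<partial>M)) \<longlonglongrightarrow> 0"
proof -
  from h obtain H where H: "H \<in> L2 M" "\<And>n. AE x in M. \<bar>hn n x\<bar> \<le> H x" unfolding L2_array_def by blast
  obtain C where C: "\<And>n x. \<bar>hn n x\<bar> \<le> C * sqrt (real n)" using h(2) unfolding root_n_bounded_def by blast
  have [measurable]: "hn n \<in> borel_measurable M" "h \<in> borel_measurable M" for n
    using h(1) unfolding L2_array_def by auto
  have lim: "AE x in M. (\<lambda>n. hn n x) \<longlonglongrightarrow> h x" using h(1) unfolding L2_array_def by auto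
  note pos = tilt_norm_pos[OF h]
  define c where "c n = sqrt (real n) * ln (tilt_norm M hn n) / 2" for n
  have M1: "(\<lambda>n. sqrt (real n) * (tilt_norm M hn n - 1)) \<longlonglongrightarrow> 0"
  proof (rule Lim_transform_eventually)
    show "(\<lambda>n. (real n * (tilt_norm M hn n - 1)) / sqrt (real n)) \<longlonglongrightarrow> 0"
      by (rule real_tendsto_divide_at_top[OF tilt_norm_limit[OF h] sqrt_real_at_top])
    show "\<forall>\<^sub>F n in sequentially. (real n * (tilt_norm M hn n - 1)) / sqrt (real n) = sqrt (real n) * (tilt_norm M hn n - 1)"
      by (rule eventually_mono[OF eventually_gt_at_top[of 0]]) (metis (no_types, opaque_lifting) mult.commute times_divide_eq_right real_div_sqrt of_nat_0_le_iff)
  qed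
  have M0: "(\<lambda>n. tilt_norm M hn n) \<longlonglongrightarrow> 1"
  proof -
    have "(\<lambda>n. (sqrt (real n) * (tilt_norm M hn n - 1)) / sqrt (real n)) \<longlonglongrightarrow> 0"
      by (rule real_tendsto_divide_at_top[OF M1 sqrt_real_at_top])
    then have "(\<lambda>n. tilt_norm M hn n - 1) \<longlonglongrightarrow> 0"
      by (rule Lim_transform_eventually) (rule eventually_mono[OF eventually_gt_at_top[of 0]], simp)
    from tendsto_add[OF this tendsto_const[of 1]] show ?thesis by simp
  qed
  \<comment> \<open>Squeezed by \<open>1 - 1 / x \<le> ln x \<le> x - 1\<close> at the normaliser,
    whose distance from 1 is negligible even after multiplication by \<open>sqrt n\<close>.\<close>
  have c0: "c \<longlonglongrightarrow> 0"
  proof (rule tendsto_sandwich)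
    show "\<forall>\<^sub>F n in sequentially. sqrt (real n) * (tilt_norm M hn n - 1) / tilt_norm M hn n / 2 \<le> c n"
    proof (intro always_eventually allI)
      fix n
      have "1 - 1 / tilt_norm M hn n \<le> ln (tilt_norm M hn n)"
        using ln_le_minus_one[of "1 / tilt_norm M hn n"] pos[of n] by (simp add: ln_div)
      then have "sqrt (real n) * (1 - 1 / tilt_norm M hn n) / 2 \<le> c n"
        unfolding c_def by (intro divide_right_mono mult_left_mono) auto
      then show "sqrt (real n) * (tilt_norm M hn n - 1) / tilt_norm M hn n / 2 \<le> c n"
        using pos[of n] by (simp add: field_simps)
    qed
    show "\<forall>\<^sub>F n in sequentially. c n \<le> sqrt (real n) * (tilt_norm M hn n - 1) / 2"
      unfolding c_def using ln_le_minus_one[OF pos]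
      by (intro always_eventually allI divide_right_mono mult_left_mono) auto
    have "(\<lambda>n. sqrt (real n) * (tilt_norm M hn n - 1) / tilt_norm M hn n / 2) \<longlonglongrightarrow> 0 / 1 / 2"
      by (intro tendsto_intros M1 M0) auto
    then show "(\<lambda>n. sqrt (real n) * (tilt_norm M hn n - 1) / tilt_norm M hn n / 2) \<longlonglongrightarrow> 0" by simp
    have "(\<lambda>n. sqrt (real n) * (tilt_norm M hn n - 1) / 2) \<longlonglongrightarrow> 0 / 2"
      by (intro tendsto_intros M1) auto
    then show "(\<lambda>n. sqrt (real n) * (tilt_norm M hn n - 1) / 2) \<longlonglongrightarrow> 0" by simp
  qed
  obtain B where B: "\<And>n. \<bar>c n\<bar> \<le> B"
    using convergent_imp_Bseq[OF convergentI[OF c0]] by (auto simp: Bseq_def)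
  define y where "y n x = hn n x / 2 - c n" for n x
  have root: "sqrt (tilt M hn n x) = exp (y n x / sqrt (real n))" if n: "0 < n" for n x
  proof -
    have "tilt M hn n x = exp (hn n x / sqrt (real n) - ln (tilt_norm M hn n))"
      using pos[of n] by (simp add: tilt_def exp_diff)
    also have "hn n x / sqrt (real n) - ln (tilt_norm M hn n) = 2 * (y n x / sqrt (real n))"
      using n by (simp add: y_def c_def diff_divide_distrib)
    also have "exp \<dots> = (exp (y n x / sqrt (real n)))\<^sup>2" by (rule exp_double)
    finally show ?thesis by simp
  qed
  let ?K = "exp (\<bar>C\<bar> / 2 + B)"
  let ?a = "\<lambda>n x. 2 * (sqrt (real n) * (exp (y n x / sqrt (real n)) - 1))"
  \<comment> \<open>Boundedness of c and the root-n bound on \<open>hn\<close> make the exponential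
    factor \<open>?K\<close> independent of n and x, so that the envelope H yields a dominating
    function.\<close>
  have a_le: "\<bar>?a n x\<bar> \<le> 2 * (?K * \<bar>y n x\<bar>)" for n x
  proof (cases "n = 0")
    case False
    then have n: "1 \<le> sqrt (real n)" by simp
    have "\<bar>y n x / sqrt (real n)\<bar> \<le> \<bar>C\<bar> / 2 + B"
    proof -
      have "\<bar>y n x\<bar> \<le> C * sqrt (real n) / 2 + B" using C[of n x] B[of n] unfolding y_def by linarith
      also have "\<dots> \<le> \<bar>C\<bar> * sqrt (real n) / 2 + B * sqrt (real n)"
      proof (intro add_mono divide_right_mono mult_right_mono)
        have "0 \<le> B" using B[of 0] by linarith
        then show "B \<le> B * sqrt (real n)" using n by (simp add: mult_le_cancel_left1)
      qed auto
      also have "\<dots> = (\<bar>C\<bar> / 2 + B) * sqrt (real n)" by (simp add: algebra_simps)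
      finally show ?thesis using n by (simp add: abs_divide divide_le_eq)
    qed
    then have "\<bar>exp (y n x / sqrt (real n)) - 1\<bar> \<le> ?K * \<bar>y n x / sqrt (real n)\<bar>"
      by (intro order_trans[OF abs_exp_minus_one_le] mult_right_mono) auto
    then have "sqrt (real n) * \<bar>exp (y n x / sqrt (real n)) - 1\<bar> \<le> sqrt (real n) * (?K * \<bar>y n x / sqrt (real n)\<bar>)"
      by (intro mult_left_mono) auto
    also have "\<dots> = ?K * \<bar>y n x\<bar>" using n by (simp add: abs_divide)
    finally show ?thesis by (simp add: abs_mult)
  qed simp
  have "(\<lambda>n. \<integral>x. (?a n x - h x)\<^sup>2 \<partial>M) \<longlonglongrightarrow> (\<integral>x. 0 \<partial>M)"
  proof (rule integral_dominated_convergence[where w="\<lambda>x. (2 * ?K * (H x + B) + \<bar>h x\<bar>)\<^sup>2"])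
    have "(\<lambda>x. 2 * ?K * (H x + B) + \<bar>h x\<bar>) \<in> L2 M"
      by (intro L2_add L2_scale L2_abs H L2_const L2_array_L2[OF h(1)])
    then show "integrable M (\<lambda>x. (2 * ?K * (H x + B) + \<bar>h x\<bar>)\<^sup>2)" by (rule L2_square_integrable)
    show "AE x in M. (\<lambda>n. (?a n x - h x)\<^sup>2) \<longlonglongrightarrow> 0"
      using lim
    proof eventually_elim
      fix x assume "(\<lambda>n. hn n x) \<longlonglongrightarrow> h x"
      then have "(\<lambda>n. y n x) \<longlonglongrightarrow> h x / 2 - 0" unfolding y_def by (intro tendsto_intros c0) auto
      from exp_first_order[OF this] have "(\<lambda>n. (?a n x - h x)\<^sup>2) \<longlonglongrightarrow> (2 * (h x / 2 - 0) - h x)\<^sup>2"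
        by (intro tendsto_intros)
      then show "(\<lambda>n. (?a n x - h x)\<^sup>2) \<longlonglongrightarrow> 0" by simp
    qed
    show "AE x in M. norm ((?a n x - h x)\<^sup>2) \<le> (2 * ?K * (H x + B) + \<bar>h x\<bar>)\<^sup>2" for n
      using H(2)[of n]
    proof eventually_elim
      fix x assume "\<bar>hn n x\<bar> \<le> H x"
      then have "\<bar>y n x\<bar> \<le> H x + B" using B[of n] unfolding y_def by linarith
      then have "2 * (?K * \<bar>y n x\<bar>) \<le> 2 * ?K * (H x + B)" by (simp add: mult_left_mono)
      then have "\<bar>?a n x - h x\<bar> \<le> 2 * ?K * (H x + B) + \<bar>h x\<bar>" using a_le[of n x] by linarith
      then have "\<bar>?a n x - h x\<bar>\<^sup>2 \<le> (2 * ?K * (H x + B) + \<bar>h x\<bar>)\<^sup>2" by (intro power_mono) auto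
      then show "norm ((?a n x - h x)\<^sup>2) \<le> (2 * ?K * (H x + B) + \<bar>h x\<bar>)\<^sup>2" by simp
    qed
    show "(\<lambda>x. (?a n x - h x)\<^sup>2) \<in> borel_measurable M" for n unfolding y_def by measurable
  qed simp
  then have *: "(\<lambda>n. \<integral>x. (?a n x - h x)\<^sup>2 \<partial>M) \<longlonglongrightarrow> 0" by simp
  show ?thesis
  proof (rule Lim_transform_eventually[OF *], rule eventually_mono[OF eventually_gt_at_top[of 0]])
    fix n :: nat assume n: "0 < n"
    have "(\<integral>x. (?a n x - h x)\<^sup>2 \<partial>M) = (\<integral>x. real n * (2 * (sqrt (tilt M hn n x) - 1) - h x / sqrt (real n))\<^sup>2 \<partial>M)"
    proof (rule Bochner_Integration.integral_cong[OF refl])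
      fix x
      have "?a n x - h x = sqrt (real n) * (2 * (sqrt (tilt M hn n x) - 1) - h x / sqrt (real n))"
        unfolding root[OF n] using n by (simp add: algebra_simps)
      then show "(?a n x - h x)\<^sup>2 = real n * (2 * (sqrt (tilt M hn n x) - 1) - h x / sqrt (real n))\<^sup>2"
        by (simp add: power_mult_distrib)
    qed
    then show "(\<integral>x. (?a n x - h x)\<^sup>2 \<partial>M) = real n * (\<integral>x. (2 * (sqrt (tilt M hn n x) - 1) - h x / sqrt (real n))\<^sup>2 \<partial>M)"
      by simp
  qed
qed

text \<open>The root quotient has squared norm 1 minus the singular mass, so the squared distance of
  the two roots is twice the defect of the affinity minus that mass. The distance is then split at
  the common linear approximation \<open>1 + h / 2\<close>, using
  \<open>(a - b)\<^sup>2 \<le> 2 * a\<^sup>2 + 2 * b\<^sup>2\<close>.\<close>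

lemma Hellinger_affinity_bound:
  assumes P: "prob_space P" "prob_space P0" "sets P = sets P0" and p: "is_density_quotient P P0 p"
    and u: "integrable P0 u" "\<And>x. 0 \<le> u x" "(\<integral>x. u x \<partial>P0) = 1"
    and h: "h \<in> L2 P0"
  shows "0 \<le> 1 - (\<integral>x. density_root p x * sqrt (u x) \<partial>P0)"
    and "8 * (1 - (\<integral>x. density_root p x * sqrt (u x) \<partial>P0)) \<le> 4 * measure P {x \<in> space P. p x = \<infinity>} +
      2 * (\<integral>x. (2 * (density_root p x - 1) - h x)\<^sup>2 \<partial>P0) + 2 * (\<integral>x. (2 * (sqrt (u x) - 1) - h x)\<^sup>2 \<partial>P0)"
proof -
  interpret P: prob_space P by fact
  interpret P0: prob_space P0 by fact
  note rp = density_root_L2[OF P(1,3) p]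
  have [measurable]: "u \<in> borel_measurable P0" using u by auto
  have su: "(\<lambda>x. sqrt (u x)) \<in> L2 P0" using u by (auto simp: L2_def)
  let ?\<rho> = "\<integral>x. density_root p x * sqrt (u x) \<partial>P0" and ?s = "measure P {x \<in> space P. p x = \<infinity>}"
  let ?A = "\<lambda>x. 2 * (density_root p x - 1) - h x" and ?B = "\<lambda>x. 2 * (sqrt (u x) - 1) - h x"
  have AB: "?A \<in> L2 P0" "?B \<in> L2 P0" by (intro L2_diff[of "\<lambda>x. 2 * _ x"] L2_scale L2_diff rp su h P0.L2_const)+
  have d: "(\<lambda>x. density_root p x - sqrt (u x)) \<in> L2 P0" by (intro L2_diff rp su)
  have "(\<integral>x. (density_root p x - sqrt (u x))\<^sup>2 \<partial>P0) =
      (\<integral>x. (density_root p x)\<^sup>2 + (sqrt (u x))\<^sup>2 - 2 * (density_root p x * sqrt (u x)) \<partial>P0)"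
    by (intro Bochner_Integration.integral_cong) (auto simp: power2_eq_square algebra_simps)
  also have "\<dots> = (1 - ?s) + 1 - 2 * ?\<rho>"
    using rp(1,2) su L2_mult_integrable[OF rp(1) su] u by (simp add: L2_def)
  finally have D: "(\<integral>x. (density_root p x - sqrt (u x))\<^sup>2 \<partial>P0) = 2 * (1 - ?\<rho>) - ?s" by simp
  define D' where "D' = 1 - ?\<rho>"
  have "0 \<le> 2 * D' - ?s" unfolding D'_def D[symmetric] by simp
  then have "0 \<le> D'" using measure_nonneg[of P "{x \<in> space P. p x = \<infinity>}"] by linarith
  then show "0 \<le> 1 - ?\<rho>" by (simp add: D'_def)
  have "4 * (\<integral>x. (density_root p x - sqrt (u x))\<^sup>2 \<partial>P0) = (\<integral>x. 4 * (density_root p x - sqrt (u x))\<^sup>2 \<partial>P0)" by simp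
  also have "\<dots> \<le> (\<integral>x. 2 * (?A x)\<^sup>2 + 2 * (?B x)\<^sup>2 \<partial>P0)"
  proof (rule integral_mono)
    fix x
    have "2 * (?A x)\<^sup>2 + 2 * (?B x)\<^sup>2 - (?A x - ?B x)\<^sup>2 = (?A x + ?B x)\<^sup>2" by (simp add: power2_eq_square algebra_simps)
    moreover have "?A x - ?B x = 2 * (density_root p x - sqrt (u x))" by simp
    ultimately have "2 * (?A x)\<^sup>2 + 2 * (?B x)\<^sup>2 - (2 * (density_root p x - sqrt (u x)))\<^sup>2 \<ge> 0"
      by (metis zero_le_power2)
    moreover have "(2 * w)\<^sup>2 = 4 * w\<^sup>2" for w :: real by (simp add: power_mult_distrib)
    ultimately show "4 * (density_root p x - sqrt (u x))\<^sup>2 \<le> 2 * (?A x)\<^sup>2 + 2 * (?B x)\<^sup>2"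
      by (metis diff_ge_0_iff_ge)
  qed (use AB d in \<open>auto simp: L2_def\<close>)
  also have "\<dots> = 2 * (\<integral>x. (?A x)\<^sup>2 \<partial>P0) + 2 * (\<integral>x. (?B x)\<^sup>2 \<partial>P0)"
    using AB by (auto simp: L2_def)
  finally show "8 * (1 - ?\<rho>) \<le> 4 * ?s + 2 * (\<integral>x. (?A x)\<^sup>2 \<partial>P0) + 2 * (\<integral>x. (?B x)\<^sup>2 \<partial>P0)"
    unfolding D D'_def[symmetric] by (simp add: right_diff_distrib)
qed

text \<open>As \<open>t n\<close> behaves like \<open>s / sqrt n\<close>, errors of order
  \<open>o(t\<^sup>2)\<close> become \<open>o(1 / n)\<close>. Replacing \<open>t n\<close> by
  \<open>s / sqrt n\<close> in the linear term costs, after multiplication by n, a multiple of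
  \<open>(t n * sqrt n - s)\<^sup>2\<close>.\<close>

lemma curve_root_expansion:
  assumes \<P>: "\<P> \<subseteq> space (prob_algebra N)"
    and curve: "L2_differentiable_curve \<P> \<epsilon> P g" and P0: "P 0 = P0"
    and t: "t \<longlonglongrightarrow> 0" "(\<lambda>n. t n * sqrt (real n)) \<longlonglongrightarrow> s" "s > 0" "\<And>n. \<bar>t n\<bar> < \<epsilon>"
  obtains p where "\<And>n. is_density_quotient (P (t n)) P0 (p n)"
    "(\<lambda>n. real n * measure (P (t n)) {x \<in> space (P (t n)). p n x = \<infinity>}) \<longlonglongrightarrow> 0"
    "(\<lambda>n. real n * (\<integral>x. (2 * (density_root (p n) x - 1) - s * g x / sqrt (real n))\<^sup>2 \<partial>P0)) \<longlonglongrightarrow> 0"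
proof -
  from curve obtain q where \<epsilon>: "\<epsilon> > 0" and P: "\<And>t. \<bar>t\<bar> < \<epsilon> \<Longrightarrow> P t \<in> \<P>"
    and g: "g \<in> L2 P0" and q: "\<And>t. \<bar>t\<bar> < \<epsilon> \<Longrightarrow> is_density_quotient (P t) P0 (q t)"
    and lim: "(\<lambda>t. L2_norm P0 (\<lambda>x. 2 * (sqrt (enn2real (q t x)) - 1) - t * g x)) \<in> o[at 0](\<lambda>t. \<bar>t\<bar>)"
    and sing: "(\<lambda>t. measure (P t) {x \<in> space (P t). q t x = \<infinity>}) \<in> o[at 0](\<lambda>t. t\<^sup>2)"
    unfolding L2_differentiable_curve_def P0 by auto
  have Pt: "prob_space (P t)" "sets (P t) = sets P0" if "\<bar>t\<bar> < \<epsilon>" for t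
    using \<P> P[OF that] P[of 0] \<epsilon> prob_algebraD P0 by (metis subsetD abs_zero)+
  interpret P0: prob_space P0 using Pt(1)[of 0] \<epsilon> P0 by simp
  \<comment> \<open>The limits in the definition of a curve are punctured at 0; \<open>s > 0\<close>
    keeps \<open>t n\<close> off 0 eventually.\<close>
  have ev: "\<forall>\<^sub>F n in sequentially. t n \<noteq> 0"
    using order_tendstoD(1)[OF t(2,3)] by eventually_elim auto
  have t0: "filterlim t (at 0) sequentially"
    using t(1) ev by (auto simp: filterlim_at)
  have nt: "(\<lambda>n. real n * (t n)\<^sup>2) \<longlonglongrightarrow> s\<^sup>2"
    using tendsto_power[OF t(2), of 2] by (simp add: power_mult_distrib mult.commute)
  show thesis
  proof (rule that[of "\<lambda>n. q (t n)"])
    show "is_density_quotient (P (t n)) P0 (q (t n))" for n by (rule q[OF t(4)])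
    have s1: "(\<lambda>n. measure (P (t n)) {x \<in> space (P (t n)). q (t n) x = \<infinity>} / (t n)\<^sup>2) \<longlonglongrightarrow> 0"
      using filterlim_compose[OF sing[unfolded smallo_power2_iff] t0] .
    have "(\<lambda>n. (real n * (t n)\<^sup>2) * (measure (P (t n)) {x \<in> space (P (t n)). q (t n) x = \<infinity>} / (t n)\<^sup>2)) \<longlonglongrightarrow> s\<^sup>2 * 0"
      by (intro tendsto_mult nt s1)
    then have "(\<lambda>n. (real n * (t n)\<^sup>2) * (measure (P (t n)) {x \<in> space (P (t n)). q (t n) x = \<infinity>} / (t n)\<^sup>2)) \<longlonglongrightarrow> 0" by simp
    then show "(\<lambda>n. real n * measure (P (t n)) {x \<in> space (P (t n)). q (t n) x = \<infinity>}) \<longlonglongrightarrow> 0"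
      by (rule Lim_transform_eventually) (use ev in \<open>eventually_elim, simp\<close>)
    let ?e = "\<lambda>n. \<integral>x. (2 * (density_root (q (t n)) x - 1) - t n * g x)\<^sup>2 \<partial>P0"
    have "(\<lambda>n. (\<integral>x. (2 * (sqrt (enn2real (q (t n) x)) - 1) - t n * g x)\<^sup>2 \<partial>P0) / (t n)\<^sup>2) \<longlonglongrightarrow> 0"
      using filterlim_compose[OF lim[unfolded L2_norm_smallo_iff] t0] .
    then have e1: "(\<lambda>n. ?e n / (t n)\<^sup>2) \<longlonglongrightarrow> 0" by (simp add: density_root_def)
    have "(\<lambda>n. (real n * (t n)\<^sup>2) * (?e n / (t n)\<^sup>2)) \<longlonglongrightarrow> s\<^sup>2 * 0"
      by (intro tendsto_mult nt e1)
    then have "(\<lambda>n. (real n * (t n)\<^sup>2) * (?e n / (t n)\<^sup>2)) \<longlonglongrightarrow> 0" by simp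
    then have e2: "(\<lambda>n. real n * ?e n) \<longlonglongrightarrow> 0"
      by (rule Lim_transform_eventually) (use ev in \<open>eventually_elim, simp\<close>)
    let ?G = "\<integral>x. (g x)\<^sup>2 \<partial>P0"
    show "(\<lambda>n. real n * (\<integral>x. (2 * (density_root (q (t n)) x - 1) - s * g x / sqrt (real n))\<^sup>2 \<partial>P0)) \<longlonglongrightarrow> 0"
    proof (rule tendsto_sandwich[OF _ _ tendsto_const])
      show "\<forall>\<^sub>F n in sequentially. 0 \<le> real n * (\<integral>x. (2 * (density_root (q (t n)) x - 1) - s * g x / sqrt (real n))\<^sup>2 \<partial>P0)"
        by (intro always_eventually allI mult_nonneg_nonneg) auto
      show "\<forall>\<^sub>F n in sequentially. real n * (\<integral>x. (2 * (density_root (q (t n)) x - 1) - s * g x / sqrt (real n))\<^sup>2 \<partial>P0)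
        \<le> 2 * (real n * ?e n) + 2 * (t n * sqrt (real n) - s)\<^sup>2 * ?G"
      proof (rule eventually_mono[OF eventually_gt_at_top[of 0]])
        fix n :: nat assume n: "0 < n"
        define r where "r = t n - s / sqrt (real n)"
        have rq: "density_root (q (t n)) \<in> L2 P0"
          by (rule density_root_L2(1)[OF Pt[OF t(4)] q[OF t(4)]])
        have A: "(\<lambda>x. 2 * (density_root (q (t n)) x - 1) - t n * g x) \<in> L2 P0"
          by (intro L2_diff[of "\<lambda>x. 2 * _ x"] L2_scale L2_diff rq g P0.L2_const)
        have A': "(\<lambda>x. 2 * (density_root (q (t n)) x - 1) - s / sqrt (real n) * g x) \<in> L2 P0"
          by (intro L2_diff[of "\<lambda>x. 2 * _ x"] L2_scale L2_diff rq g P0.L2_const)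
        have "(\<integral>x. (2 * (density_root (q (t n)) x - 1) - s / sqrt (real n) * g x)\<^sup>2 \<partial>P0) \<le>
            (\<integral>x. 2 * (2 * (density_root (q (t n)) x - 1) - t n * g x)\<^sup>2 + 2 * (r\<^sup>2 * (g x)\<^sup>2) \<partial>P0)"
        proof (rule integral_mono)
          fix x
          define a where "a = 2 * (density_root (q (t n)) x - 1) - t n * g x"
          have eq: "2 * (density_root (q (t n)) x - 1) - s / sqrt (real n) * g x = a + r * g x"
            by (simp add: a_def r_def algebra_simps)
          have "2 * a\<^sup>2 + 2 * (r * g x)\<^sup>2 - (a + r * g x)\<^sup>2 = (a - r * g x)\<^sup>2"
            by (simp add: power2_eq_square algebra_simps)
          then have "(a + r * g x)\<^sup>2 \<le> 2 * a\<^sup>2 + 2 * (r * g x)\<^sup>2" by (smt (verit) zero_le_power2)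
          then show "(2 * (density_root (q (t n)) x - 1) - s / sqrt (real n) * g x)\<^sup>2 \<le>
            2 * (2 * (density_root (q (t n)) x - 1) - t n * g x)\<^sup>2 + 2 * (r\<^sup>2 * (g x)\<^sup>2)"
            unfolding eq a_def[symmetric] by (simp only: power_mult_distrib)
        qed (use A A' g in \<open>auto simp: L2_def\<close>)
        also have "\<dots> = 2 * ?e n + 2 * (r\<^sup>2 * ?G)"
          using A g by (auto simp: L2_def)
        finally have "real n * (\<integral>x. (2 * (density_root (q (t n)) x - 1) - s / sqrt (real n) * g x)\<^sup>2 \<partial>P0) \<le>
            real n * (2 * ?e n + 2 * (r\<^sup>2 * ?G))" by (intro mult_left_mono) auto
        also have "\<dots> = 2 * (real n * ?e n) + 2 * (sqrt (real n) * r)\<^sup>2 * ?G"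
          by (simp add: power_mult_distrib algebra_simps)
        also have "sqrt (real n) * r = t n * sqrt (real n) - s" using n by (simp add: r_def algebra_simps)
        finally show "real n * (\<integral>x. (2 * (density_root (q (t n)) x - 1) - s * g x / sqrt (real n))\<^sup>2 \<partial>P0)
          \<le> 2 * (real n * ?e n) + 2 * (t n * sqrt (real n) - s)\<^sup>2 * ?G" by simp
      qed
      have "(\<lambda>n. 2 * (real n * ?e n) + 2 * (t n * sqrt (real n) - s)\<^sup>2 * ?G) \<longlonglongrightarrow> 2 * 0 + 2 * (s - s)\<^sup>2 * ?G"
        by (intro tendsto_intros e2 t)
      then show "(\<lambda>n. 2 * (real n * ?e n) + 2 * (t n * sqrt (real n) - s)\<^sup>2 * ?G) \<longlonglongrightarrow> 0" by simp
    qed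
  qed
qed

section \<open>Two-sample design and the limit law of linear statistics under tilts\<close>

locale two_sample_design = P0: prob_space P0 + Q0: prob_space Q0
  for P0 :: "'a measure" and Q0 :: "'b measure" +
  fixes n1 n2 :: "nat \<Rightarrow> nat" and d :: real
  assumes sizes: "n1 n + n2 n = n"
    and ratio: "(\<lambda>n. real (n2 n) / real n) \<longlonglongrightarrow> d"
    and d: "0 < d" "d < 1"
begin

abbreviation N :: "nat \<Rightarrow> ((nat \<Rightarrow> 'a) \<times> (nat \<Rightarrow> 'b)) measure" where
  "N n \<equiv> two_sample (n1 n) (n2 n) P0 Q0"

sublocale N: prob_space "N n" for n
  by (intro prob_space_two_sample P0.prob_space_axioms Q0.prob_space_axioms)

lemma ratio1: "(\<lambda>n. real (n1 n) / real n) \<longlonglongrightarrow> 1 - d"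
proof (rule Lim_transform_eventually)
  show "(\<lambda>n. 1 - real (n2 n) / real n) \<longlonglongrightarrow> 1 - d" by (intro tendsto_intros ratio)
  show "\<forall>\<^sub>F n in sequentially. 1 - real (n2 n) / real n = real (n1 n) / real n"
  proof (rule eventually_mono[OF eventually_gt_at_top[of 0]])
    fix n :: nat assume "0 < n"
    moreover have "real n = real (n1 n) + real (n2 n)" using sizes[of n] by (metis of_nat_add)
    ultimately show "1 - real (n2 n) / real n = real (n1 n) / real n" by (simp add: field_simps)
  qed
qed

lemma sizes_le: "n1 n \<le> n" "n2 n \<le> n"
  using sizes[of n] by auto

definition lin_stat :: "(nat \<Rightarrow> 'a \<Rightarrow> real) \<Rightarrow> (nat \<Rightarrow> 'b \<Rightarrow> real) \<Rightarrow> nat \<Rightarrow> (nat \<Rightarrow> 'a) \<times> (nat \<Rightarrow> 'b) \<Rightarrow> real" where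
  "lin_stat k1 k2 n \<omega> = ((\<Sum>i=1..n1 n. k1 n (fst \<omega> i)) + (\<Sum>j=1..n2 n. k2 n (snd \<omega> j))) / sqrt (real n)"

definition tilted :: "(nat \<Rightarrow> 'a \<Rightarrow> real) \<Rightarrow> (nat \<Rightarrow> 'b \<Rightarrow> real) \<Rightarrow> nat \<Rightarrow> (nat \<Rightarrow> 'a) \<times> (nat \<Rightarrow> 'b) \<Rightarrow> real" where
  "tilted h1 h2 n = sample_prod (n1 n) (n2 n) (tilt P0 h1 n) (tilt Q0 h2 n)"

definition admissible :: "(nat \<Rightarrow> 'a \<Rightarrow> real) \<Rightarrow> (nat \<Rightarrow> 'b \<Rightarrow> real) \<Rightarrow> ('a \<Rightarrow> real) \<Rightarrow> ('b \<Rightarrow> real) \<Rightarrow> bool" where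
  "admissible h1n h2n h1 h2 \<longleftrightarrow> L2_array P0 h1n h1 \<and> root_n_bounded h1n \<and> L2_array Q0 h2n h2 \<and> root_n_bounded h2n"

lemma admissible_add:
  assumes "admissible h1n h2n h1 h2" "admissible k1n k2n k1 k2"
  shows "admissible (\<lambda>n x. h1n n x + b * k1n n x) (\<lambda>n y. h2n n y + b * k2n n y)
    (\<lambda>x. h1 x + b * k1 x) (\<lambda>y. h2 y + b * k2 y)"
  using assms unfolding admissible_def
  by (auto intro!: L2_array_add root_n_bounded_add P0.finite_measure_axioms Q0.finite_measure_axioms)

lemma admissible_truncation:
  "h1 \<in> L2_0 P0 \<Longrightarrow> h2 \<in> L2_0 Q0 \<Longrightarrow> admissible (truncation h1) (truncation h2) h1 h2"
  unfolding admissible_def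
  by (auto intro!: L2_array_truncation root_n_bounded_truncation P0.finite_measure_axioms Q0.finite_measure_axioms)

lemma lin_stat_measurable[measurable]:
  assumes "L2_array P0 k1n k1" "L2_array Q0 k2n k2"
  shows "lin_stat k1n k2n n \<in> borel_measurable (N n)"
proof -
  have [measurable]: "k1n n \<in> borel_measurable P0" "k2n n \<in> borel_measurable Q0"
    using assms unfolding L2_array_def by auto
  show ?thesis unfolding lin_stat_def[abs_def] two_sample_def by measurable
qed

lemma
  assumes h: "admissible h1n h2n h1 h2"
  shows tilted_pos: "0 < tilted h1n h2n n \<omega>"
    and integrable_tilted: "integrable (N n) (tilted h1n h2n n)"
    and integral_tilted: "(\<integral>\<omega>. tilted h1n h2n n \<omega> \<partial>N n) = 1"
proof -
  note a = h[unfolded admissible_def]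
  have i: "integrable P0 (tilt P0 h1n n)" "integrable Q0 (tilt Q0 h2n n)"
    using P0.integrable_tilt Q0.integrable_tilt a by blast+
  show "0 < tilted h1n h2n n \<omega>"
    unfolding tilted_def sample_prod_def
    using a P0.tilt_pos[of h1n h1 n] Q0.tilt_pos[of h2n h2 n] by (intro mult_pos_pos prod_pos) auto
  show "integrable (N n) (tilted h1n h2n n)"
    unfolding tilted_def by (intro integrable_sample_prod P0.prob_space_axioms Q0.prob_space_axioms i)
  show "(\<integral>\<omega>. tilted h1n h2n n \<omega> \<partial>N n) = 1"
    unfolding tilted_def integral_sample_prod[OF P0.prob_space_axioms Q0.prob_space_axioms i]
    using a P0.integral_tilt[of h1n h1 n] Q0.integral_tilt[of h2n h2 n] by simp
qed

lemma integrable_test_tilted: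
  assumes h: "admissible h1n h2n h1 h2"
    and \<phi>: "\<phi> \<in> borel_measurable (N n)" "\<And>\<omega>. \<omega> \<in> space (N n) \<Longrightarrow> 0 \<le> \<phi> \<omega> \<and> \<phi> \<omega> \<le> (1::real)"
  shows "integrable (N n) (\<lambda>\<omega>. \<phi> \<omega> * tilted h1n h2n n \<omega>)"
proof (rule Bochner_Integration.integrable_bound[OF integrable_tilted[OF h]])
  show "AE \<omega> in N n. norm (\<phi> \<omega> * tilted h1n h2n n \<omega>) \<le> norm (tilted h1n h2n n \<omega>)"
    using \<phi>(2) by (intro AE_I2) (auto simp: abs_mult intro!: mult_left_le_one_le)
qed (use \<phi> integrable_tilted[OF h, of n] in measurable)

text \<open>The inner product of the limiting Gaussian shift experiment, weighted by the limiting
  sampling fractions. Under the tilt in direction h the linear statistic of k has it as limiting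
  mean; with \<open>h = k\<close> it is the limiting variance.\<close>

definition drift :: "('a \<Rightarrow> real) \<Rightarrow> ('b \<Rightarrow> real) \<Rightarrow> ('a \<Rightarrow> real) \<Rightarrow> ('b \<Rightarrow> real) \<Rightarrow> real" where
  "drift h1 h2 k1 k2 = (1 - d) * (\<integral>x. h1 x * k1 x \<partial>P0) + d * (\<integral>y. h2 y * k2 y \<partial>Q0)"

lemma exp_lin_stat:
  "exp (\<i> * complex_of_real (w * lin_stat k1 k2 n \<omega>)) =
    sample_prod (n1 n) (n2 n) (\<lambda>x. exp (\<i> * complex_of_real (w * k1 n x / sqrt (real n))))
      (\<lambda>y. exp (\<i> * complex_of_real (w * k2 n y / sqrt (real n)))) \<omega>"
proof -
  have "\<i> * complex_of_real (w * lin_stat k1 k2 n \<omega>) =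
     (\<Sum>i=1..n1 n. \<i> * complex_of_real (w * k1 n (fst \<omega> i) / sqrt (real n))) +
     (\<Sum>j=1..n2 n. \<i> * complex_of_real (w * k2 n (snd \<omega> j) / sqrt (real n)))"
    unfolding lin_stat_def
    by (simp add: sum_distrib_left sum_divide_distrib add_divide_distrib distrib_left)
  then show ?thesis by (simp add: exp_add exp_sum sample_prod_def)
qed

text \<open>By independence the integral is a quotient of powers of transforms of one observation.
  The exponents combine to \<open>((h + i * w * k)\<^sup>2 - h\<^sup>2) / 2\<close>, integrated with
  the sampling fractions as weights: the square of h cancels against the normaliser, and the
  exponent of a normal characteristic function remains.\<close>

lemma tilted_characteristic_limit:
  assumes h: "admissible h1n h2n h1 h2" and k: "L2_array P0 k1n k1" "L2_array Q0 k2n k2"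
  shows "(\<lambda>n. \<integral>\<omega>. tilted h1n h2n n \<omega> *\<^sub>R exp (\<i> * complex_of_real (w * lin_stat k1n k2n n \<omega>)) \<partial>N n)
    \<longlonglongrightarrow> exp (\<i> * complex_of_real (w * drift h1 h2 k1 k2) - complex_of_real (w\<^sup>2 * drift k1 k2 k1 k2 / 2))"
proof -
  note a = h[unfolded admissible_def]
  have a': "L2_array P0 h1n h1" "root_n_bounded h1n" "L2_array Q0 h2n h2" "root_n_bounded h2n" using a by auto
  note c1 = P0.tilted_characteristic_function[OF a'(1,2) k(1), where w=w]
  note c2 = Q0.tilted_characteristic_function[OF a'(3,4) k(2), where w=w]
  let ?A1 = "\<lambda>n. \<integral>x. exp (Complex (h1n n x) (w * k1n n x) / sqrt (real n)) \<partial>P0"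
  let ?A2 = "\<lambda>n. \<integral>x. exp (Complex (h2n n x) (w * k2n n x) / sqrt (real n)) \<partial>Q0"
  let ?L1 = "Complex ((\<integral>x. (h1 x)\<^sup>2 \<partial>P0) / 2 - w\<^sup>2 * (\<integral>x. (k1 x)\<^sup>2 \<partial>P0) / 2) (w * (\<integral>x. h1 x * k1 x \<partial>P0))"
  let ?L2 = "Complex ((\<integral>x. (h2 x)\<^sup>2 \<partial>Q0) / 2 - w\<^sup>2 * (\<integral>x. (k2 x)\<^sup>2 \<partial>Q0) / 2) (w * (\<integral>x. h2 x * k2 x \<partial>Q0))"
  let ?M1 = "\<lambda>n. complex_of_real (tilt_norm P0 h1n n)" and ?M2 = "\<lambda>n. complex_of_real (tilt_norm Q0 h2n n)"
  let ?K1 = "complex_of_real ((\<integral>x. (h1 x)\<^sup>2 \<partial>P0) / 2)" and ?K2 = "complex_of_real ((\<integral>x. (h2 x)\<^sup>2 \<partial>Q0) / 2)"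
  have M: "(\<lambda>n. real n * (?M1 n - 1)) \<longlonglongrightarrow> ?K1" "(\<lambda>n. real n * (?M2 n - 1)) \<longlonglongrightarrow> ?K2"
    using tendsto_of_real[OF P0.tilt_norm_limit[OF a'(1,2)], where 'a=complex]
      tendsto_of_real[OF Q0.tilt_norm_limit[OF a'(3,4)], where 'a=complex] by simp_all
  have "(\<lambda>n. (?A1 n ^ n1 n * ?A2 n ^ n2 n) / (?M1 n ^ n1 n * ?M2 n ^ n2 n)) \<longlonglongrightarrow>
      (exp ((1 - d) * ?L1) * exp (d * ?L2)) / (exp ((1 - d) * ?K1) * exp (d * ?K2))"
    by (intro tendsto_intros power_limit_exp ratio ratio1 c1(2) c2(2) M) auto
  also have "(exp ((1 - d) * ?L1) * exp (d * ?L2)) / (exp ((1 - d) * ?K1) * exp (d * ?K2)) =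
      exp (((1 - d) * ?L1 + d * ?L2) - ((1 - d) * ?K1 + d * ?K2))"
    by (simp only: exp_add exp_diff)
  also have "((1 - d) * ?L1 + d * ?L2) - ((1 - d) * ?K1 + d * ?K2) =
      \<i> * complex_of_real (w * drift h1 h2 k1 k2) - complex_of_real (w\<^sup>2 * drift k1 k2 k1 k2 / 2)"
    by (auto simp: complex_eq_iff drift_def power2_eq_square field_simps)
  finally have lim: "(\<lambda>n. (?A1 n ^ n1 n * ?A2 n ^ n2 n) / (?M1 n ^ n1 n * ?M2 n ^ n2 n)) \<longlonglongrightarrow>
    exp (\<i> * complex_of_real (w * drift h1 h2 k1 k2) - complex_of_real (w\<^sup>2 * drift k1 k2 k1 k2 / 2))" .
  have eq: "(\<integral>\<omega>. tilted h1n h2n n \<omega> *\<^sub>R exp (\<i> * complex_of_real (w * lin_stat k1n k2n n \<omega>)) \<partial>N n) =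
     (?A1 n ^ n1 n * ?A2 n ^ n2 n) / (?M1 n ^ n1 n * ?M2 n ^ n2 n)" for n
  proof -
    let ?u = "\<lambda>x. exp (Complex (h1n n x) (w * k1n n x) / sqrt (real n)) / ?M1 n"
    let ?v = "\<lambda>x. exp (Complex (h2n n x) (w * k2n n x) / sqrt (real n)) / ?M2 n"
    have ce: "exp (complex_of_real (a / s)) / m * exp (\<i> * complex_of_real (b / s)) = exp (Complex a b / complex_of_real s) / m" for a b s m
      by (simp add: Complex_eq add_divide_distrib exp_add)
    have "tilted h1n h2n n \<omega> *\<^sub>R exp (\<i> * complex_of_real (w * lin_stat k1n k2n n \<omega>)) =
      sample_prod (n1 n) (n2 n) (\<lambda>x. complex_of_real (tilt P0 h1n n x)) (\<lambda>y. complex_of_real (tilt Q0 h2n n y)) \<omega> *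
      exp (\<i> * complex_of_real (w * lin_stat k1n k2n n \<omega>))" for \<omega>
      by (simp add: scaleR_conv_of_real tilted_def sample_prod_def)
    also have "\<dots> \<omega> = sample_prod (n1 n) (n2 n) ?u ?v \<omega>" for \<omega>
      unfolding exp_lin_stat sample_prod_mult tilt_def of_real_divide[of "exp _"] exp_of_real[symmetric] ce ..
    finally have "(\<integral>\<omega>. tilted h1n h2n n \<omega> *\<^sub>R exp (\<i> * complex_of_real (w * lin_stat k1n k2n n \<omega>)) \<partial>N n) =
        (\<integral>\<omega>. sample_prod (n1 n) (n2 n) ?u ?v \<omega> \<partial>N n)" by simp
    also have "\<dots> = (\<integral>x. ?u x \<partial>P0) ^ n1 n * (\<integral>y. ?v y \<partial>Q0) ^ n2 n"
      by (intro integral_sample_prod P0.prob_space_axioms Q0.prob_space_axioms integrable_divide c1(1) c2(1))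
    also have "\<dots> = (?A1 n ^ n1 n * ?A2 n ^ n2 n) / (?M1 n ^ n1 n * ?M2 n ^ n2 n)"
      by (simp add: power_divide)
    finally show ?thesis .
  qed
  show ?thesis unfolding eq by (rule lim)
qed

text \<open>The asymptotic power of the two-sided test as a function of the drift m. The parameter v
  is a variance, hence the root.\<close>

definition two_sided :: "real \<Rightarrow> real \<Rightarrow> real \<Rightarrow> real" where
  "two_sided c v m = measure std_normal_distribution {z. c < \<bar>m + sqrt v * z\<bar>}"

text \<open>Levy's theorem for the statistic standardised by its limiting mean and variance under
  the tilted law. For the standardised variable the rejection region has at most two boundary
  points, hence is a continuity set of the normal law. That k is a mere \<open>L2_array\<close>
  admits the statistic of the theorem with its coefficients.\<close>

lemma tilted_two_sided_limit:
  assumes h: "admissible h1n h2n h1 h2" and k: "L2_array P0 k1n k1" "L2_array Q0 k2n k2"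
    and v: "0 < drift k1 k2 k1 k2"
  shows "(\<lambda>n. \<integral>\<omega>. (if c < \<bar>lin_stat k1n k2n n \<omega>\<bar> then 1 else 0) * tilted h1n h2n n \<omega> \<partial>N n)
    \<longlonglongrightarrow> two_sided c (drift k1 k2 k1 k2) (drift h1 h2 k1 k2)"
proof -
  define m where "m = drift h1 h2 k1 k2"
  define v where "v = drift k1 k2 k1 k2"
  have v0: "0 < sqrt v" using v by (simp add: v_def)
  have [measurable]: "tilted h1n h2n n \<in> borel_measurable (N n)" "lin_stat k1n k2n n \<in> borel_measurable (N n)" for n
    using integrable_tilted[OF h, of n] lin_stat_measurable[OF k, of n] by auto
  define N' where "N' n = density (N n) (tilted h1n h2n n)" for n
  have pos: "0 \<le> tilted h1n h2n n \<omega>" for n \<omega> using tilted_pos[OF h, of n \<omega>] by simp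
  have N'p: "prob_space (N' n)" for n
  proof
    have "emeasure (N' n) (space (N' n)) = (\<integral>\<^sup>+\<omega>. tilted h1n h2n n \<omega> \<partial>N n)"
      unfolding N'_def by (auto simp: emeasure_density intro!: nn_integral_cong)
    also have "\<dots> = ennreal (\<integral>\<omega>. tilted h1n h2n n \<omega> \<partial>N n)"
      by (intro nn_integral_eq_integral integrable_tilted[OF h] AE_I2 pos)
    finally show "emeasure (N' n) (space (N' n)) = 1" by (simp add: integral_tilted[OF h])
  qed
  interpret N': prob_space "N' n" for n by (rule N'p)
  have N'm: "borel_measurable (N' n) = borel_measurable (N n)" for n
    unfolding N'_def by (rule measurable_cong_sets) simp_all
  let ?Z = "\<lambda>n \<omega>. (lin_stat k1n k2n n \<omega> - m) / sqrt v"
  have Zm: "?Z n \<in> borel_measurable (N' n)" for n unfolding N'm by measurable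
  let ?D = "\<lambda>n. distr (N' n) borel (?Z n)"
  have rd: "real_distribution (?D n)" for n
    using Zm by (intro N'.real_distribution_distr)
  have "weak_conv_m ?D std_normal_distribution"
  proof (rule levy_continuity[OF rd real_dist_normal_dist])
    fix t :: real
    define w where "w = t / sqrt v"
    have char: "char (?D n) t = exp (- (\<i> * complex_of_real (w * m))) *
        (\<integral>\<omega>. tilted h1n h2n n \<omega> *\<^sub>R exp (\<i> * complex_of_real (w * lin_stat k1n k2n n \<omega>)) \<partial>N n)" for n
    proof -
      have "char (?D n) t = (\<integral>\<omega>. exp (\<i> * complex_of_real (t * ?Z n \<omega>)) \<partial>N' n)"
        unfolding char_def using Zm by (subst integral_distr) auto
      also have "\<dots> = (\<integral>\<omega>. tilted h1n h2n n \<omega> *\<^sub>R exp (\<i> * complex_of_real (t * ?Z n \<omega>)) \<partial>N n)"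
        unfolding N'_def by (intro integral_density) (auto simp: pos)
      also have "\<dots> = (\<integral>\<omega>. exp (- (\<i> * complex_of_real (w * m))) *
          (tilted h1n h2n n \<omega> *\<^sub>R exp (\<i> * complex_of_real (w * lin_stat k1n k2n n \<omega>))) \<partial>N n)"
      proof (intro Bochner_Integration.integral_cong refl)
        fix \<omega>
        have eq: "t * ?Z n \<omega> = w * lin_stat k1n k2n n \<omega> - w * m" by (simp add: w_def diff_divide_distrib right_diff_distrib)
        have "exp (\<i> * complex_of_real (t * ?Z n \<omega>)) =
          exp (- (\<i> * complex_of_real (w * m))) * exp (\<i> * complex_of_real (w * lin_stat k1n k2n n \<omega>))"
          unfolding eq exp_add[symmetric] by (simp add: right_diff_distrib)
        then show "tilted h1n h2n n \<omega> *\<^sub>R exp (\<i> * complex_of_real (t * ?Z n \<omega>)) =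
          exp (- (\<i> * complex_of_real (w * m))) * (tilted h1n h2n n \<omega> *\<^sub>R exp (\<i> * complex_of_real (w * lin_stat k1n k2n n \<omega>)))"
          by simp
      qed
      finally show ?thesis by (simp only: integral_mult_right_zero)
    qed
    have "(\<lambda>n. char (?D n) t) \<longlonglongrightarrow> exp (- (\<i> * complex_of_real (w * m))) * exp (\<i> * complex_of_real (w * m) - complex_of_real (w\<^sup>2 * v / 2))"
      unfolding char by (intro tendsto_mult tendsto_const tilted_characteristic_limit[OF h k, of w, folded m_def v_def])
    also have "exp (- (\<i> * complex_of_real (w * m))) * exp (\<i> * complex_of_real (w * m) - complex_of_real (w\<^sup>2 * v / 2)) =
        complex_of_real (exp (- (w\<^sup>2 * v / 2)))"
      by (simp add: exp_add[symmetric] exp_of_real[symmetric])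
    also have "w\<^sup>2 * v = t\<^sup>2" using v0 by (simp add: w_def power_divide)
    finally show "(\<lambda>n. char (?D n) t) \<longlonglongrightarrow> char std_normal_distribution t"
      by (simp add: char_std_normal_distribution)
  qed
  note conv = weak_conv_imp_continuity_set_conv[OF rd real_dist_normal_dist this]
  let ?A = "{z. c < \<bar>m + sqrt v * z\<bar>}"
  have Ao: "open ?A" by (intro open_Collect_less continuous_intros)
  then have Am: "?A \<in> sets borel" by simp
  have "frontier ?A \<subseteq> {(c - m) / sqrt v, (- c - m) / sqrt v}"
  proof
    fix z assume z: "z \<in> frontier ?A"
    have "closed {z. c \<le> \<bar>m + sqrt v * z\<bar>}" by (intro closed_Collect_le continuous_intros)
    then have "closure ?A \<subseteq> {z. c \<le> \<bar>m + sqrt v * z\<bar>}" by (intro closure_minimal) auto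
    then have "\<bar>m + sqrt v * z\<bar> = c" using z Ao by (auto simp: frontier_def interior_open)
    then have "m + sqrt v * z = c \<or> m + sqrt v * z = - c" by linarith
    then have "z = (c - m) / sqrt v \<or> z = (- c - m) / sqrt v" using v0 by (auto simp: eq_divide_eq algebra_simps)
    then show "z \<in> {(c - m) / sqrt v, (- c - m) / sqrt v}" by simp
  qed
  then have "finite (frontier ?A)" by (rule finite_subset) simp
  then have "frontier ?A \<in> null_sets lborel" by (rule finite_imp_null_set_lborel)
  then have "frontier ?A \<in> null_sets std_normal_distribution"
    using absolutely_continuousI_density[of "\<lambda>x. ennreal (std_normal_density x)" lborel] by (auto simp: absolutely_continuous_def)
  then have "emeasure std_normal_distribution (frontier ?A) = 0" by auto
  from conv[OF Am this] have "(\<lambda>n. measure (?D n) ?A) \<longlonglongrightarrow> two_sided c v m" by (simp add: two_sided_def)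
  moreover have "measure (?D n) ?A = (\<integral>\<omega>. (if c < \<bar>lin_stat k1n k2n n \<omega>\<bar> then 1 else 0) * tilted h1n h2n n \<omega> \<partial>N n)" for n
  proof -
    have "measure (?D n) ?A = (\<integral>x. indicator ?A x \<partial>?D n)" using Am by simp
    also have "\<dots> = (\<integral>\<omega>. indicator ?A (?Z n \<omega>) \<partial>N' n)" using Zm Am by (subst integral_distr) auto
    also have "\<dots> = (\<integral>\<omega>. tilted h1n h2n n \<omega> *\<^sub>R indicator ?A (?Z n \<omega>) \<partial>N n)"
      unfolding N'_def using Am by (intro integral_density) (auto simp: pos)
    also have "\<dots> = (\<integral>\<omega>. (if c < \<bar>lin_stat k1n k2n n \<omega>\<bar> then 1 else 0) * tilted h1n h2n n \<omega> \<partial>N n)"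
      using v0 by (intro Bochner_Integration.integral_cong refl) (auto simp: indicator_def)
    finally show ?thesis .
  qed
  ultimately show ?thesis by (simp add: m_def v_def)
qed

end

text \<open>The multiplier l solves \<open>f c = f (- c)\<close>, that is
  \<open>sinh (a * c) = l * sinh (\<epsilon> * c)\<close>, and \<mu> is the common value at the two
  end points. It is positive because a and \<epsilon> have the same sign; so f is convex, hence at
  most \<mu> between the points of equal height and at least \<mu> outside.\<close>

lemma two_exponentials_separation:
  fixes a \<epsilon> c z :: real
  assumes a\<epsilon>: "0 < a * \<epsilon>" and c: "0 < c"
  defines "\<mu> \<equiv> exp (a * c) + sinh (a * c) / sinh (\<epsilon> * c) * exp (- \<epsilon> * c)"
  shows "0 < sinh (a * c) / sinh (\<epsilon> * c)" "0 < \<mu>"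
    and "\<bar>z\<bar> \<le> c \<Longrightarrow> exp (a * z) + sinh (a * c) / sinh (\<epsilon> * c) * exp (- \<epsilon> * z) \<le> \<mu>"
    and "c < \<bar>z\<bar> \<Longrightarrow> \<mu> \<le> exp (a * z) + sinh (a * c) / sinh (\<epsilon> * c) * exp (- \<epsilon> * z)"
proof -
  define l where "l = sinh (a * c) / sinh (\<epsilon> * c)"
  define f where "f z = exp (a * z) + l * exp (- \<epsilon> * z)" for z
  have \<epsilon>0: "sinh (\<epsilon> * c) \<noteq> 0" using a\<epsilon> c by auto
  show l: "0 < sinh (a * c) / sinh (\<epsilon> * c)"
    using a\<epsilon> c by (auto simp: zero_less_divide_iff zero_less_mult_iff mult_less_0_iff)
  then show "0 < \<mu>" unfolding \<mu>_def by (intro add_pos_pos mult_pos_pos) auto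
  have \<mu>: "\<mu> = f c" by (simp add: \<mu>_def f_def l_def)
  have s: "exp x - exp (- x) = 2 * sinh x" for x :: real by (simp add: sinh_field_def)
  have "f c - f (- c) = (exp (a * c) - exp (- (a * c))) - l * (exp (\<epsilon> * c) - exp (- (\<epsilon> * c)))"
    by (simp add: f_def algebra_simps)
  also have "\<dots> = 2 * sinh (a * c) - l * (2 * sinh (\<epsilon> * c))" unfolding s ..
  also have "\<dots> = 0" using \<epsilon>0 by (simp add: l_def)
  finally have sym: "f (- c) = \<mu>" by (simp add: \<mu>)
  have conv: "convex_on UNIV f"
    unfolding f_def
  proof (intro convex_on_add convex_on_cmul)
    have 1: "convex_on UNIV (\<lambda>x. exp (b * x))" for b :: real
      by (intro convex_on_realI[where f' = "\<lambda>x. b * exp (b * x)"])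
        (auto intro!: derivative_eq_intros, metis exp_le_cancel_iff mult_left_mono mult_left_mono_neg linear)
    show "convex_on UNIV (\<lambda>x. exp (a * x))" "convex_on UNIV (\<lambda>x. exp (- \<epsilon> * x))" by (rule 1)+
    show "0 \<le> l" using l by (simp add: l_def)
  qed
  have between: "f y \<le> max (f x) (f w)" if "x \<le> y" "y \<le> w" "x < w" for x y w
  proof -
    define t where "t = (y - x) / (w - x)"
    have t: "0 \<le> t" "t \<le> 1" using that by (auto simp: t_def divide_le_eq)
    have "t * (w - x) = y - x" using that by (simp add: t_def)
    moreover have "(1 - t) * x + t * w = x + t * (w - x)" by (simp add: algebra_simps)
    ultimately have "y = (1 - t) *\<^sub>R x + t *\<^sub>R w" by simp
    then have "f y \<le> (1 - t) * f x + t * f w"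
      using convex_onD[OF conv t, of x w] by simp
    also have "\<dots> \<le> (1 - t) * max (f x) (f w) + t * max (f x) (f w)"
      using t by (intro add_mono mult_left_mono) auto
    finally show ?thesis by (simp add: algebra_simps)
  qed
  have fz: "exp (a * z) + sinh (a * c) / sinh (\<epsilon> * c) * exp (- \<epsilon> * z) = f z" by (simp add: f_def l_def)
  show "exp (a * z) + sinh (a * c) / sinh (\<epsilon> * c) * exp (- \<epsilon> * z) \<le> \<mu>" if "\<bar>z\<bar> \<le> c"
    unfolding fz using between[of "- c" z c] that c by (simp add: sym \<mu>[symmetric])
  show "\<mu> \<le> exp (a * z) + sinh (a * c) / sinh (\<epsilon> * c) * exp (- \<epsilon> * z)" if "c < \<bar>z\<bar>"
  proof -
    have "\<mu> \<le> f z"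
    proof (rule ccontr)
      assume "\<not> \<mu> \<le> f z"
      then have less: "f z < \<mu>" by simp
      \<comment> \<open>s is the end point far from z and w the near one, so w lies strictly between
        s and z. By convexity a value below \<mu> at z would push \<open>f w\<close> strictly below
        \<mu>.\<close>
      define s where "s = (if 0 < z then - c else c)"
      define w where "w = (if 0 < z then c else - c)"
      have fs: "f s = \<mu>" "f w = \<mu>" by (auto simp: s_def w_def sym \<mu>[symmetric])
      have s: "(s < w \<and> w < z) \<or> (z < w \<and> w < s)" using that c by (auto simp: s_def w_def)
      define t where "t = (w - s) / (z - s)"
      have zs: "z \<noteq> s" using s by auto
      have t: "0 < t" "t \<le> 1" using s by (auto simp: t_def divide_le_eq zero_less_divide_iff)
      have "t * (z - s) = w - s" using zs by (simp add: t_def)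
      moreover have "(1 - t) * s + t * z = s + t * (z - s)" by (simp add: algebra_simps)
      ultimately have "w = (1 - t) *\<^sub>R s + t *\<^sub>R z" by simp
      then have "f w \<le> (1 - t) * f s + t * f z"
        using convex_onD[OF conv, of t s z] t by simp
      also have "\<dots> < (1 - t) * \<mu> + t * \<mu>" using t less fs by simp
      finally show False using fs by (simp add: algebra_simps)
    qed
    then show ?thesis unfolding fz .
  qed
qed

section \<open>Replacing curves by tilts, and the exponential form of the tilts\<close>

context two_sample_design
begin

definition tests :: "(nat \<Rightarrow> (nat \<Rightarrow> 'a) \<times> (nat \<Rightarrow> 'b) \<Rightarrow> real) \<Rightarrow> bool" where
  "tests \<phi> \<longleftrightarrow> (\<forall>n. \<phi> n \<in> borel_measurable (N n) \<and> (\<forall>\<omega>\<in>space (N n). 0 \<le> \<phi> n \<omega> \<and> \<phi> n \<omega> \<le> 1))"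

lemma testsD:
  assumes "tests \<phi>"
  shows "\<phi> n \<in> borel_measurable (N n)" "\<omega> \<in> space (N n) \<Longrightarrow> 0 \<le> \<phi> n \<omega> \<and> \<phi> n \<omega> \<le> 1"
  using assms by (auto simp: tests_def)

definition tilted_power where
  "tilted_power h1n h2n \<phi> n = (\<integral>\<omega>. \<phi> n \<omega> * tilted h1n h2n n \<omega> \<partial>N n)"

text \<open>The Hellinger distances of the factors from their tilts are \<open>o(n\<^sup>-\<^sup>\<onehalf>)\<close>.\<close>

lemma curve_power_tilted_power:
  assumes \<P>: "\<P> \<subseteq> space (prob_algebra M1)" and \<Q>: "\<Q> \<subseteq> space (prob_algebra M2)"
    and P: "L2_differentiable_curve \<P> \<epsilon> P g1" "P 0 = P0" and Q: "L2_differentiable_curve \<Q> \<epsilon> Q g2" "Q 0 = Q0"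
    and t: "t \<longlonglongrightarrow> 0" "(\<lambda>n. t n * sqrt (real n)) \<longlonglongrightarrow> s" "s > 0" "\<And>n. \<bar>t n\<bar> < \<epsilon>"
    and h: "admissible h1n h2n h1 h2"
    and gh: "AE x in P0. h1 x = s * g1 x" "AE y in Q0. h2 y = s * g2 y"
    and \<phi>: "tests \<phi>"
  shows "(\<lambda>n. (\<integral>\<omega>. \<phi> n \<omega> \<partial>two_sample (n1 n) (n2 n) (P (t n)) (Q (t n))) - tilted_power h1n h2n \<phi> n) \<longlonglongrightarrow> 0"
proof -
  note a = h[unfolded admissible_def]
  have a': "L2_array P0 h1n h1" "root_n_bounded h1n" "L2_array Q0 h2n h2" "root_n_bounded h2n" using a by auto
  obtain p where p: "\<And>n. is_density_quotient (P (t n)) P0 (p n)"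
    "(\<lambda>n. real n * measure (P (t n)) {x \<in> space (P (t n)). p n x = \<infinity>}) \<longlonglongrightarrow> 0"
    "(\<lambda>n. real n * (\<integral>x. (2 * (density_root (p n) x - 1) - s * g1 x / sqrt (real n))\<^sup>2 \<partial>P0)) \<longlonglongrightarrow> 0"
    by (rule curve_root_expansion[OF \<P> P t], rule that)
  obtain q where q: "\<And>n. is_density_quotient (Q (t n)) Q0 (q n)"
    "(\<lambda>n. real n * measure (Q (t n)) {x \<in> space (Q (t n)). q n x = \<infinity>}) \<longlonglongrightarrow> 0"
    "(\<lambda>n. real n * (\<integral>x. (2 * (density_root (q n) x - 1) - s * g2 x / sqrt (real n))\<^sup>2 \<partial>Q0)) \<longlonglongrightarrow> 0"
    by (rule curve_root_expansion[OF \<Q> Q t], rule that)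
  have "\<bar>0\<bar> < \<epsilon>" using P(1) by (simp add: L2_differentiable_curve_def)
  then have "P 0 \<in> \<P>" "Q 0 \<in> \<Q>"
    using P(1) Q(1) by (auto simp: L2_differentiable_curve_def simp del: abs_zero)
  then have mem: "P (t n) \<in> space (prob_algebra M1)" "Q (t n) \<in> space (prob_algebra M2)"
      "P0 \<in> space (prob_algebra M1)" "Q0 \<in> space (prob_algebra M2)" for n
    using P Q t(4)[of n] \<P> \<Q> by (auto simp: L2_differentiable_curve_def)
  have Pn: "prob_space (P (t n))" "sets (P (t n)) = sets P0" and Qn: "prob_space (Q (t n))" "sets (Q (t n)) = sets Q0" for n
    using mem(1,2)[of n, THEN prob_algebraD(1)] mem(1,2)[of n, THEN prob_algebraD(2)] mem(3,4)[THEN prob_algebraD(2)] by simp_all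
  have g: "g1 \<in> L2 P0" "g2 \<in> L2 Q0" using P Q by (auto simp: L2_differentiable_curve_def)
  have [measurable]: "g1 \<in> borel_measurable P0" "g2 \<in> borel_measurable Q0" using g by (auto simp: L2_def)
  have [measurable]: "h1 \<in> borel_measurable P0" "h2 \<in> borel_measurable Q0"
    using a' by (auto simp: L2_array_def)
  have tm[measurable]: "tilt P0 h1n n \<in> borel_measurable P0" "tilt Q0 h2n n \<in> borel_measurable Q0" for n
    using P0.integrable_tilt[OF a'(1,2), of n] Q0.integrable_tilt[OF a'(3,4), of n] by auto
  define s1 where "s1 n = measure (P (t n)) {x \<in> space (P (t n)). p n x = \<infinity>}" for n
  define s2 where "s2 n = measure (Q (t n)) {x \<in> space (Q (t n)). q n x = \<infinity>}" for n
  define A1 where "A1 n = (\<integral>x. (2 * (density_root (p n) x - 1) - s * g1 x / sqrt (real n))\<^sup>2 \<partial>P0)" for n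
  define A2 where "A2 n = (\<integral>x. (2 * (density_root (q n) x - 1) - s * g2 x / sqrt (real n))\<^sup>2 \<partial>Q0)" for n
  define B1 where "B1 n = (\<integral>x. (2 * (sqrt (tilt P0 h1n n x) - 1) - s * g1 x / sqrt (real n))\<^sup>2 \<partial>P0)" for n
  define B2 where "B2 n = (\<integral>x. (2 * (sqrt (tilt Q0 h2n n x) - 1) - s * g2 x / sqrt (real n))\<^sup>2 \<partial>Q0)" for n
  define D1 where "D1 n = 1 - (\<integral>x. density_root (p n) x * sqrt (tilt P0 h1n n x) \<partial>P0)" for n
  define D2 where "D2 n = 1 - (\<integral>x. density_root (q n) x * sqrt (tilt Q0 h2n n x) \<partial>Q0)" for n
  have B1: "(\<lambda>n. real n * B1 n) \<longlonglongrightarrow> 0"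
  proof -
    have "B1 n = (\<integral>x. (2 * (sqrt (tilt P0 h1n n x) - 1) - h1 x / sqrt (real n))\<^sup>2 \<partial>P0)" for n
      unfolding B1_def by (rule integral_cong_AE) (use gh(1) in \<open>auto elim!: eventually_mono\<close>)
    then show ?thesis using P0.tilt_root_expansion[OF a'(1,2)] by simp
  qed
  have B2: "(\<lambda>n. real n * B2 n) \<longlonglongrightarrow> 0"
  proof -
    have "B2 n = (\<integral>x. (2 * (sqrt (tilt Q0 h2n n x) - 1) - h2 x / sqrt (real n))\<^sup>2 \<partial>Q0)" for n
      unfolding B2_def by (rule integral_cong_AE) (use gh(2) in \<open>auto elim!: eventually_mono\<close>)
    then show ?thesis using Q0.tilt_root_expansion[OF a'(3,4)] by simp
  qed
  have sg: "(\<lambda>x. s * g1 x / sqrt (real n)) \<in> L2 P0" "(\<lambda>x. s * g2 x / sqrt (real n)) \<in> L2 Q0" for n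
    using L2_scale[OF g(1), of "s / sqrt (real n)"] L2_scale[OF g(2), of "s / sqrt (real n)"] by simp_all
  have D1: "0 \<le> D1 n" "8 * D1 n \<le> 4 * s1 n + 2 * A1 n + 2 * B1 n" for n
    using Hellinger_affinity_bound[OF Pn(1) P0.prob_space_axioms Pn(2) p(1) P0.integrable_tilt[OF a'(1,2)]
        less_imp_le[OF P0.tilt_pos[OF a'(1,2)]] P0.integral_tilt[OF a'(1,2)] sg(1)]
    unfolding D1_def s1_def A1_def B1_def by simp_all
  have D2: "0 \<le> D2 n" "8 * D2 n \<le> 4 * s2 n + 2 * A2 n + 2 * B2 n" for n
    using Hellinger_affinity_bound[OF Qn(1) Q0.prob_space_axioms Qn(2) q(1) Q0.integrable_tilt[OF a'(3,4)]
        less_imp_le[OF Q0.tilt_pos[OF a'(3,4)]] Q0.integral_tilt[OF a'(3,4)] sg(2)]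
    unfolding D2_def s2_def A2_def B2_def by simp_all
  have s0: "0 \<le> s1 n" "0 \<le> s2 n" for n by (auto simp: s1_def s2_def)
  define U where "U n = real n * s1 n + real n * s2 n +
    sqrt (4 * (real n * s1 n) + 2 * (real n * A1 n) + 2 * (real n * B1 n) + (4 * (real n * s2 n) + 2 * (real n * A2 n) + 2 * (real n * B2 n)))" for n
  have U: "U \<longlonglongrightarrow> 0"
  proof -
    have "U \<longlonglongrightarrow> 0 + 0 + sqrt (4 * 0 + 2 * 0 + 2 * 0 + (4 * 0 + 2 * 0 + 2 * 0))"
      unfolding U_def by (intro tendsto_intros B1 B2 p(2)[folded s1_def] q(2)[folded s2_def] p(3)[folded A1_def] q(3)[folded A2_def])
    then show ?thesis by simp
  qed
  show ?thesis
  proof (rule Lim_null_comparison[OF _ U], intro always_eventually allI)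
    fix n
    have "\<bar>(\<integral>\<omega>. \<phi> n \<omega> \<partial>two_sample (n1 n) (n2 n) (P (t n)) (Q (t n))) - tilted_power h1n h2n \<phi> n\<bar> \<le>
      (real (n1 n) * s1 n + real (n2 n) * s2 n) + sqrt (8 * (real (n1 n) * D1 n + real (n2 n) * D2 n))"
      unfolding tilted_power_def tilted_def s1_def s2_def D1_def D2_def
      by (rule two_sample_test_diff_le[OF Pn(1) P0.prob_space_axioms Pn(2) Qn(1) Q0.prob_space_axioms Qn(2) p(1) q(1)
          P0.integrable_tilt[OF a'(1,2)] less_imp_le[OF P0.tilt_pos[OF a'(1,2)]] P0.integral_tilt[OF a'(1,2)]
          Q0.integrable_tilt[OF a'(3,4)] less_imp_le[OF Q0.tilt_pos[OF a'(3,4)]] Q0.integral_tilt[OF a'(3,4)]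
          testsD[OF \<phi>]])
    \<comment> \<open>Both sample sizes are replaced by n, after which every term is n times a
      quantity of order \<open>o(1 / n)\<close>.\<close>
    also have "\<dots> \<le> U n"
    proof -
      have "real (n1 n) * s1 n \<le> real n * s1 n" "real (n2 n) * s2 n \<le> real n * s2 n"
        using sizes_le[of n] s0 by (auto intro!: mult_right_mono)
      moreover have "8 * (real (n1 n) * D1 n + real (n2 n) * D2 n) \<le> real n * (8 * D1 n) + real n * (8 * D2 n)"
        using mult_right_mono[of "real (n1 n)" "real n" "D1 n"] mult_right_mono[of "real (n2 n)" "real n" "D2 n"] sizes_le[of n] D1(1) D2(1)
        by auto
      moreover have "real n * (8 * D1 n) + real n * (8 * D2 n) \<le> real n * (4 * s1 n + 2 * A1 n + 2 * B1 n) + real n * (4 * s2 n + 2 * A2 n + 2 * B2 n)"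
        using D1 D2 by (intro add_mono mult_left_mono) auto
      ultimately show ?thesis unfolding U_def by (intro add_mono real_sqrt_le_mono) (auto simp: algebra_simps)
    qed
    finally show "norm ((\<integral>\<omega>. \<phi> n \<omega> \<partial>two_sample (n1 n) (n2 n) (P (t n)) (Q (t n))) - tilted_power h1n h2n \<phi> n) \<le> U n" by simp
  qed
qed

definition sample_norm :: "(nat \<Rightarrow> 'a \<Rightarrow> real) \<Rightarrow> (nat \<Rightarrow> 'b \<Rightarrow> real) \<Rightarrow> nat \<Rightarrow> real" where
  "sample_norm h1n h2n n = tilt_norm P0 h1n n ^ n1 n * tilt_norm Q0 h2n n ^ n2 n"

lemma sample_norm_pos: "admissible h1n h2n h1 h2 \<Longrightarrow> 0 < sample_norm h1n h2n n"
  unfolding admissible_def sample_norm_def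
  using P0.tilt_norm_pos[of h1n h1 n] Q0.tilt_norm_pos[of h2n h2 n] by simp

text \<open>The normalisers are constants, so the density of a tilted sample is exactly an
  exponential of the linear statistic; there is no remainder as in a local asymptotic
  expansion.\<close>

lemma tilted_eq: "tilted h1n h2n n \<omega> = exp (lin_stat h1n h2n n \<omega>) / sample_norm h1n h2n n"
  unfolding tilted_def sample_prod_def tilt_def sample_norm_def lin_stat_def
  by (simp add: prod_dividef exp_sum[symmetric] exp_add[symmetric] sum_divide_distrib[symmetric] add_divide_distrib)

text \<open>The detour through the complex numbers allows the same limit theorem for powers to be
  used as for characteristic functions.\<close>

lemma sample_norm_limit:
  assumes h: "admissible h1n h2n h1 h2"
  shows "sample_norm h1n h2n \<longlonglongrightarrow> exp (drift h1 h2 h1 h2 / 2)"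
proof -
  have a': "L2_array P0 h1n h1" "root_n_bounded h1n" "L2_array Q0 h2n h2" "root_n_bounded h2n"
    using h by (auto simp: admissible_def)
  let ?M1 = "\<lambda>n. complex_of_real (tilt_norm P0 h1n n)" and ?M2 = "\<lambda>n. complex_of_real (tilt_norm Q0 h2n n)"
  let ?K1 = "complex_of_real ((\<integral>x. (h1 x)\<^sup>2 \<partial>P0) / 2)" and ?K2 = "complex_of_real ((\<integral>x. (h2 x)\<^sup>2 \<partial>Q0) / 2)"
  have M: "(\<lambda>n. real n * (?M1 n - 1)) \<longlonglongrightarrow> ?K1" "(\<lambda>n. real n * (?M2 n - 1)) \<longlonglongrightarrow> ?K2"
    using tendsto_of_real[OF P0.tilt_norm_limit[OF a'(1,2)], where 'a=complex]
      tendsto_of_real[OF Q0.tilt_norm_limit[OF a'(3,4)], where 'a=complex] by simp_all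
  have "(\<lambda>n. ?M1 n ^ n1 n * ?M2 n ^ n2 n) \<longlonglongrightarrow> exp ((1 - d) * ?K1) * exp (d * ?K2)"
    by (intro tendsto_mult power_limit_exp ratio ratio1 M)
  moreover have "exp ((1 - d) * ?K1) * exp (d * ?K2) = complex_of_real (exp (drift h1 h2 h1 h2 / 2))"
    by (simp only: exp_of_real[symmetric] exp_add[symmetric]) (simp add: drift_def power2_eq_square add_divide_distrib)
  moreover have "?M1 n ^ n1 n * ?M2 n ^ n2 n = complex_of_real (sample_norm h1n h2n n)" for n
    by (simp add: sample_norm_def)
  ultimately show ?thesis by (simp only: tendsto_of_real_iff)
qed

lemma lin_stat_add:
  "lin_stat (\<lambda>n x. h1n n x + b * k1n n x) (\<lambda>n y. h2n n y + b * k2n n y) n \<omega> =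
    lin_stat h1n h2n n \<omega> + b * lin_stat k1n k2n n \<omega>"
  by (simp add: lin_stat_def sum.distrib sum_distrib_left[symmetric] add_divide_distrib algebra_simps)

lemma drift_add:
  assumes h: "admissible h1n h2n h1 h2" and k: "admissible k1n k2n k1 k2"
  shows "drift (\<lambda>x. h1 x + b * k1 x) (\<lambda>y. h2 y + b * k2 y) (\<lambda>x. h1 x + b * k1 x) (\<lambda>y. h2 y + b * k2 y) =
    drift h1 h2 h1 h2 + 2 * b * drift h1 h2 k1 k2 + b\<^sup>2 * drift k1 k2 k1 k2"
    and "drift (\<lambda>x. h1 x + b * k1 x) (\<lambda>y. h2 y + b * k2 y) k1 k2 = drift h1 h2 k1 k2 + b * drift k1 k2 k1 k2"
proof -
  have L: "h1 \<in> L2 P0" "k1 \<in> L2 P0" "h2 \<in> L2 Q0" "k2 \<in> L2 Q0"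
    using h k L2_array_L2(1) unfolding admissible_def by auto
  note i = L2_mult_integrable[OF L(1) L(1)] L2_mult_integrable[OF L(1) L(2)] L2_mult_integrable[OF L(2) L(2)]
    L2_mult_integrable[OF L(3) L(3)] L2_mult_integrable[OF L(3) L(4)] L2_mult_integrable[OF L(4) L(4)]
  have 1: "(\<integral>x. (h1 x + b * k1 x) * (h1 x + b * k1 x) \<partial>P0) =
    (\<integral>x. h1 x * h1 x \<partial>P0) + 2 * b * (\<integral>x. h1 x * k1 x \<partial>P0) + b\<^sup>2 * (\<integral>x. k1 x * k1 x \<partial>P0)"
  proof -
    have "(\<integral>x. (h1 x + b * k1 x) * (h1 x + b * k1 x) \<partial>P0) = (\<integral>x. h1 x * h1 x + 2 * b * (h1 x * k1 x) + b\<^sup>2 * (k1 x * k1 x) \<partial>P0)"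
      by (intro Bochner_Integration.integral_cong) (auto simp: power2_eq_square algebra_simps)
    then show ?thesis using i by simp
  qed
  have 2: "(\<integral>x. (h2 x + b * k2 x) * (h2 x + b * k2 x) \<partial>Q0) =
    (\<integral>x. h2 x * h2 x \<partial>Q0) + 2 * b * (\<integral>x. h2 x * k2 x \<partial>Q0) + b\<^sup>2 * (\<integral>x. k2 x * k2 x \<partial>Q0)"
  proof -
    have "(\<integral>x. (h2 x + b * k2 x) * (h2 x + b * k2 x) \<partial>Q0) = (\<integral>x. h2 x * h2 x + 2 * b * (h2 x * k2 x) + b\<^sup>2 * (k2 x * k2 x) \<partial>Q0)"
      by (intro Bochner_Integration.integral_cong) (auto simp: power2_eq_square algebra_simps)
    then show ?thesis using i by simp
  qed
  show "drift (\<lambda>x. h1 x + b * k1 x) (\<lambda>y. h2 y + b * k2 y) (\<lambda>x. h1 x + b * k1 x) (\<lambda>y. h2 y + b * k2 y) =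
    drift h1 h2 h1 h2 + 2 * b * drift h1 h2 k1 k2 + b\<^sup>2 * drift k1 k2 k1 k2"
    unfolding drift_def 1 2 by (simp add: algebra_simps)
  have 3: "(\<integral>x. (h1 x + b * k1 x) * k1 x \<partial>P0) = (\<integral>x. h1 x * k1 x \<partial>P0) + b * (\<integral>x. k1 x * k1 x \<partial>P0)"
    using i by (simp add: distrib_right mult.assoc)
  have 4: "(\<integral>x. (h2 x + b * k2 x) * k2 x \<partial>Q0) = (\<integral>x. h2 x * k2 x \<partial>Q0) + b * (\<integral>x. k2 x * k2 x \<partial>Q0)"
    using i by (simp add: distrib_right mult.assoc)
  show "drift (\<lambda>x. h1 x + b * k1 x) (\<lambda>y. h2 y + b * k2 y) k1 k2 = drift h1 h2 k1 k2 + b * drift k1 k2 k1 k2"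
    unfolding drift_def 3 4 by (simp add: algebra_simps)
qed

end

section \<open>The standard normal distribution\<close>

interpretation std_normal: real_distribution std_normal_distribution
  by (rule real_dist_normal_dist)

text \<open>Differences of the distribution function give half-open intervals, the fundamental
  theorem of calculus closed ones; they differ by a Lebesgue null point.\<close>

lemma std_normal_interval:
  assumes "a \<le> b"
  shows "measure std_normal_distribution {a<..b} = integral {a..b} std_normal_density"
proof -
  have c: "continuous_on {a..b} std_normal_density"
    unfolding std_normal_density_def by (intro continuous_intros) auto
  have i: "set_integrable lborel {a..b} std_normal_density"
    by (rule borel_integrable_atLeastAtMost') (rule c)
  have "emeasure std_normal_distribution {a<..b} = (\<integral>\<^sup>+x. ennreal (indicator {a<..b} x * std_normal_density x) \<partial>lborel)"
    by (subst emeasure_density) (auto intro!: nn_integral_cong simp: indicator_def)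
  also have "\<dots> = (\<integral>\<^sup>+x. ennreal (indicator {a..b} x * std_normal_density x) \<partial>lborel)"
  proof (rule nn_integral_cong_AE)
    show "AE x in lborel. ennreal (indicator {a<..b} x * std_normal_density x) = ennreal (indicator {a..b} x * std_normal_density x)"
      using AE_lborel_singleton[of a]
    proof eventually_elim
      fix x assume "x \<noteq> a"
      then have "(indicator {a<..b} x :: real) = indicator {a..b} x" by (auto simp: indicator_def)
      then show "ennreal (indicator {a<..b} x * std_normal_density x) = ennreal (indicator {a..b} x * std_normal_density x)" by simp
    qed
  qed
  also have "\<dots> = ennreal (\<integral>x. indicator {a..b} x * std_normal_density x \<partial>lborel)"
    using i by (intro nn_integral_eq_integral) (auto simp: set_integrable_def)
  also have "(\<integral>x. indicator {a..b} x * std_normal_density x \<partial>lborel) = integral {a..b} std_normal_density"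
    using set_borel_integral_eq_integral(2)[OF i] by (simp add: set_lebesgue_integral_def)
  finally have "ennreal (measure std_normal_distribution {a<..b}) = ennreal (integral {a..b} std_normal_density)"
    by (simp add: std_normal.emeasure_eq_measure)
  moreover have "0 \<le> integral {a..b} std_normal_density"
    by (intro integral_nonneg integrable_continuous_interval c) simp
  ultimately show ?thesis by (simp add: ennreal_inj)
qed

text \<open>Near x the distribution function is a constant plus the integral of the continuous
  density from \<open>x - 1\<close>, a starting point that keeps x in the interior of the interval
  of integration.\<close>

lemma DERIV_cdf_std_normal: "(cdf std_normal_distribution has_real_derivative std_normal_density x) (at x)"
proof -
  have c: "continuous_on {x - 1..x + 1} std_normal_density"
    unfolding std_normal_density_def by (intro continuous_intros) auto
  have "((\<lambda>y. integral {x - 1..y} std_normal_density) has_real_derivative std_normal_density x) (at x within {x - 1..x + 1})"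
    by (rule integral_has_real_derivative[OF c]) simp
  moreover have "at x within {x - 1..x + 1} = at x"
    by (rule at_within_interior) simp
  ultimately have "((\<lambda>y. integral {x - 1..y} std_normal_density) has_real_derivative std_normal_density x) (at x)" by simp
  then have "((\<lambda>y. cdf std_normal_distribution (x - 1) + integral {x - 1..y} std_normal_density) has_real_derivative 0 + std_normal_density x) (at x)"
    by (intro DERIV_add) auto
  then have D: "((\<lambda>y. cdf std_normal_distribution (x - 1) + integral {x - 1..y} std_normal_density) has_real_derivative std_normal_density x) (at x)"
    by simp
  show ?thesis
  proof (rule has_field_derivative_transform_within_open[OF D, of "{x - 1<..<x + 1}"])
    fix y assume y: "y \<in> {x - 1<..<x + 1}"
    then have "measure std_normal_distribution {x - 1<..y} = cdf std_normal_distribution y - cdf std_normal_distribution (x - 1)"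
      by (subst std_normal.cdf_diff_eq[of "x - 1" y]) auto
    then show "cdf std_normal_distribution (x - 1) + integral {x - 1..y} std_normal_density = cdf std_normal_distribution y"
      using std_normal_interval[of "x - 1" y] y by simp
  qed auto
qed

lemma isCont_cdf_std_normal: "isCont (cdf std_normal_distribution) x"
  using DERIV_cdf_std_normal by (rule DERIV_isCont)

text \<open>Lebesgue measure and the normal density are invariant under reflection, and continuity
  of the distribution function excludes an atom at x.\<close>

lemma cdf_std_normal_minus: "cdf std_normal_distribution (- x) = 1 - cdf std_normal_distribution x"
proof -
  have "emeasure std_normal_distribution {..- x} = (\<integral>\<^sup>+y. ennreal (std_normal_density y) * indicator {..- x} y \<partial>lborel)"
    by (subst emeasure_density) auto
  also have "\<dots> = (\<integral>\<^sup>+y. ennreal (std_normal_density y) * indicator {..- x} y \<partial>distr lborel borel uminus)"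
    by (simp add: lborel_distr_uminus)
  also have "\<dots> = (\<integral>\<^sup>+y. ennreal (std_normal_density (- y)) * indicator {..- x} (- y) \<partial>lborel)"
    by (subst nn_integral_distr) auto
  also have "\<dots> = (\<integral>\<^sup>+y. ennreal (std_normal_density y) * indicator {x..} y \<partial>lborel)"
    by (intro nn_integral_cong) (auto simp: std_normal_density_def indicator_def)
  also have "\<dots> = emeasure std_normal_distribution {x..}"
    by (subst emeasure_density) auto
  finally have "measure std_normal_distribution {..- x} = measure std_normal_distribution {x..}"
    by (simp add: measure_def)
  moreover have "measure std_normal_distribution {x..} = 1 - measure std_normal_distribution {..<x}"
  proof -
    have "{x..} = UNIV - {..<x}" by auto
    then show ?thesis using std_normal.prob_compl[of "{..<x}"] by simp
  qed
  moreover have "measure std_normal_distribution {..<x} = cdf std_normal_distribution x"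
  proof -
    have "measure std_normal_distribution {x} = 0"
      using std_normal.isCont_cdf[of x] isCont_cdf_std_normal by simp
    moreover have "measure std_normal_distribution ({..<x} \<union> {x}) = measure std_normal_distribution {..<x} + measure std_normal_distribution {x}"
      by (intro std_normal.finite_measure_Union) auto
    moreover have "{..<x} \<union> {x} = {..x}" by auto
    ultimately show ?thesis by (simp add: cdf_def)
  qed
  ultimately show ?thesis by (simp add: cdf_def)
qed

text \<open>\<open>inv\<close> returns a preimage as soon as there is one, and the intermediate
  value theorem between the limits 0 and 1 provides it.\<close>

lemma std_normal_quantile:
  assumes "0 < p" "p < 1"
  shows "cdf std_normal_distribution (std_normal_quantile p) = p"
proof -
  have "\<forall>\<^sub>F x in at_bot. cdf std_normal_distribution x < p"
    using order_tendstoD(2)[OF std_normal.cdf_lim_at_bot assms(1)] .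
  then obtain a where a: "\<And>x. x \<le> a \<Longrightarrow> cdf std_normal_distribution x < p"
    by (auto simp: eventually_at_bot_linorder)
  have "\<forall>\<^sub>F x in at_top. p < cdf std_normal_distribution x"
    using order_tendstoD(1)[OF std_normal.cdf_lim_at_top_prob assms(2)] .
  then obtain b where b: "\<And>x. x \<ge> b \<Longrightarrow> p < cdf std_normal_distribution x"
    by (auto simp: eventually_at_top_linorder)
  have "a \<le> max a b" by simp
  then obtain x where "cdf std_normal_distribution x = p"
    using IVT[of "cdf std_normal_distribution" a p "max a b"] a[of a] b[of "max a b"] isCont_cdf_std_normal
    by (auto simp: less_imp_le)
  then have "p \<in> range (cdf std_normal_distribution)" by auto
  then show ?thesis unfolding std_normal_quantile_def by (rule f_inv_into_f)
qed

lemma std_normal_quantile_pos: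
  assumes "1 / 2 < p" "p < 1"
  shows "0 < std_normal_quantile p"
proof (rule ccontr)
  assume "\<not> 0 < std_normal_quantile p"
  then have "cdf std_normal_distribution (std_normal_quantile p) \<le> cdf std_normal_distribution 0"
    by (intro std_normal.cdf_nondecreasing) simp
  moreover have "cdf std_normal_distribution 0 = 1 / 2" using cdf_std_normal_minus[of 0] by simp
  ultimately show False using std_normal_quantile[of p] assms by simp
qed

context two_sample_design
begin

lemma two_sided_cdf:
  assumes v: "0 < v" and c: "0 \<le> c"
  shows "two_sided c v m = 1 - (cdf std_normal_distribution ((c - m) / sqrt v) - cdf std_normal_distribution ((- c - m) / sqrt v))"
proof -
  let ?a = "(- c - m) / sqrt v" and ?b = "(c - m) / sqrt v"
  have s: "0 < sqrt v" using v by simp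
  have ab: "?a \<le> ?b" using s c by (intro divide_right_mono) auto
  have set: "{z. c < \<bar>m + sqrt v * z\<bar>} = UNIV - {?a..?b}"
    using s by (auto simp: divide_le_eq le_divide_eq algebra_simps not_le abs_less_iff abs_if)
  have "measure std_normal_distribution {?a} = 0"
    using std_normal.isCont_cdf[of ?a] isCont_cdf_std_normal by simp
  moreover have "measure std_normal_distribution ({?a} \<union> {?a<..?b}) = measure std_normal_distribution {?a} + measure std_normal_distribution {?a<..?b}"
    by (intro std_normal.finite_measure_Union) auto
  moreover have "{?a} \<union> {?a<..?b} = {?a..?b}" using ab by auto
  moreover have "measure std_normal_distribution {?a<..?b} = cdf std_normal_distribution ?b - cdf std_normal_distribution ?a"
  proof (cases "?a = ?b")
    case False
    then have "?a < ?b" using ab by linarith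
    then show ?thesis using std_normal.cdf_diff_eq[of ?a ?b] by simp
  next
    case True
    then show ?thesis by (simp only:) simp
  qed
  ultimately have "measure std_normal_distribution {?a..?b} = cdf std_normal_distribution ?b - cdf std_normal_distribution ?a"
    by simp
  moreover have "measure std_normal_distribution (UNIV - {?a..?b}) = 1 - measure std_normal_distribution {?a..?b}"
    using std_normal.prob_compl[of "{?a..?b}"] by simp
  ultimately show ?thesis unfolding two_sided_def set by simp
qed

text \<open>Moving m shifts both ends of the acceptance interval by the same amount. At
  \<open>m = 0\<close> the ends are symmetric and the normal density is even, so mass gained at one
  end is lost at the other.\<close>

lemma DERIV_two_sided_0:
  assumes v: "0 < v" and c: "0 \<le> c"
  shows "(two_sided c v has_real_derivative 0) (at 0)"
proof -
  have "((\<lambda>m. 1 - (cdf std_normal_distribution ((c - m) / sqrt v) - cdf std_normal_distribution ((- c - m) / sqrt v)))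
     has_real_derivative 0 - (std_normal_density ((c - 0) / sqrt v) * (- 1 / sqrt v) - std_normal_density ((- c - 0) / sqrt v) * (- 1 / sqrt v))) (at 0)"
    by (intro DERIV_diff DERIV_const DERIV_chain2[OF DERIV_cdf_std_normal] DERIV_cdivide)
      (auto intro!: derivative_eq_intros)
  moreover have "std_normal_density ((- c - 0) / sqrt v) = std_normal_density ((c - 0) / sqrt v)"
    by (simp add: std_normal_density_def power_divide)
  moreover have "two_sided c v = (\<lambda>m. 1 - (cdf std_normal_distribution ((c - m) / sqrt v) - cdf std_normal_distribution ((- c - m) / sqrt v)))"
    by (rule ext) (rule two_sided_cdf[OF v c])
  ultimately show ?thesis by simp
qed

lemma two_sided_0:
  assumes v: "0 < v" and \<alpha>: "0 < \<alpha>" "\<alpha> < 1" and c: "c = std_normal_quantile (1 - \<alpha> / 2) * sqrt v"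
  shows "0 < c" "two_sided c v 0 = \<alpha>"
proof -
  have u: "0 < std_normal_quantile (1 - \<alpha> / 2)" "cdf std_normal_distribution (std_normal_quantile (1 - \<alpha> / 2)) = 1 - \<alpha> / 2"
    using \<alpha> by (auto intro!: std_normal_quantile_pos std_normal_quantile)
  then show c0: "0 < c" using v by (simp add: c)
  have "(c - 0) / sqrt v = std_normal_quantile (1 - \<alpha> / 2)" "(- c - 0) / sqrt v = - std_normal_quantile (1 - \<alpha> / 2)"
    using v by (auto simp: c)
  then show "two_sided c v 0 = \<alpha>"
    using two_sided_cdf[OF v less_imp_le[OF c0], of 0] u by (simp add: cdf_std_normal_minus)
qed

end

section \<open>Affine families of tilts\<close>

text \<open>A line \<open>h + b * k\<close> of directions, with k the direction of interest and h a
  nuisance direction orthogonal to it with respect to \<open>drift\<close>. Orthogonality makes the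
  limiting mean \<open>b * v\<close> of the statistic \<open>S\<close> depend on b alone.\<close>

locale tilt_family = two_sample_design P0 Q0 n1 n2 d
  for P0 :: "'a measure" and Q0 :: "'b measure" and n1 n2 d +
  fixes h1n k1n :: "nat \<Rightarrow> 'a \<Rightarrow> real" and h2n k2n :: "nat \<Rightarrow> 'b \<Rightarrow> real"
    and h1 k1 :: "'a \<Rightarrow> real" and h2 k2 :: "'b \<Rightarrow> real" and v :: real
  assumes h: "admissible h1n h2n h1 h2" and k: "admissible k1n k2n k1 k2"
    and orth: "drift h1 h2 k1 k2 = 0" and v: "drift k1 k2 k1 k2 = v" "0 < v"
begin

abbreviation S :: "nat \<Rightarrow> (nat \<Rightarrow> 'a) \<times> (nat \<Rightarrow> 'b) \<Rightarrow> real" where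
  "S \<equiv> lin_stat k1n k2n"

definition w :: "real \<Rightarrow> nat \<Rightarrow> (nat \<Rightarrow> 'a) \<times> (nat \<Rightarrow> 'b) \<Rightarrow> real" where
  "w b = tilted (\<lambda>n x. h1n n x + b * k1n n x) (\<lambda>n y. h2n n y + b * k2n n y)"

text \<open>The moment generating function of \<open>S n\<close> at b under the density
  \<open>w 0 n\<close>, as integrating \<open>w_eq\<close> shows; hence its Gaussian limit.\<close>

definition r :: "real \<Rightarrow> nat \<Rightarrow> real" where
  "r b n = sample_norm (\<lambda>n x. h1n n x + b * k1n n x) (\<lambda>n y. h2n n y + b * k2n n y) n / sample_norm h1n h2n n"

definition pow :: "(nat \<Rightarrow> (nat \<Rightarrow> 'a) \<times> (nat \<Rightarrow> 'b) \<Rightarrow> real) \<Rightarrow> real \<Rightarrow> nat \<Rightarrow> real" where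
  "pow \<phi> b = tilted_power (\<lambda>n x. h1n n x + b * k1n n x) (\<lambda>n y. h2n n y + b * k2n n y) \<phi>"

lemmas hk = admissible_add[OF h k]

lemma k_arrays: "L2_array P0 k1n k1" "L2_array Q0 k2n k2"
  using k by (auto simp: admissible_def)

lemma S_measurable[measurable]: "S n \<in> borel_measurable (N n)"
  by (rule lin_stat_measurable[OF k_arrays])

lemma w_measurable[measurable]: "w b n \<in> borel_measurable (N n)"
  unfolding w_def using integrable_tilted[OF hk[of b], of n] by auto

lemma w_pos: "0 < w b n \<omega>"
  unfolding w_def by (rule tilted_pos[OF hk])

lemma w_integrable: "integrable (N n) (w b n)" and w_integral: "(\<integral>\<omega>. w b n \<omega> \<partial>N n) = 1"
  unfolding w_def by (rule integrable_tilted[OF hk] integral_tilted[OF hk])+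

lemma r_pos: "0 < r b n"
  unfolding r_def using sample_norm_pos[OF hk[of b], of n] sample_norm_pos[OF h, of n] by simp

lemma w_eq: "r b n * w b n \<omega> = exp (b * S n \<omega>) * w 0 n \<omega>"
  unfolding r_def w_def tilted_eq lin_stat_add
  using sample_norm_pos[OF hk[of b], of n] sample_norm_pos[OF h, of n] by (simp add: exp_add)

lemma r_limit: "r b \<longlonglongrightarrow> exp (b\<^sup>2 * v / 2)"
proof -
  have "r b \<longlonglongrightarrow> exp ((drift h1 h2 h1 h2 + b\<^sup>2 * v) / 2) / exp (drift h1 h2 h1 h2 / 2)"
    unfolding r_def using sample_norm_limit[OF hk[of b]] sample_norm_limit[OF h]
    by (intro tendsto_divide) (simp_all add: drift_add[OF h k] orth v)
  then show ?thesis by (simp add: exp_diff[symmetric] add_divide_distrib)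
qed

lemma pow_eq: "pow \<phi> b n = (\<integral>\<omega>. \<phi> n \<omega> * w b n \<omega> \<partial>N n)"
  by (simp add: pow_def tilted_power_def w_def)

lemma test_integrable: "tests \<phi> \<Longrightarrow> integrable (N n) (\<lambda>\<omega>. \<phi> n \<omega> * w b n \<omega>)"
  unfolding w_def by (intro integrable_test_tilted[OF hk] testsD)

definition two_sided_test :: "real \<Rightarrow> nat \<Rightarrow> (nat \<Rightarrow> 'a) \<times> (nat \<Rightarrow> 'b) \<Rightarrow> real" where
  "two_sided_test c n \<omega> = (if c < \<bar>S n \<omega>\<bar> then 1 else 0)"

lemma two_sided_test: "tests (two_sided_test c)"
  unfolding tests_def two_sided_test_def[abs_def] by auto

lemma two_sided_test_limit: "pow (two_sided_test c) b \<longlonglongrightarrow> two_sided c v (b * v)"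
proof -
  have "(\<lambda>n. \<integral>\<omega>. (if c < \<bar>S n \<omega>\<bar> then 1 else 0) * w b n \<omega> \<partial>N n) \<longlonglongrightarrow> two_sided c v (b * v)"
    unfolding w_def using tilted_two_sided_limit[OF hk[of b] k_arrays, of c] v
    by (simp add: drift_add[OF h k] orth)
  then show ?thesis by (simp add: pow_eq[abs_def] two_sided_test_def)
qed

text \<open>The chi-square distance between neighbouring tilts is explicit, which makes the power
  functions equicontinuous at 0.\<close>

lemma pow_close:
  assumes \<phi>: "tests \<phi>"
  shows "(pow \<phi> b n - pow \<phi> 0 n)\<^sup>2 \<le> r (2 * b) n / (r b n)\<^sup>2 - 1"
proof -
  have rb: "r b n \<noteq> 0" using r_pos[of b n] by simp
  let ?D = "\<lambda>\<omega>. exp (b * S n \<omega>) / r b n - 1"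
  have wb: "w b n \<omega> = exp (b * S n \<omega>) / r b n * w 0 n \<omega>" for \<omega>
    using w_eq[of b n \<omega>] rb by (simp add: field_simps)
  \<comment> \<open>The square stays within the family: \<open>exp (2 * b * S)\<close> times
    \<open>w 0\<close> is a multiple of \<open>w (2 * b)\<close>, with factor
    \<open>r (2 * b)\<close>. This makes the integral explicit.\<close>
  have D2: "(?D \<omega>)\<^sup>2 * w 0 n \<omega> = r (2 * b) n / (r b n)\<^sup>2 * w (2 * b) n \<omega> - 2 * w b n \<omega> + w 0 n \<omega>" for \<omega>
  proof -
    have "(?D \<omega>)\<^sup>2 * w 0 n \<omega> = exp (2 * b * S n \<omega>) * w 0 n \<omega> / (r b n)\<^sup>2 - 2 * (exp (b * S n \<omega>) / r b n * w 0 n \<omega>) + w 0 n \<omega>"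
      by (simp add: power2_diff power_divide exp_double[symmetric] algebra_simps)
    then show ?thesis unfolding wb[symmetric] using w_eq[of "2 * b" n \<omega>] by (simp add: mult.assoc)
  qed
  have D2i: "integrable (N n) (\<lambda>\<omega>. (?D \<omega>)\<^sup>2 * w 0 n \<omega>)"
    and D2I: "(\<integral>\<omega>. (?D \<omega>)\<^sup>2 * w 0 n \<omega> \<partial>N n) = r (2 * b) n / (r b n)\<^sup>2 - 1"
    unfolding D2 using w_integrable[of n] w_integral[where n=n] by auto
  have sq: "(sqrt (w 0 n \<omega>))\<^sup>2 = w 0 n \<omega>" for \<omega> using w_pos[of 0 n \<omega>] by simp
  let ?f = "\<lambda>\<omega>. \<phi> n \<omega> * sqrt (w 0 n \<omega>)" and ?g = "\<lambda>\<omega>. ?D \<omega> * sqrt (w 0 n \<omega>)"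
  note \<phi>m[measurable] = testsD(1)[OF \<phi>, of n]
  have s: "(\<lambda>\<omega>. sqrt (w 0 n \<omega>)) \<in> L2 (N n)" using w_integrable[of n 0] by (simp add: L2_def sq)
  have f: "?f \<in> L2 (N n)"
    by (rule L2_bound[OF s]) (use testsD(2)[OF \<phi>] w_pos[of 0 n] in \<open>auto simp: abs_mult intro!: AE_I2 mult_left_le_one_le\<close>)
  have g: "?g \<in> L2 (N n)" using D2i by (simp add: L2_def power_mult_distrib sq)
  have f1: "(\<integral>\<omega>. (?f \<omega>)\<^sup>2 \<partial>N n) \<le> 1"
  proof -
    have "(\<integral>\<omega>. (?f \<omega>)\<^sup>2 \<partial>N n) \<le> (\<integral>\<omega>. w 0 n \<omega> \<partial>N n)"
    proof (rule integral_mono[OF L2_square_integrable[OF f] w_integrable])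
      fix \<omega> assume "\<omega> \<in> space (N n)"
      then have "(\<phi> n \<omega>)\<^sup>2 \<le> 1" using testsD(2)[OF \<phi>, of \<omega> n] by (simp add: power_le_one)
      then show "(?f \<omega>)\<^sup>2 \<le> w 0 n \<omega>" using w_pos[of 0 n \<omega>] by (simp add: power_mult_distrib sq mult_left_le_one_le)
    qed
    then show ?thesis by (simp add: w_integral)
  qed
  have "pow \<phi> b n - pow \<phi> 0 n = (\<integral>\<omega>. \<phi> n \<omega> * w b n \<omega> - \<phi> n \<omega> * w 0 n \<omega> \<partial>N n)"
    unfolding pow_eq using test_integrable[OF \<phi>] by simp
  also have "\<dots> = (\<integral>\<omega>. ?f \<omega> * ?g \<omega> \<partial>N n)"
  proof (intro Bochner_Integration.integral_cong refl)
    fix \<omega>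
    have "?f \<omega> * ?g \<omega> = \<phi> n \<omega> * ?D \<omega> * (sqrt (w 0 n \<omega>))\<^sup>2" by (simp add: power2_eq_square)
    then show "\<phi> n \<omega> * w b n \<omega> - \<phi> n \<omega> * w 0 n \<omega> = ?f \<omega> * ?g \<omega>"
      unfolding sq wb by (simp add: algebra_simps)
  qed
  finally have "(pow \<phi> b n - pow \<phi> 0 n)\<^sup>2 \<le> (\<integral>\<omega>. (?f \<omega>)\<^sup>2 \<partial>N n) * (\<integral>\<omega>. (?g \<omega>)\<^sup>2 \<partial>N n)"
    using Cauchy_Schwarz_integral[OF f g] by simp
  also have "\<dots> \<le> 1 * (\<integral>\<omega>. (?g \<omega>)\<^sup>2 \<partial>N n)" by (intro mult_right_mono f1) simp
  also have "\<dots> = r (2 * b) n / (r b n)\<^sup>2 - 1" by (simp add: power_mult_distrib sq D2I)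
  finally show ?thesis .
qed

text \<open>The lower bound \<alpha> is given only off 0. The gap between the powers at b and at 0
  is controlled, uniformly over tests, by a quantity with limit
  \<open>exp (b\<^sup>2 * v) - 1\<close>, so a small b carries the bound over to 0.\<close>

lemma pow_0_lower:
  assumes \<phi>: "tests \<phi>" and unbiased: "\<And>b e. b \<noteq> 0 \<Longrightarrow> 0 < e \<Longrightarrow> \<forall>\<^sub>F n in sequentially. \<alpha> - e < pow \<phi> b n"
    and e: "0 < e"
  shows "\<forall>\<^sub>F n in sequentially. \<alpha> - e < pow \<phi> 0 n"
proof -
  have "((\<lambda>b. exp (b\<^sup>2 * v) - 1) \<longlongrightarrow> exp (0\<^sup>2 * v) - 1) (at (0::real))" by (intro tendsto_intros)
  then have "\<forall>\<^sub>F b in at 0. exp (b\<^sup>2 * v) - 1 < (e / 2)\<^sup>2"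
    using e by (intro order_tendstoD(2)) auto
  then obtain b where b: "b \<noteq> 0" "exp (b\<^sup>2 * v) - 1 < (e / 2)\<^sup>2"
    using eventually_happens[of _ "at (0::real)"] eventually_conj[OF _ eventually_neq_at_within[of 0 0 UNIV]]
    by (metis (mono_tags, lifting) at_neq_bot trivial_limit_def)
  have "(\<lambda>n. r (2 * b) n / (r b n)\<^sup>2 - 1) \<longlonglongrightarrow> exp ((2 * b)\<^sup>2 * v / 2) / (exp (b\<^sup>2 * v / 2))\<^sup>2 - 1"
    by (intro tendsto_intros r_limit) simp
  \<comment> \<open>Up to the summand 1 this is the chi-square divergence of two normal laws with
    variance v and means \<open>b * v\<close> and 0.\<close>
  also have "exp ((2 * b)\<^sup>2 * v / 2) / (exp (b\<^sup>2 * v / 2))\<^sup>2 = exp (b\<^sup>2 * v)"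
    by (simp add: exp_double[symmetric] exp_diff[symmetric] power_mult_distrib)
  finally have "\<forall>\<^sub>F n in sequentially. r (2 * b) n / (r b n)\<^sup>2 - 1 < (e / 2)\<^sup>2"
    using b by (intro order_tendstoD(2)) auto
  moreover have "\<forall>\<^sub>F n in sequentially. \<alpha> - e / 2 < pow \<phi> b n" using unbiased[OF b(1), of "e / 2"] e by simp
  ultimately show ?thesis
  proof eventually_elim
    fix n assume 1: "r (2 * b) n / (r b n)\<^sup>2 - 1 < (e / 2)\<^sup>2" and 2: "\<alpha> - e / 2 < pow \<phi> b n"
    have "\<bar>pow \<phi> b n - pow \<phi> 0 n\<bar>\<^sup>2 < (e / 2)\<^sup>2" using pow_close[OF \<phi>, of b n] 1 by simp
    then have "\<bar>pow \<phi> b n - pow \<phi> 0 n\<bar> < e / 2" by (rule power2_less_imp_less) (use e in simp)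
    then show "\<alpha> - e < pow \<phi> 0 n" using 2 by linarith
  qed
qed

text \<open>Integrate \<open>(\<psi> - \<phi>) * (exp (a * z) + l * exp (- \<epsilon> * z) - \<mu>)
  \<ge> 0\<close> against \<open>w 0\<close>: both factors are nonnegative where \<psi> rejects and
  nonpositive where it accepts. The constants r turn the exponentials into tilts, so the inequality
  is exact for every n.\<close>

lemma two_sided_test_inequality:
  assumes \<phi>: "tests \<phi>" and a\<epsilon>: "0 < a * \<epsilon>" and c: "0 < c"
  defines "l \<equiv> sinh (a * c) / sinh (\<epsilon> * c)"
  defines "\<mu> \<equiv> exp (a * c) + l * exp (- \<epsilon> * c)"
  shows "0 \<le> r a n * (pow (two_sided_test c) a n - pow \<phi> a n)
    + l * r (- \<epsilon>) n * (pow (two_sided_test c) (- \<epsilon>) n - pow \<phi> (- \<epsilon>) n)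
    - \<mu> * (pow (two_sided_test c) 0 n - pow \<phi> 0 n)"
proof -
  note sep = two_exponentials_separation[OF a\<epsilon> c, folded l_def, folded \<mu>_def]
  let ?\<psi> = "two_sided_test c"
  let ?F = "\<lambda>\<omega>. r a n * (?\<psi> n \<omega> * w a n \<omega> - \<phi> n \<omega> * w a n \<omega>)
    + l * r (- \<epsilon>) n * (?\<psi> n \<omega> * w (- \<epsilon>) n \<omega> - \<phi> n \<omega> * w (- \<epsilon>) n \<omega>)
    - \<mu> * (?\<psi> n \<omega> * w 0 n \<omega> - \<phi> n \<omega> * w 0 n \<omega>)"
  have "0 \<le> (\<integral>\<omega>. ?F \<omega> \<partial>N n)"
  proof (intro integral_nonneg_AE AE_I2)
    fix \<omega> assume \<omega>: "\<omega> \<in> space (N n)"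
    define z where "z = S n \<omega>"
    have "?F \<omega> = (?\<psi> n \<omega> - \<phi> n \<omega>) * ((r a n * w a n \<omega>) + l * (r (- \<epsilon>) n * w (- \<epsilon>) n \<omega>) - \<mu> * w 0 n \<omega>)"
      by (simp add: algebra_simps)
    also have "\<dots> = (?\<psi> n \<omega> - \<phi> n \<omega>) * (exp (a * z) + l * exp (- \<epsilon> * z) - \<mu>) * w 0 n \<omega>"
      unfolding w_eq z_def by (simp add: algebra_simps)
    also have "\<dots> \<ge> 0"
    proof (rule mult_nonneg_nonneg[OF _ less_imp_le[OF w_pos]])
      show "0 \<le> (?\<psi> n \<omega> - \<phi> n \<omega>) * (exp (a * z) + l * exp (- \<epsilon> * z) - \<mu>)"
      proof (cases "c < \<bar>z\<bar>")
        case True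
        then show ?thesis using sep(4)[of z] testsD(2)[OF \<phi> \<omega>]
          by (intro mult_nonneg_nonneg) (auto simp: two_sided_test_def z_def)
      next
        case False
        then show ?thesis using sep(3)[of z] testsD(2)[OF \<phi> \<omega>]
          by (intro mult_nonpos_nonpos) (auto simp: two_sided_test_def z_def)
      qed
    qed
    finally show "0 \<le> ?F \<omega>" .
  qed
  also have "(\<integral>\<omega>. ?F \<omega> \<partial>N n) = r a n * (pow ?\<psi> a n - pow \<phi> a n)
    + l * r (- \<epsilon>) n * (pow ?\<psi> (- \<epsilon>) n - pow \<phi> (- \<epsilon>) n) - \<mu> * (pow ?\<psi> 0 n - pow \<phi> 0 n)"
    unfolding pow_eq using test_integrable[OF \<phi>, of n] test_integrable[OF two_sided_test[of c], where n=n]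
    by simp
  finally show ?thesis .
qed

text \<open>The multiplier of the constraint at \<open>- \<epsilon>\<close> grows only like \<open>1 / \<epsilon>\<close>, whereas the power of the
  two-sided test is flat at 0.\<close>

lemma multiplier_limit:
  assumes c: "0 < c" and \<alpha>: "two_sided c v 0 = \<alpha>"
  shows "((\<lambda>\<epsilon>. sinh (a * c) / sinh (\<epsilon> * c) * exp ((\<epsilon>\<^sup>2 - a\<^sup>2) * v / 2) * (two_sided c v (- \<epsilon> * v) - \<alpha>)) \<longlongrightarrow> 0) (at 0)"
proof -
  have "((\<lambda>\<epsilon>. (two_sided c v (- \<epsilon> * v))) has_real_derivative 0 * (- v)) (at 0)"
    using DERIV_two_sided_0[OF v(2) less_imp_le[OF c]]
    by (intro DERIV_chain2[where f="two_sided c v"]) (auto intro!: derivative_eq_intros)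
  then have 1: "((\<lambda>\<epsilon>. (two_sided c v (- \<epsilon> * v) - \<alpha>) / \<epsilon>) \<longlongrightarrow> 0) (at 0)"
    by (simp add: has_field_derivative_iff \<alpha>)
  have "((\<lambda>\<epsilon>. sinh (\<epsilon> * c)) has_real_derivative cosh (0 * c) * c) (at 0)"
    by (auto intro!: derivative_eq_intros)
  then have "((\<lambda>\<epsilon>. sinh (\<epsilon> * c) / \<epsilon>) \<longlongrightarrow> c) (at 0)"
    by (simp add: has_field_derivative_iff)
  then have 2: "((\<lambda>\<epsilon>. sinh (a * c) / (sinh (\<epsilon> * c) / \<epsilon>)) \<longlongrightarrow> sinh (a * c) / c) (at 0)"
    using c by (intro tendsto_intros) auto
  have 3: "((\<lambda>\<epsilon>. exp ((\<epsilon>\<^sup>2 - a\<^sup>2) * v / 2)) \<longlongrightarrow> exp ((0\<^sup>2 - a\<^sup>2) * v / 2)) (at (0::real))"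
    by (intro tendsto_intros) auto
  \<comment> \<open>The pole is balanced by dividing both \<open>sinh (\<epsilon> * c)\<close> and
    the power difference by \<epsilon>: the first quotient tends to \<open>c\<close>, which is
    nonzero, the second to 0.\<close>
  have "((\<lambda>\<epsilon>. sinh (a * c) / (sinh (\<epsilon> * c) / \<epsilon>) * exp ((\<epsilon>\<^sup>2 - a\<^sup>2) * v / 2) * ((two_sided c v (- \<epsilon> * v) - \<alpha>) / \<epsilon>))
      \<longlongrightarrow> sinh (a * c) / c * exp ((0\<^sup>2 - a\<^sup>2) * v / 2) * 0) (at 0)"
    by (intro tendsto_mult 1 2 3)
  then have "((\<lambda>\<epsilon>. sinh (a * c) / (sinh (\<epsilon> * c) / \<epsilon>) * exp ((\<epsilon>\<^sup>2 - a\<^sup>2) * v / 2) * ((two_sided c v (- \<epsilon> * v) - \<alpha>) / \<epsilon>)) \<longlongrightarrow> 0) (at 0)"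
    by simp
  then show ?thesis
    by (rule Lim_transform_eventually) (auto simp: eventually_at_filter)
qed

text \<open>For fixed \<epsilon> the bounds \<open>\<alpha> - \<delta>\<close> at
  \<open>- \<epsilon>\<close> and \<open>\<alpha> + \<delta>\<close> at 0 are inserted into the
  inequality for finite n, which is divided by \<open>r a n\<close> before n tends to infinity. The
  excess over the power of the two-sided test consists of the multiplier term, below
  \<open>e / 2\<close> for a suitable \<epsilon>, and of
  \<open>K * \<delta> = e / 4\<close>.\<close>

lemma pow_upper:
  assumes \<phi>: "tests \<phi>" and unbiased: "\<And>b e. b \<noteq> 0 \<Longrightarrow> 0 < e \<Longrightarrow> \<forall>\<^sub>F n in sequentially. \<alpha> - e < pow \<phi> b n"
    and level: "\<And>e. 0 < e \<Longrightarrow> \<forall>\<^sub>F n in sequentially. pow \<phi> 0 n < \<alpha> + e"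
    and c: "0 < c" and \<alpha>: "two_sided c v 0 = \<alpha>" and a: "a \<noteq> 0" and e: "0 < e"
  shows "\<forall>\<^sub>F n in sequentially. pow \<phi> a n < two_sided c v (a * v) + e"
proof -
  let ?L = "\<lambda>\<epsilon>. sinh (a * c) / sinh (\<epsilon> * c)"
  let ?m = "\<lambda>\<epsilon>. ?L \<epsilon> * exp ((\<epsilon>\<^sup>2 - a\<^sup>2) * v / 2)"
  have "\<exists>\<epsilon>. 0 < a * \<epsilon> \<and> ?m \<epsilon> * (two_sided c v (- \<epsilon> * v) - \<alpha>) < e / 2"
  proof -
    have "\<forall>\<^sub>F \<epsilon> in at 0. ?m \<epsilon> * (two_sided c v (- \<epsilon> * v) - \<alpha>) < e / 2"
      using order_tendstoD(2)[OF multiplier_limit[OF c \<alpha>, of a], of "e / 2"] e by simp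
    then obtain \<rho> where \<rho>: "0 < \<rho>" "\<And>x. x \<noteq> 0 \<Longrightarrow> \<bar>x\<bar> < \<rho> \<Longrightarrow> ?m x * (two_sided c v (- x * v) - \<alpha>) < e / 2"
      by (auto simp: eventually_at dist_real_def)
    \<comment> \<open>\<epsilon> takes the sign of a, which puts the auxiliary point
      \<open>- \<epsilon>\<close> on the opposite side of 0.\<close>
    have "a * (sgn a * (\<rho> / 2)) = \<bar>a\<bar> * (\<rho> / 2)" by (simp add: sgn_if)
    also have "0 < \<bar>a\<bar> * (\<rho> / 2)" using \<rho>(1) a by simp
    finally have "0 < a * (sgn a * (\<rho> / 2))" .
    moreover have "\<bar>sgn a * (\<rho> / 2)\<bar> < \<rho>" "sgn a * (\<rho> / 2) \<noteq> 0"
      using \<rho>(1) a by (auto simp: abs_mult sgn_zero_iff)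
    ultimately show ?thesis using \<rho>(2) by blast
  qed
  then obtain \<epsilon> where \<epsilon>: "0 < a * \<epsilon>" "?m \<epsilon> * (two_sided c v (- \<epsilon> * v) - \<alpha>) < e / 2" by blast
  define l where "l = ?L \<epsilon>"
  define \<mu> where "\<mu> = exp (a * c) + l * exp (- \<epsilon> * c)"
  have l: "0 < l" and \<mu>: "0 < \<mu>"
    using two_exponentials_separation(1,2)[OF \<epsilon>(1) c] by (auto simp: l_def \<mu>_def)
  note ineq = two_sided_test_inequality[OF \<phi> \<epsilon>(1) c, folded l_def, folded \<mu>_def]
  \<comment> \<open>The limit of the total factor with which the slack \<delta> of the two
    constraints enters after division by \<open>r a n\<close>.\<close>
  define K where "K = l * exp ((\<epsilon>\<^sup>2 - a\<^sup>2) * v / 2) + \<mu> * exp (- (a\<^sup>2 * v / 2))"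
  have K: "0 < K" unfolding K_def using l \<mu> by (intro add_pos_pos mult_pos_pos) auto
  define \<delta> where "\<delta> = e / (4 * K)"
  have \<delta>: "0 < \<delta>" using e K by (simp add: \<delta>_def)
  let ?\<psi> = "two_sided_test c"
  let ?B = "\<lambda>n. pow ?\<psi> a n + l * r (- \<epsilon>) n / r a n * (pow ?\<psi> (- \<epsilon>) n - \<alpha> + \<delta>) - \<mu> / r a n * (pow ?\<psi> 0 n - \<alpha> - \<delta>)"
  have "?B \<longlonglongrightarrow> two_sided c v (a * v) + l * exp ((- \<epsilon>)\<^sup>2 * v / 2) / exp (a\<^sup>2 * v / 2) * (two_sided c v (- \<epsilon> * v) - \<alpha> + \<delta>)
      - \<mu> / exp (a\<^sup>2 * v / 2) * (two_sided c v (0 * v) - \<alpha> - \<delta>)"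
    by (intro tendsto_intros r_limit two_sided_test_limit) auto
  also have "two_sided c v (a * v) + l * exp ((- \<epsilon>)\<^sup>2 * v / 2) / exp (a\<^sup>2 * v / 2) * (two_sided c v (- \<epsilon> * v) - \<alpha> + \<delta>)
      - \<mu> / exp (a\<^sup>2 * v / 2) * (two_sided c v (0 * v) - \<alpha> - \<delta>) =
      two_sided c v (a * v) + ?m \<epsilon> * (two_sided c v (- \<epsilon> * v) - \<alpha>) + K * \<delta>"
  proof -
    have 1: "exp ((\<epsilon>\<^sup>2 - a\<^sup>2) * v / 2) = exp ((- \<epsilon>)\<^sup>2 * v / 2) / exp (a\<^sup>2 * v / 2)"
      by (simp add: exp_diff[symmetric] left_diff_distrib diff_divide_distrib)
    have 2: "exp (- (a\<^sup>2 * v / 2)) = 1 / exp (a\<^sup>2 * v / 2)" by (simp add: exp_minus inverse_eq_divide)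
    show ?thesis unfolding K_def 1 2 l_def[symmetric]
      by (simp add: \<alpha> algebra_simps add_divide_distrib diff_divide_distrib)
  qed
  also have "K * \<delta> = e / 4" using K by (simp add: \<delta>_def)
  finally have B: "\<forall>\<^sub>F n in sequentially. ?B n < two_sided c v (a * v) + e"
    using \<epsilon>(2) e by (intro order_tendstoD(2)) auto
  have neg: "- \<epsilon> \<noteq> 0" using \<epsilon>(1) by auto
  show ?thesis
    using B unbiased[OF neg \<delta>] level[OF \<delta>]
  proof eventually_elim
    fix n assume B: "?B n < two_sided c v (a * v) + e" and lo: "\<alpha> - \<delta> < pow \<phi> (- \<epsilon>) n" and hi: "pow \<phi> 0 n < \<alpha> + \<delta>"
    have ra: "0 < r a n" "0 < r (- \<epsilon>) n" by (rule r_pos)+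
    have "r a n * pow \<phi> a n \<le> r a n * pow ?\<psi> a n + l * r (- \<epsilon>) n * (pow ?\<psi> (- \<epsilon>) n - pow \<phi> (- \<epsilon>) n)
        - \<mu> * (pow ?\<psi> 0 n - pow \<phi> 0 n)"
      using ineq[of n] by (simp add: right_diff_distrib)
    also have "\<dots> \<le> r a n * pow ?\<psi> a n + l * r (- \<epsilon>) n * (pow ?\<psi> (- \<epsilon>) n - \<alpha> + \<delta>) - \<mu> * (pow ?\<psi> 0 n - \<alpha> - \<delta>)"
    proof -
      have "l * r (- \<epsilon>) n * (pow ?\<psi> (- \<epsilon>) n - pow \<phi> (- \<epsilon>) n) \<le> l * r (- \<epsilon>) n * (pow ?\<psi> (- \<epsilon>) n - \<alpha> + \<delta>)"
        using lo l ra by (intro mult_left_mono) auto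
      moreover have "\<mu> * (pow ?\<psi> 0 n - \<alpha> - \<delta>) \<le> \<mu> * (pow ?\<psi> 0 n - pow \<phi> 0 n)"
        by (rule mult_left_mono) (use hi \<mu> in linarith)+
      ultimately show ?thesis by linarith
    qed
    also have "\<dots> = r a n * ?B n" using ra by (simp add: field_simps)
    finally have "pow \<phi> a n \<le> ?B n" using ra by simp
    then show "pow \<phi> a n < two_sided c v (a * v) + e" using B by simp
  qed
qed

end

section \<open>Implicit alternatives and hypotheses\<close>

text \<open>Averaging over the second coordinate removes the centred component \<open>g2\<close>.
  With its counterpart for the second factor this is the uniqueness of additive
  decompositions.\<close>

lemma (in pair_prob_space) partial_fst_sum:
  assumes g: "g \<in> borel_measurable (M1 \<Otimes>\<^sub>M M2)" and g1: "g1 \<in> borel_measurable M1" and g2: "g2 \<in> L2_0 M2"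
    and eq: "AE z in M1 \<Otimes>\<^sub>M M2. g z = g1 (fst z) + g2 (snd z)"
  shows "AE x in M1. partial_fst g x = g1 x"
  using AE_pair[OF eq] AE_space
proof eventually_elim
  fix x assume ae: "AE y in M2. g (x, y) = g1 (fst (x, y)) + g2 (snd (x, y))" and x: "x \<in> space M1"
  have i: "integrable M2 g2" "(\<integral>y. g2 y \<partial>M2) = 0" using g2 M2.L2_integrable by (auto simp: L2_0_def)
  have [measurable]: "(\<lambda>y. g (x, y)) \<in> borel_measurable M2" using measurable_Pair2[OF g x] .
  have "partial_fst g x = (\<integral>y. g1 x + g2 y \<partial>M2)"
    unfolding partial_fst_def by (rule integral_cong_AE) (use ae i in auto)
  also have "\<dots> = g1 x" using i by (simp add: M2.prob_space)
  finally show "partial_fst g x = g1 x" .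
qed

lemma (in pair_prob_space) partial_snd_sum:
  assumes g: "g \<in> borel_measurable (M1 \<Otimes>\<^sub>M M2)" and g1: "g1 \<in> L2_0 M1" and g2: "g2 \<in> borel_measurable M2"
    and eq: "AE z in M1 \<Otimes>\<^sub>M M2. g z = g1 (fst z) + g2 (snd z)"
  shows "AE y in M2. partial_snd g y = g2 y"
proof -
  have [measurable]: "g1 \<in> borel_measurable M1" using g1 by (simp add: L2_0_def L2_def)
  note g[measurable] g2[measurable]
  have "AE x in M1. AE y in M2. g (x, y) = g1 x + g2 y" using AE_pair[OF eq] by simp
  then have "AE y in M2. AE x in M1. g (x, y) = g1 x + g2 y"
    by (subst AE_commute[symmetric]) simp_all
  then show ?thesis using AE_space
  proof eventually_elim
    fix y assume ae: "AE x in M1. g (x, y) = g1 x + g2 y" and y: "y \<in> space M2"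
    have i: "integrable M1 g1" "(\<integral>x. g1 x \<partial>M1) = 0" using g1 M1.L2_integrable by (auto simp: L2_0_def)
    have [measurable]: "(\<lambda>x. g (x, y)) \<in> borel_measurable M1" using measurable_Pair1[OF g y] .
    have "partial_snd g y = (\<integral>x. g1 x + g2 y \<partial>M1)"
      unfolding partial_snd_def by (rule integral_cong_AE) (use ae i in auto)
    also have "\<dots> = g2 y" using i by (simp add: M1.prob_space)
    finally show "partial_snd g y = g2 y" .
  qed
qed

text \<open>Once the cone equals its closed span, membership of two-term combinations makes the cone
  itself a linear space.\<close>

lemma linear_span_subset_tangent_space:
  assumes K: "tangent_cone R \<R> \<subseteq> L2 R" and g: "g \<in> tangent_cone R \<R>" "h \<in> tangent_cone R \<R>"
  shows "(\<lambda>x. a * g x + b * h x) \<in> tangent_space R \<R>"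
  unfolding tangent_space_def L2_closure_def
proof (intro CollectI conjI allI impI)
  let ?f = "\<lambda>x. a * g x + b * h x"
  show "?f \<in> L2 R" using K g by (intro L2_add L2_scale) auto
  fix e :: real assume e: "0 < e"
  have "?f \<in> linear_span (tangent_cone R \<R>)"
  \<comment> \<open>The span is formed from finite sets of functions, so two equal functions must be
    merged into one with coefficient \<open>a + b\<close>.\<close>
  proof (cases "g = h")
    case True
    show ?thesis unfolding linear_span_def
      by (intro CollectI exI[of _ "{g}"] exI[of _ "\<lambda>_. a + b"]) (use g True in \<open>auto simp: algebra_simps\<close>)
  next
    case False
    show ?thesis unfolding linear_span_def
      by (intro CollectI exI[of _ "{g, h}"] exI[of _ "\<lambda>f. if f = g then a else b"]) (use g False in auto)
  qed
  moreover have "L2_norm R (\<lambda>x. ?f x - ?f x) < e" using e by (simp add: L2_norm_def)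
  ultimately show "\<exists>h\<in>linear_span (tangent_cone R \<R>). L2_norm R (\<lambda>x. ?f x - h x) < e"
    by (rule bexI[where x="?f", rotated])
qed

text \<open>Tangents are functions rather than classes. The rescaled gradient is assembled from
  given components that agree with those of a tangent only almost everywhere, so membership has to
  survive changes on null sets.\<close>

lemma tangent_space_cong_AE:
  assumes g: "g \<in> tangent_space R \<R>" and f: "f \<in> borel_measurable R" and eq: "AE x in R. f x = g x"
    and S: "tangent_cone R \<R> \<subseteq> L2 R"
  shows "f \<in> tangent_space R \<R>"
  unfolding tangent_space_def L2_closure_def
proof (intro CollectI conjI allI impI)
  have gL: "g \<in> L2 R" using g by (simp add: tangent_space_def L2_closure_def)
  then show "f \<in> L2 R" using f eq by (rule L2_cong_AE)
  fix e :: real assume "0 < e"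
  then obtain h where h: "h \<in> linear_span (tangent_cone R \<R>)" "L2_norm R (\<lambda>x. g x - h x) < e"
    using g by (auto simp: tangent_space_def L2_closure_def)
  have hm: "h \<in> borel_measurable R"
    using h(1) S by (auto simp: linear_span_def L2_def intro!: borel_measurable_sum borel_measurable_times)
  have "(\<integral>x. (f x - h x)\<^sup>2 \<partial>R) = (\<integral>x. (g x - h x)\<^sup>2 \<partial>R)"
    by (rule integral_cong_AE) (use f gL hm eq in \<open>auto simp: L2_def elim!: eventually_mono\<close>)
  then show "\<exists>h\<in>linear_span (tangent_cone R \<R>). L2_norm R (\<lambda>x. f x - h x) < e"
    using h by (auto simp: L2_norm_def intro!: bexI[of _ h])
qed

section \<open>Limits inferior and superior as eventual inequalities, and their transfer\<close>

lemma ereal_liminf_ge_iff: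
  "ereal a \<le> liminf (\<lambda>n. ereal (f n)) \<longleftrightarrow> (\<forall>e>0. \<forall>\<^sub>F n in sequentially. a - e < f n)"
proof
  assume l: "ereal a \<le> liminf (\<lambda>n. ereal (f n))"
  show "\<forall>e>0. \<forall>\<^sub>F n in sequentially. a - e < f n"
  proof (intro allI impI)
    fix e :: real assume "0 < e"
    then have "ereal (a - e) < ereal a" by simp
    then have "\<forall>\<^sub>F n in sequentially. ereal (a - e) < ereal (f n)"
      using l unfolding le_Liminf_iff by blast
    then show "\<forall>\<^sub>F n in sequentially. a - e < f n" by simp
  qed
next
  assume e: "\<forall>e>0. \<forall>\<^sub>F n in sequentially. a - e < f n"
  show "ereal a \<le> liminf (\<lambda>n. ereal (f n))"
  proof (rule ereal_le_epsilon2)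
    fix r :: real assume "0 < r"
    then have "\<forall>\<^sub>F n in sequentially. ereal (a - r) \<le> ereal (f n)"
      using e by (auto elim!: eventually_mono)
    then have "ereal (a - r) \<le> liminf (\<lambda>n. ereal (f n))" by (rule Liminf_bounded)
    then show "ereal a \<le> liminf (\<lambda>n. ereal (f n)) + ereal r"
      by (metis add_right_mono add.commute diff_add_cancel plus_ereal.simps(1))
  qed
qed

lemma ereal_limsup_le_iff:
  "limsup (\<lambda>n. ereal (f n)) \<le> ereal a \<longleftrightarrow> (\<forall>e>0. \<forall>\<^sub>F n in sequentially. f n < a + e)"
proof -
  have "limsup (\<lambda>n. ereal (f n)) \<le> ereal a \<longleftrightarrow> ereal (- a) \<le> - limsup (\<lambda>n. ereal (f n))"
    using ereal_minus_le_minus[of "ereal a" "limsup (\<lambda>n. ereal (f n))"] by simp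
  also have "- limsup (\<lambda>n. ereal (f n)) = liminf (\<lambda>n. ereal (- f n))"
    using ereal_Liminf_uminus[of sequentially "\<lambda>n. ereal (f n)"] by simp
  also have "ereal (- a) \<le> liminf (\<lambda>n. ereal (- f n)) \<longleftrightarrow> (\<forall>e>0. \<forall>\<^sub>F n in sequentially. - a - e < - f n)"
    by (rule ereal_liminf_ge_iff)
  also have "\<dots> \<longleftrightarrow> (\<forall>e>0. \<forall>\<^sub>F n in sequentially. f n < a + e)"
    by (simp add: algebra_simps)
  finally show ?thesis .
qed

lemma eventually_lower_transfer:
  fixes x y :: "nat \<Rightarrow> real"
  assumes xy: "(\<lambda>n. x n - y n) \<longlonglongrightarrow> 0" and x: "\<And>e. 0 < e \<Longrightarrow> \<forall>\<^sub>F n in sequentially. a - e < x n" and e: "0 < e"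
  shows "\<forall>\<^sub>F n in sequentially. a - e < y n"
proof -
  have "\<forall>\<^sub>F n in sequentially. x n - y n < e / 2" by (rule order_tendstoD(2)[OF xy]) (use e in simp)
  moreover have "\<forall>\<^sub>F n in sequentially. a - e / 2 < x n" using x e by simp
  ultimately show ?thesis by eventually_elim linarith
qed

lemma eventually_upper_transfer:
  fixes x y :: "nat \<Rightarrow> real"
  assumes xy: "(\<lambda>n. x n - y n) \<longlonglongrightarrow> 0" and x: "\<And>e. 0 < e \<Longrightarrow> \<forall>\<^sub>F n in sequentially. x n < a + e" and e: "0 < e"
  shows "\<forall>\<^sub>F n in sequentially. y n < a + e"
proof -
  have "\<forall>\<^sub>F n in sequentially. - (e / 2) < x n - y n" using order_tendstoD(1)[OF xy] e by simp
  moreover have "\<forall>\<^sub>F n in sequentially. x n < a + e / 2" using x e by simp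
  ultimately show ?thesis by eventually_elim linarith
qed

section \<open>The model: linear tangent cone and sequences represented by tangents\<close>

locale product_model = two_sample_design P0 Q0 n1 n2 d
  for P0 :: "'a measure" and Q0 :: "'b measure" and n1 n2 d +
  fixes M1 :: "'a measure" and M2 :: "'b measure" and \<P> \<Q> k and kt :: "'a \<times> 'b \<Rightarrow> real" and kt1 kt2
  assumes \<P>: "\<P> \<subseteq> space (prob_algebra M1)" and \<Q>: "\<Q> \<subseteq> space (prob_algebra M2)"
    and P0: "P0 \<in> \<P>" and Q0: "Q0 \<in> \<Q>"
    and gradient: "is_canonical_gradient (\<P> \<otimes>\<^sub>F \<Q>) k (P0 \<Otimes>\<^sub>M Q0) kt"
    and kt1: "kt1 \<in> L2_0 P0" and kt2: "kt2 \<in> L2_0 Q0"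
    and kt_sum: "AE z in P0 \<Otimes>\<^sub>M Q0. kt z = kt1 (fst z) + kt2 (snd z)"
    and kt_nz: "L2_norm (P0 \<Otimes>\<^sub>M Q0) kt \<noteq> 0"
    and cone: "tangent_cone (P0 \<Otimes>\<^sub>M Q0) (\<P> \<otimes>\<^sub>F \<Q>) = tangent_space (P0 \<Otimes>\<^sub>M Q0) (\<P> \<otimes>\<^sub>F \<Q>)"
begin

sublocale R: pair_prob_space P0 Q0 ..

abbreviation R0 where "R0 \<equiv> P0 \<Otimes>\<^sub>M Q0"

abbreviation K where "K \<equiv> tangent_cone R0 (\<P> \<otimes>\<^sub>F \<Q>)"

abbreviation F where "F \<equiv> F2 \<P> \<Q> P0 Q0"

lemma K_L2: "K \<subseteq> L2 R0"
  by (auto simp: tangent_cone_def L2_differentiable_curve_def)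

lemma K_linear: "g \<in> K \<Longrightarrow> h \<in> K \<Longrightarrow> (\<lambda>z. a * g z + b * h z) \<in> K"
  using linear_span_subset_tangent_space[OF K_L2] by (simp add: cone[symmetric])

lemma K_cong_AE: "g \<in> K \<Longrightarrow> f \<in> borel_measurable R0 \<Longrightarrow> AE z in R0. f z = g z \<Longrightarrow> f \<in> K"
  using tangent_space_cong_AE[OF _ _ _ K_L2] by (simp add: cone[symmetric])

lemma kt_K: "kt \<in> K"
  using gradient by (simp add: is_canonical_gradient_def cone)

definition decomp :: "('a \<times> 'b \<Rightarrow> real) \<Rightarrow> ('a \<Rightarrow> real) \<Rightarrow> ('b \<Rightarrow> real) \<Rightarrow> bool" where
  "decomp h h1 h2 \<longleftrightarrow> h1 \<in> L2_0 P0 \<and> h2 \<in> L2_0 Q0 \<and> (AE z in R0. h z = h1 (fst z) + h2 (snd z))"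

lemma decomp_add:
  assumes "decomp h h1 h2" "decomp g g1 g2"
  shows "decomp (\<lambda>z. h z + b * g z) (\<lambda>x. h1 x + b * g1 x) (\<lambda>y. h2 y + b * g2 y)"
proof -
  have "AE z in R0. h z + b * g z = (h1 (fst z) + b * g1 (fst z)) + (h2 (snd z) + b * g2 (snd z))"
  proof -
    have "AE z in R0. h z = h1 (fst z) + h2 (snd z)" "AE z in R0. g z = g1 (fst z) + g2 (snd z)"
      using assms by (auto simp: decomp_def)
    then show ?thesis by eventually_elim (simp add: algebra_simps)
  qed
  then show ?thesis
    using assms by (simp add: decomp_def L2_0_linear P0.prob_space_axioms Q0.prob_space_axioms)
qed

lemma decomp_kt: "decomp kt kt1 kt2"
  using kt1 kt2 kt_sum by (simp add: decomp_def)

text \<open>The mixed terms factorise into products of means and vanish because all components are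
  centred.\<close>

lemma inner_decomp:
  assumes h: "h \<in> borel_measurable R0" "decomp h h1 h2" and g: "g \<in> borel_measurable R0" "decomp g g1 g2"
  shows "(\<integral>z. g z * h z \<partial>R0) = (\<integral>x. h1 x * g1 x \<partial>P0) + (\<integral>y. h2 y * g2 y \<partial>Q0)"
proof -
  have L: "h1 \<in> L2 P0" "h2 \<in> L2 Q0" "g1 \<in> L2 P0" "g2 \<in> L2 Q0"
    and z: "(\<integral>x. h1 x \<partial>P0) = 0" "(\<integral>x. h2 x \<partial>Q0) = 0"
    and ae: "AE z in R0. h z = h1 (fst z) + h2 (snd z)" "AE z in R0. g z = g1 (fst z) + g2 (snd z)"
    using h g by (auto simp: decomp_def L2_0_def)
  note [measurable] = L[THEN L2_measurable] h(1) g(1)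
  note i = P0.L2_integrable[OF L(1)] P0.L2_integrable[OF L(3)] Q0.L2_integrable[OF L(2)] Q0.L2_integrable[OF L(4)]
  have i1: "integrable P0 (\<lambda>x. h1 x * g1 x)" "integrable Q0 (\<lambda>y. h2 y * g2 y)"
    using L by (auto intro: L2_mult_integrable)
  have "(\<integral>z. g z * h z \<partial>R0) = (\<integral>z. (g1 (fst z) + g2 (snd z)) * (h1 (fst z) + h2 (snd z)) \<partial>R0)"
    by (rule integral_cong_AE) (use ae in \<open>auto elim!: eventually_elim2\<close>)
  also have "\<dots> = (\<integral>z. (h1 (fst z) * g1 (fst z) + h2 (snd z) * g2 (snd z)) + (g1 (fst z) * h2 (snd z) + h1 (fst z) * g2 (snd z)) \<partial>R0)"
    by (intro Bochner_Integration.integral_cong) (auto simp: algebra_simps)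
  also have "\<dots> = ((\<integral>x. h1 x * g1 x \<partial>P0) + (\<integral>y. h2 y * g2 y \<partial>Q0)) + ((\<integral>x. g1 x \<partial>P0) * (\<integral>y. h2 y \<partial>Q0) + (\<integral>x. h1 x \<partial>P0) * (\<integral>y. g2 y \<partial>Q0))"
    using R.integrable_times[OF i(2,3)] R.integrable_times[OF i(1,4)] R.integral_times[OF i(2,3)] R.integral_times[OF i(1,4)]
      R.integrable_of_fst[OF i1(1)] R.integrable_of_snd[OF i1(2)]
      R.integral_of_fst[of "\<lambda>x. h1 x * g1 x"] R.integral_of_snd[of "\<lambda>y. h2 y * g2 y"] by simp
  finally show ?thesis using z by simp
qed

lemma K_decomp:
  assumes "h \<in> K"
  obtains h1 h2 where "decomp h h1 h2" "(\<lambda>z. h1 (fst z)) \<in> K" "(\<lambda>z. h2 (snd z)) \<in> K"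
proof -
  from assms obtain \<epsilon> f where f: "L2_differentiable_curve (\<P> \<otimes>\<^sub>F \<Q>) \<epsilon> f h" "f 0 = R0"
    by (auto simp: tangent_cone_def)
  from product_curve_factors[OF \<P> \<Q> P0 Q0 f] obtain P Q where PQ: "P 0 = P0" "Q 0 = Q0"
    "L2_differentiable_curve \<P> \<epsilon> P (R.partial_fst h)" "L2_differentiable_curve \<Q> \<epsilon> Q (R.partial_snd h)"
    "AE z in R0. h z = R.partial_fst h (fst z) + R.partial_snd h (snd z)" "(\<integral>z. h z \<partial>R0) = 0"
    by metis
  have hL: "h \<in> L2 R0" using assms K_L2 by auto
  show thesis
  proof (rule that)
    show "decomp h (R.partial_fst h) (R.partial_snd h)"
      using PQ R.L2_partial_fst(1,3)[OF hL] R.L2_partial_snd[OF hL] by (simp add: decomp_def L2_0_def)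
    show "(\<lambda>z. R.partial_fst h (fst z)) \<in> K"
      by (rule L2_differentiable_curve_fst[OF \<P> \<Q> P0 Q0 PQ(3,1)])
    show "(\<lambda>z. R.partial_snd h (snd z)) \<in> K"
      by (rule L2_differentiable_curve_snd[OF \<P> \<Q> P0 Q0 PQ(4,2)])
  qed
qed

lemma decomp_unique:
  assumes h: "h \<in> borel_measurable R0" and 1: "decomp h h1 h2"
  shows "AE x in P0. R.partial_fst h x = h1 x" "AE y in Q0. R.partial_snd h y = h2 y"
  using R.partial_fst_sum[OF h, of h1 h2] R.partial_snd_sum[OF h, of h1 h2] 1 by (auto simp: decomp_def L2_0_def L2_def)

text \<open>The interface between sequences and tilts, with the rate s of a sequence absorbed into
  h. The comparison is demanded for all components and all admissible arrays because the tilts used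
  later belong to a line through h, and their array is then not the truncation of the components of
  h.\<close>

definition represents :: "(nat \<Rightarrow> 'a measure) \<Rightarrow> (nat \<Rightarrow> 'b measure) \<Rightarrow> ('a \<times> 'b \<Rightarrow> real) \<Rightarrow> bool" where
  "represents Ps Qs h \<longleftrightarrow> h \<in> K \<and> is_local_parameter k P0 Q0 Ps Qs (\<integral>z. kt z * h z \<partial>R0) \<and>
    (\<forall>h1 h2 h1n h2n \<phi>. decomp h h1 h2 \<longrightarrow> admissible h1n h2n h1 h2 \<longrightarrow> tests \<phi> \<longrightarrow>
      (\<lambda>n. test_power n1 n2 \<phi> Ps Qs n - tilted_power h1n h2n \<phi> n) \<longlonglongrightarrow> 0)"

text \<open>As \<open>t n\<close> is close to \<open>s / sqrt n\<close>, the sequence moves in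
  direction \<open>s * g\<close>. The local parameter comes from differentiability of the functional
  along the curve, the powers from exchanging the curve for tilts.\<close>

lemma represents_curve:
  assumes f: "L2_differentiable_curve (\<P> \<otimes>\<^sub>F \<Q>) \<epsilon> f g" "f 0 = R0"
    and t: "t \<longlonglongrightarrow> 0" "(\<lambda>n. t n * sqrt (real n)) \<longlonglongrightarrow> s" "s > 0" "\<And>n. \<bar>t n\<bar> < \<epsilon>"
    and PQs: "\<And>n. Ps n \<in> \<P>" "\<And>n. Qs n \<in> \<Q>" "\<And>n. f (t n) = Ps n \<Otimes>\<^sub>M Qs n"
  shows "represents Ps Qs (\<lambda>z. s * g z)"
  unfolding represents_def
proof (intro conjI allI impI)
  from product_curve_factors[OF \<P> \<Q> P0 Q0 f] obtain P Q where PQ: "P 0 = P0" "Q 0 = Q0"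
    "\<And>t. \<bar>t\<bar> < \<epsilon> \<Longrightarrow> f t = P t \<Otimes>\<^sub>M Q t"
    "L2_differentiable_curve \<P> \<epsilon> P (R.partial_fst g)" "L2_differentiable_curve \<Q> \<epsilon> Q (R.partial_snd g)"
    by metis
  have gK: "g \<in> K" using f by (auto simp: tangent_cone_def)
  then show "(\<lambda>z. s * g z) \<in> K" using K_linear[of g g s 0] by simp
  have gm: "g \<in> borel_measurable R0" using gK K_L2 by (auto simp: L2_def)
  \<comment> \<open>The recorded factors and those extracted from the curve have equal products,
    hence coincide as marginals.\<close>
  have eq: "Ps n = P (t n)" "Qs n = Q (t n)" for n
  proof -
    have mem: "P (t n) \<in> \<P>" "Q (t n) \<in> \<Q>" using PQ t(4)[of n] by (auto simp: L2_differentiable_curve_def)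
    have "Ps n \<Otimes>\<^sub>M Qs n = P (t n) \<Otimes>\<^sub>M Q (t n)" using PQs(3)[of n] PQ(3)[OF t(4)[of n]] by simp
    moreover have "prob_space (Ps n)" "sets (Ps n) = sets M1" "prob_space (P (t n))" "sets (P (t n)) = sets M1"
      "prob_space (Qs n)" "sets (Qs n) = sets M2" "prob_space (Q (t n))" "sets (Q (t n)) = sets M2"
      using PQs(1,2)[of n] mem \<P> \<Q> prob_algebraD by blast+
    ultimately show "Ps n = P (t n)" "Qs n = Q (t n)" by (simp_all add: pair_measure_eq_iff)
  qed
  \<comment> \<open>Differentiability of the functional concerns limits from the right;
    \<open>s > 0\<close> makes \<open>t n\<close> eventually positive.\<close>
  have tpos: "\<forall>\<^sub>F n in sequentially. 0 < t n"
    using order_tendstoD(1)[OF t(2,3)] by eventually_elim (auto simp: zero_less_mult_iff)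
  have "filterlim t (at_right 0) sequentially"
    using t(1) tpos by (auto simp: filterlim_at elim: eventually_mono)
  moreover have "((\<lambda>t. (k (f t) - k R0) / t) \<longlongrightarrow> (\<integral>z. kt z * g z \<partial>R0)) (at_right 0)"
    using gradient f unfolding is_canonical_gradient_def is_gradient_def by blast
  ultimately have "(\<lambda>n. (k (f (t n)) - k R0) / t n) \<longlonglongrightarrow> (\<integral>z. kt z * g z \<partial>R0)"
    by (rule filterlim_compose[rotated])
  then have "(\<lambda>n. (t n * sqrt (real n)) * ((k (f (t n)) - k R0) / t n)) \<longlonglongrightarrow> s * (\<integral>z. kt z * g z \<partial>R0)"
    by (intro tendsto_mult t(2))
  then have "(\<lambda>n. sqrt (real n) * (k (Ps n \<Otimes>\<^sub>M Qs n) - k R0)) \<longlonglongrightarrow> s * (\<integral>z. kt z * g z \<partial>R0)"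
    by (rule Lim_transform_eventually) (use tpos in \<open>eventually_elim, simp add: PQs(3)\<close>)
  then show "is_local_parameter k P0 Q0 Ps Qs (\<integral>z. kt z * (s * g z) \<partial>R0)"
    by (simp add: is_local_parameter_def mult.left_commute)
  fix h1 h2 h1n h2n \<phi> assume d: "decomp (\<lambda>z. s * g z) h1 h2" and a: "admissible h1n h2n h1 h2" and \<phi>: "tests \<phi>"
  have "AE x in P0. R.partial_fst (\<lambda>z. s * g z) x = h1 x" "AE y in Q0. R.partial_snd (\<lambda>z. s * g z) y = h2 y"
    using decomp_unique[OF _ d] gm by auto
  then have "AE x in P0. h1 x = s * R.partial_fst g x" "AE y in Q0. h2 y = s * R.partial_snd g y"
    by (auto simp: R.partial_fst_def R.partial_snd_def elim!: eventually_mono)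
  from curve_power_tilted_power[OF \<P> \<Q> PQ(4,1) PQ(5,2) t a this \<phi>]
  show "(\<lambda>n. test_power n1 n2 \<phi> Ps Qs n - tilted_power h1n h2n \<phi> n) \<longlonglongrightarrow> 0"
    by (simp add: test_power_def eq)
qed

lemma F_represents:
  assumes "(Ps, Qs) \<in> F"
  obtains h where "represents Ps Qs h"
proof -
  from assms obtain \<epsilon> f g t s where "L2_differentiable_curve (\<P> \<otimes>\<^sub>F \<Q>) \<epsilon> f g" "f 0 = R0"
    "t \<longlonglongrightarrow> 0" "(\<lambda>n. t n * sqrt (real n)) \<longlonglongrightarrow> s" "s > 0" "\<And>n. \<bar>t n\<bar> < \<epsilon>"
    "\<And>n. Ps n \<in> \<P>" "\<And>n. Qs n \<in> \<Q>" "\<And>n. f (t n) = Ps n \<Otimes>\<^sub>M Qs n"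
    unfolding F2_def by auto
  from represents_curve[OF this] show thesis by (rule that)
qed

lemma K_represented:
  assumes h: "h \<in> K"
  obtains Ps Qs where "(Ps, Qs) \<in> F" "represents Ps Qs h"
proof -
  from h obtain \<epsilon> f where f: "L2_differentiable_curve (\<P> \<otimes>\<^sub>F \<Q>) \<epsilon> f h" "f 0 = R0"
    by (auto simp: tangent_cone_def)
  have \<epsilon>: "0 < \<epsilon>" and mem: "\<And>t. \<bar>t\<bar> < \<epsilon> \<Longrightarrow> f t \<in> \<P> \<otimes>\<^sub>F \<Q>"
    using f by (auto simp: L2_differentiable_curve_def)
  \<comment> \<open>The parameter \<open>1 / sqrt n\<close> gives the rate 1. It is replaced by 0
    for the finitely many n at which it would leave the domain of the curve.\<close>
  define t where "t n = (if 1 / sqrt (real n) < \<epsilon> then 1 / sqrt (real n) else 0)" for n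
  have t\<epsilon>: "\<bar>t n\<bar> < \<epsilon>" for n using \<epsilon> by (simp add: t_def)
  have inv: "(\<lambda>n. 1 / sqrt (real n)) \<longlonglongrightarrow> 0"
    by (rule real_tendsto_divide_at_top[OF tendsto_const sqrt_real_at_top])
  have ev: "\<forall>\<^sub>F n in sequentially. 1 / sqrt (real n) < \<epsilon>" by (rule order_tendstoD(2)[OF inv \<epsilon>])
  have t0: "t \<longlonglongrightarrow> 0"
    using inv by (rule Lim_transform_eventually) (use ev in \<open>eventually_elim, simp add: t_def\<close>)
  have t1: "(\<lambda>n. t n * sqrt (real n)) \<longlonglongrightarrow> 1"
  proof (rule tendsto_eventually)
    show "\<forall>\<^sub>F n in sequentially. t n * sqrt (real n) = 1"
      using ev eventually_gt_at_top[of 0] by eventually_elim (simp add: t_def)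
  qed
  have "\<exists>P Q. P \<in> \<P> \<and> Q \<in> \<Q> \<and> f (t n) = P \<Otimes>\<^sub>M Q" for n
    using mem[OF t\<epsilon>[of n]] by (auto simp: product_family_def)
  then obtain Ps Qs where PQs: "\<And>n. Ps n \<in> \<P>" "\<And>n. Qs n \<in> \<Q>" "\<And>n. f (t n) = Ps n \<Otimes>\<^sub>M Qs n" by metis
  have "(Ps, Qs) \<in> F"
    unfolding F2_def
  proof (intro CollectI case_prodI conjI allI)
    show "\<exists>\<epsilon> f g t s. L2_differentiable_curve (\<P> \<otimes>\<^sub>F \<Q>) \<epsilon> f g \<and> f 0 = R0 \<and> t \<longlonglongrightarrow> 0 \<and>
        (\<lambda>n. t n * sqrt (real n)) \<longlonglongrightarrow> s \<and> s > 0 \<and> (\<forall>n. \<bar>t n\<bar> < \<epsilon> \<and> f (t n) = Ps n \<Otimes>\<^sub>M Qs n)"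
      by (rule exI[of _ \<epsilon>], rule exI[of _ f], rule exI[of _ h], rule exI[of _ t], rule exI[of _ 1])
        (use f t0 t1 t\<epsilon> PQs in auto)
  qed (use PQs in auto)
  moreover have "represents Ps Qs (\<lambda>z. 1 * h z)"
    by (rule represents_curve[OF f t0 t1 _ t\<epsilon> PQs]) simp
  ultimately show thesis using that by simp
qed

text \<open>The Riesz representer of \<open>h \<mapsto> \<integral> kt * h\<close> for the inner product \<^const>\<open>drift\<close> of the limit
  experiment.\<close>

definition ks1 where "ks1 x = 1 / (1 - d) * kt1 x"
definition ks2 where "ks2 y = 1 / d * kt2 y"
definition ks where "ks z = ks1 (fst z) + ks2 (snd z)"
definition var where "var = 1 / (1 - d) * (\<integral>x. (kt1 x)\<^sup>2 \<partial>P0) + 1 / d * (\<integral>y. (kt2 y)\<^sup>2 \<partial>Q0)"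

lemma ks12: "ks1 \<in> L2_0 P0" "ks2 \<in> L2_0 Q0"
  unfolding ks1_def[abs_def] ks2_def[abs_def] by (intro L2_0_scale kt1 kt2)+

lemma decomp_ks: "decomp ks ks1 ks2"
  using ks12 by (simp add: decomp_def ks_def)

lemma K_measurable: "h \<in> K \<Longrightarrow> h \<in> borel_measurable R0"
  using K_L2 by (auto simp: L2_def)

text \<open>Unequal weights on the two components lead off the line spanned by the gradient. As both
  components are tangents by themselves, linearity of the cone still covers the combination; those
  found along a curve agree with \<open>kt1\<close> and \<open>kt2\<close> almost
  everywhere.\<close>

lemma ks_K: "ks \<in> K"
proof -
  obtain g1 g2 where g: "decomp kt g1 g2" "(\<lambda>z. g1 (fst z)) \<in> K" "(\<lambda>z. g2 (snd z)) \<in> K"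
    using K_decomp[OF kt_K] by blast
  note kt_m = K_measurable[OF kt_K]
  have ae: "AE x in P0. g1 x = kt1 x" "AE y in Q0. g2 y = kt2 y"
    using decomp_unique[OF kt_m g(1)] decomp_unique[OF kt_m decomp_kt] by (auto elim!: eventually_elim2)
  have eq: "AE z in R0. ks z = 1 / (1 - d) * g1 (fst z) + 1 / d * g2 (snd z)"
    using R.AE_fst[OF ae(1)] R.AE_snd[OF ae(2)] by eventually_elim (simp add: ks_def ks1_def ks2_def)
  have [measurable]: "ks1 \<in> borel_measurable P0" "ks2 \<in> borel_measurable Q0" using ks12 by (auto simp: L2_0_def L2_def)
  have "ks \<in> borel_measurable R0" unfolding ks_def[abs_def] by measurable
  from K_cong_AE[OF K_linear[OF g(2,3)] this eq] show ?thesis .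
qed

text \<open>The weights of \<open>ks1\<close> and \<open>ks2\<close> cancel the sampling fractions
  in \<open>drift\<close>. Hence the limiting mean of the test statistic is the local
  parameter.\<close>

lemma drift_ks:
  assumes "h \<in> borel_measurable R0" "decomp h h1 h2"
  shows "drift h1 h2 ks1 ks2 = (\<integral>z. kt z * h z \<partial>R0)"
proof -
  have "drift h1 h2 ks1 ks2 = (\<integral>x. h1 x * kt1 x \<partial>P0) + (\<integral>y. h2 y * kt2 y \<partial>Q0)"
    using d by (simp add: drift_def ks1_def ks2_def)
  then show ?thesis using inner_decomp[OF assms K_measurable[OF kt_K] decomp_kt] by simp
qed

lemma drift_var: "drift ks1 ks2 ks1 ks2 = var"
proof -
  have "(\<integral>x. ks1 x * ks1 x \<partial>P0) = (\<integral>x. (kt1 x)\<^sup>2 \<partial>P0) / (1 - d)\<^sup>2"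
    unfolding ks1_def by (simp add: power2_eq_square mult.assoc divide_inverse[symmetric] flip: integral_divide_zero)
  moreover have "(\<integral>x. ks2 x * ks2 x \<partial>Q0) = (\<integral>x. (kt2 x)\<^sup>2 \<partial>Q0) / d\<^sup>2"
    unfolding ks2_def by (simp add: power2_eq_square mult.assoc divide_inverse[symmetric] flip: integral_divide_zero)
  ultimately show ?thesis using d by (simp add: drift_def var_def power2_eq_square)
qed

text \<open>The components of the gradient are orthogonal, so its nonzero norm leaves one of them
  with positive norm, and both weights are positive.\<close>

lemma var_pos: "0 < var"
proof -
  have "(\<integral>z. kt z * kt z \<partial>R0) = (\<integral>x. kt1 x * kt1 x \<partial>P0) + (\<integral>y. kt2 y * kt2 y \<partial>Q0)"
    by (intro inner_decomp K_measurable kt_K decomp_kt)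
  moreover have "(\<integral>z. kt z * kt z \<partial>R0) \<noteq> 0"
    using kt_nz by (simp add: L2_norm_def power2_eq_square)
  moreover have "0 \<le> (\<integral>x. kt1 x * kt1 x \<partial>P0)" "0 \<le> (\<integral>y. kt2 y * kt2 y \<partial>Q0)" by simp_all
  ultimately have "0 < (\<integral>x. (kt1 x)\<^sup>2 \<partial>P0) \<or> 0 < (\<integral>y. (kt2 y)\<^sup>2 \<partial>Q0)"
    unfolding power2_eq_square by linarith
  then show ?thesis
  proof
    assume "0 < (\<integral>x. (kt1 x)\<^sup>2 \<partial>P0)"
    then show ?thesis unfolding var_def using d by (intro add_pos_nonneg) auto
  next
    assume "0 < (\<integral>y. (kt2 y)\<^sup>2 \<partial>Q0)"
    then show ?thesis unfolding var_def using d by (intro add_nonneg_pos) auto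
  qed
qed

section \<open>The test statistic, its limiting power, and bounds for unbiased tests\<close>

lemma tests_iff: "\<phi> \<in> test_sequences M1 M2 n1 n2 \<longleftrightarrow> tests \<phi>"
proof -
  have s: "sets (two_sample (n1 n) (n2 n) M1 M2) = sets (N n)" for n
    using prob_algebraD(2)[OF subsetD[OF \<P> P0]] prob_algebraD(2)[OF subsetD[OF \<Q> Q0]]
    by (intro sets_two_sample) simp_all
  show ?thesis
    unfolding test_sequences_def tests_def sets_eq_imp_space_eq[OF s] measurable_cong_sets[OF s refl] by auto
qed

text \<open>Writing \<open>sqrt n / n1\<close> as \<open>(n / n1) / sqrt n\<close> exhibits the
  statistic as a linear one, with arrays converging to \<open>ks1\<close> and
  \<open>ks2\<close>.\<close>

definition stat :: "nat \<Rightarrow> (nat \<Rightarrow> 'a) \<times> (nat \<Rightarrow> 'b) \<Rightarrow> real" where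
  "stat = lin_stat (\<lambda>n x. real n / real (n1 n) * kt1 x) (\<lambda>n y. real n / real (n2 n) * kt2 y)"

lemma stat_eq: "stat n \<omega> = sqrt (real n) / real (n1 n) * (\<Sum>i=1..n1 n. kt1 (fst \<omega> i))
    + sqrt (real n) / real (n2 n) * (\<Sum>j=1..n2 n. kt2 (snd \<omega> j))"
proof -
  have "real n / b * x / sqrt (real n) = sqrt (real n) / b * x" for b x
    by (metis (no_types, opaque_lifting) of_nat_0_le_iff real_div_sqrt times_divide_eq_left divide_divide_eq_left mult.commute)
  then show ?thesis
    unfolding stat_def lin_stat_def sum_distrib_left[symmetric] add_divide_distrib by simp
qed

lemma stat_arrays:
  "L2_array P0 (\<lambda>n x. real n / real (n1 n) * kt1 x) ks1" "L2_array Q0 (\<lambda>n y. real n / real (n2 n) * kt2 y) ks2"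
proof -
  have "(\<lambda>n. inverse (real (n1 n) / real n)) \<longlonglongrightarrow> inverse (1 - d)" "(\<lambda>n. inverse (real (n2 n) / real n)) \<longlonglongrightarrow> inverse d"
    using d by (intro tendsto_inverse ratio ratio1; simp)+
  then have "(\<lambda>n. real n / real (n1 n)) \<longlonglongrightarrow> 1 / (1 - d)" "(\<lambda>n. real n / real (n2 n)) \<longlonglongrightarrow> 1 / d"
    by (simp_all add: inverse_eq_divide)
  from L2_array_scale[OF P0.finite_measure_axioms kt1 this(1)] L2_array_scale[OF Q0.finite_measure_axioms kt2 this(2)]
  show "L2_array P0 (\<lambda>n x. real n / real (n1 n) * kt1 x) ks1" "L2_array Q0 (\<lambda>n y. real n / real (n2 n) * kt2 y) ks2"
    by (simp_all add: ks1_def[abs_def] ks2_def[abs_def])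
qed

definition stat_test :: "real \<Rightarrow> nat \<Rightarrow> (nat \<Rightarrow> 'a) \<times> (nat \<Rightarrow> 'b) \<Rightarrow> real" where
  "stat_test c n \<omega> = (if c < \<bar>stat n \<omega>\<bar> then 1 else 0)"

lemma tests_stat_test: "tests (stat_test c)"
proof -
  have [measurable]: "stat n \<in> borel_measurable (N n)" for n
    unfolding stat_def by (rule lin_stat_measurable[OF stat_arrays])
  show ?thesis unfolding tests_def stat_test_def[abs_def] by auto
qed

text \<open>The sequence is exchanged for the tilt along the truncated components of h. The limit
  sees h only through the local parameter, as the part of h orthogonal to \<open>ks\<close> does not
  move the statistic.\<close>

lemma stat_test_power:
  assumes rep: "represents Ps Qs h"
  shows "test_power n1 n2 (stat_test c) Ps Qs \<longlonglongrightarrow> two_sided c var (\<integral>z. kt z * h z \<partial>R0)"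
proof -
  have hK: "h \<in> K" using rep by (simp add: represents_def)
  obtain h1 h2 where dec: "decomp h h1 h2" using K_decomp[OF hK] by blast
  then have adm: "admissible (truncation h1) (truncation h2) h1 h2"
    by (intro admissible_truncation) (auto simp: decomp_def)
  have "(\<lambda>n. test_power n1 n2 (stat_test c) Ps Qs n - tilted_power (truncation h1) (truncation h2) (stat_test c) n) \<longlonglongrightarrow> 0"
    using rep dec adm tests_stat_test by (simp add: represents_def)
  moreover have "tilted_power (truncation h1) (truncation h2) (stat_test c) \<longlonglongrightarrow> two_sided c var (\<integral>z. kt z * h z \<partial>R0)"
    using tilted_two_sided_limit[OF adm stat_arrays, of c] var_pos
    unfolding drift_var drift_ks[OF K_measurable[OF hK] dec] tilted_power_def[abs_def] stat_test_def stat_def by simp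
  ultimately show ?thesis using tendsto_add by fastforce
qed

text \<open>Split \<open>h = g + a * ks\<close> with \<open>a = \<theta> / var\<close>, so that g is
  orthogonal to \<open>ks\<close> and the line \<open>g + b * ks\<close> passes through h at
  \<open>b = a\<close>. Every point of the line is a tangent with local parameter
  \<open>b * var\<close>: an alternative for nonzero b, a hypothesis for \<open>b = 0\<close>. So
  the bounds for tilt families apply. The two-sided test inside the family is built from truncations
  of \<open>ks\<close> and shares its limiting power with the test based on
  \<open>stat\<close>.\<close>

lemma
  assumes \<phi>: "tests \<phi>"
    and alt: "\<And>Ps Qs h e. (Ps, Qs) \<in> F \<Longrightarrow> represents Ps Qs h \<Longrightarrow> (\<integral>z. kt z * h z \<partial>R0) \<noteq> 0 \<Longrightarrow> 0 < e \<Longrightarrow>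
      \<forall>\<^sub>F n in sequentially. \<alpha> - e < test_power n1 n2 \<phi> Ps Qs n"
    and hyp: "\<And>Ps Qs h e. (Ps, Qs) \<in> F \<Longrightarrow> represents Ps Qs h \<Longrightarrow> (\<integral>z. kt z * h z \<partial>R0) = 0 \<Longrightarrow> 0 < e \<Longrightarrow>
      \<forall>\<^sub>F n in sequentially. test_power n1 n2 \<phi> Ps Qs n < \<alpha> + e"
    and c: "0 < c" "two_sided c var 0 = \<alpha>"
    and rep: "represents Ps Qs h"
  shows unbiased_power_upper: "(\<integral>z. kt z * h z \<partial>R0) \<noteq> 0 \<Longrightarrow> 0 < e \<Longrightarrow>
      \<forall>\<^sub>F n in sequentially. test_power n1 n2 \<phi> Ps Qs n < two_sided c var (\<integral>z. kt z * h z \<partial>R0) + e"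
    and unbiased_power_lower: "(\<integral>z. kt z * h z \<partial>R0) = 0 \<Longrightarrow> 0 < e \<Longrightarrow>
      \<forall>\<^sub>F n in sequentially. \<alpha> - e < test_power n1 n2 \<phi> Ps Qs n"
proof -
  define \<theta> where "\<theta> = (\<integral>z. kt z * h z \<partial>R0)"
  define a where "a = \<theta> / var"
  have av: "a * var = \<theta>" using var_pos by (simp add: a_def)
  have hK: "h \<in> K" using rep by (simp add: represents_def)
  obtain h1 h2 where dec: "decomp h h1 h2" using K_decomp[OF hK] by blast
  define g where "g = (\<lambda>z. h z + (- a) * ks z)"
  define g1 where "g1 = (\<lambda>x. h1 x + (- a) * ks1 x)"
  define g2 where "g2 = (\<lambda>y. h2 y + (- a) * ks2 y)"
  have g: "decomp g g1 g2" unfolding g_def g1_def g2_def by (rule decomp_add[OF dec decomp_ks])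
  have gK: "g \<in> K" using K_linear[OF hK ks_K, of 1 "- a"] by (simp add: g_def)
  have adm: "admissible (truncation g1) (truncation g2) g1 g2" "admissible (truncation h1) (truncation h2) h1 h2"
    "admissible (truncation ks1) (truncation ks2) ks1 ks2"
    using g dec decomp_ks by (auto intro!: admissible_truncation simp: decomp_def)
  have orth: "drift g1 g2 ks1 ks2 = 0"
    unfolding g1_def g2_def drift_add(2)[OF adm(2,3)] drift_var
    by (simp add: drift_ks[OF K_measurable[OF hK] dec] \<theta>_def[symmetric] av)
  interpret T: tilt_family P0 Q0 n1 n2 d "truncation g1" "truncation ks1" "truncation g2" "truncation ks2" g1 ks1 g2 ks2 var
    by unfold_locales (rule adm(1) adm(3) orth drift_var var_pos)+
  have ghK: "(\<lambda>z. g z + b * ks z) \<in> K" for b using K_linear[OF gK ks_K, of 1 b] by simp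
  have gdec: "decomp (\<lambda>z. g z + b * ks z) (\<lambda>x. g1 x + b * ks1 x) (\<lambda>y. g2 y + b * ks2 y)" for b
    by (rule decomp_add[OF g decomp_ks])
  have inner: "(\<integral>z. kt z * (g z + b * ks z) \<partial>R0) = b * var" for b
    using drift_ks[OF K_measurable[OF ghK] gdec, of b] drift_add(2)[OF adm(1,3), of b] by (simp add: orth drift_var)
  have close: "(\<lambda>n. test_power n1 n2 \<phi> Ps' Qs' n - T.pow \<phi> b n) \<longlonglongrightarrow> 0"
    if "represents Ps' Qs' (\<lambda>z. g z + b * ks z)" for Ps' Qs' b
    using that gdec[of b] T.hk[of b] \<phi> unfolding represents_def T.pow_def by blast
  \<comment> \<open>Unbiasedness speaks of sequences of the model, so a curve with tangent
    \<open>g + b * ks\<close> is chosen and its powers are carried over to the tilt.\<close>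
  have unb: "\<forall>\<^sub>F n in sequentially. \<alpha> - e < T.pow \<phi> b n" if b: "b \<noteq> 0" and e: "0 < e" for b e
  proof -
    obtain Ps' Qs' where r: "(Ps', Qs') \<in> F" "represents Ps' Qs' (\<lambda>z. g z + b * ks z)"
      using K_represented[OF ghK] by blast
    show ?thesis
      by (rule eventually_lower_transfer[OF close[OF r(2)] alt[OF r] e]) (use inner[of b] b var_pos in auto)
  qed
  have lev: "\<forall>\<^sub>F n in sequentially. T.pow \<phi> 0 n < \<alpha> + e" if e: "0 < e" for e
  proof -
    obtain Ps' Qs' where r: "(Ps', Qs') \<in> F" "represents Ps' Qs' (\<lambda>z. g z + 0 * ks z)"
      using K_represented[OF ghK] by blast
    show ?thesis
      by (rule eventually_upper_transfer[OF close[OF r(2)] hyp[OF r] e]) (use inner[of 0] in auto)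
  qed
  have rep': "represents Ps Qs (\<lambda>z. g z + a * ks z)" using rep by (simp add: g_def)
  have cl: "(\<lambda>n. T.pow \<phi> a n - test_power n1 n2 \<phi> Ps Qs n) \<longlonglongrightarrow> 0"
    using tendsto_minus[OF close[OF rep']] by simp
  {
    assume "(\<integral>z. kt z * h z \<partial>R0) \<noteq> 0" and e: "0 < e"
    then have a: "a \<noteq> 0" using var_pos by (simp add: a_def \<theta>_def)
    show "\<forall>\<^sub>F n in sequentially. test_power n1 n2 \<phi> Ps Qs n < two_sided c var (\<integral>z. kt z * h z \<partial>R0) + e"
      by (rule eventually_upper_transfer[OF cl _ e])
        (use T.pow_upper[OF \<phi> unb lev c a] in \<open>simp add: av \<theta>_def\<close>)
  }
  {
    assume "(\<integral>z. kt z * h z \<partial>R0) = 0" and e: "0 < e"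
    then have a: "a = 0" by (simp add: a_def \<theta>_def)
    show "\<forall>\<^sub>F n in sequentially. \<alpha> - e < test_power n1 n2 \<phi> Ps Qs n"
      by (rule eventually_lower_transfer[OF cl _ e])
        (use T.pow_0_lower[OF \<phi> unb] in \<open>simp add: a\<close>)
  }
qed

section \<open>Hypotheses and alternatives in terms of tangents, and optimality\<close>

lemma local_parameter_unique:
  assumes "represents Ps Qs h" "is_local_parameter k P0 Q0 Ps Qs \<theta>"
  shows "(\<integral>z. kt z * h z \<partial>R0) = \<theta>"
  using assms LIMSEQ_unique unfolding represents_def is_local_parameter_def by blast

text \<open>Limits are unique, so the local parameter is the inner product of the gradient with any
  representing tangent; membership can be decided on the tangent.\<close>

lemma implicit_hypotheses_iff:
  "(Ps, Qs) \<in> implicit_hypotheses \<P> \<Q> k P0 Q0 \<longleftrightarrow>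
    (Ps, Qs) \<in> F \<and> (\<exists>h. represents Ps Qs h \<and> (\<integral>z. kt z * h z \<partial>R0) = 0)"
proof
  assume *: "(Ps, Qs) \<in> implicit_hypotheses \<P> \<Q> k P0 Q0"
  then have F: "(Ps, Qs) \<in> F" "is_local_parameter k P0 Q0 Ps Qs 0" by (auto simp: implicit_hypotheses_def)
  from F_represents[OF F(1)] obtain h where "represents Ps Qs h" by blast
  with F local_parameter_unique show "(Ps, Qs) \<in> F \<and> (\<exists>h. represents Ps Qs h \<and> (\<integral>z. kt z * h z \<partial>R0) = 0)" by blast
next
  assume "(Ps, Qs) \<in> F \<and> (\<exists>h. represents Ps Qs h \<and> (\<integral>z. kt z * h z \<partial>R0) = 0)"
  then obtain h where F: "(Ps, Qs) \<in> F" and h: "represents Ps Qs h" "(\<integral>z. kt z * h z \<partial>R0) = 0" by blast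
  have "is_local_parameter k P0 Q0 Ps Qs (\<integral>z. kt z * h z \<partial>R0)" using h(1) unfolding represents_def by blast
  then show "(Ps, Qs) \<in> implicit_hypotheses \<P> \<Q> k P0 Q0"
    unfolding h(2) using F by (simp add: implicit_hypotheses_def)
qed

lemma implicit_alternatives_iff:
  "(Ps, Qs) \<in> implicit_alternatives \<P> \<Q> k P0 Q0 \<longleftrightarrow>
    (Ps, Qs) \<in> F \<and> (\<exists>h. represents Ps Qs h \<and> (\<integral>z. kt z * h z \<partial>R0) \<noteq> 0)"
proof
  assume *: "(Ps, Qs) \<in> implicit_alternatives \<P> \<Q> k P0 Q0"
  then obtain \<theta> where F: "(Ps, Qs) \<in> F" "is_local_parameter k P0 Q0 Ps Qs \<theta>" "\<theta> \<noteq> 0"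
    by (auto simp: implicit_alternatives_def)
  from F_represents[OF F(1)] obtain h where h: "represents Ps Qs h" by blast
  with local_parameter_unique[OF h F(2)] F
  show "(Ps, Qs) \<in> F \<and> (\<exists>h. represents Ps Qs h \<and> (\<integral>z. kt z * h z \<partial>R0) \<noteq> 0)" by blast
next
  assume "(Ps, Qs) \<in> F \<and> (\<exists>h. represents Ps Qs h \<and> (\<integral>z. kt z * h z \<partial>R0) \<noteq> 0)"
  then obtain h where F: "(Ps, Qs) \<in> F" and h: "represents Ps Qs h" "(\<integral>z. kt z * h z \<partial>R0) \<noteq> 0" by blast
  have "is_local_parameter k P0 Q0 Ps Qs (\<integral>z. kt z * h z \<partial>R0)" using h(1) unfolding represents_def by blast
  then show "(Ps, Qs) \<in> implicit_alternatives \<P> \<Q> k P0 Q0"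
    using F h(2) by (auto simp: implicit_alternatives_def)
qed

text \<open>Both optimality bounds are those obtained along the lines of tilts; on the hypotheses
  the power of the test tends to \<alpha>. What has to be added is that the test is itself unbiased
  on the alternatives.\<close>

lemma stat_test_optimal:
  assumes \<alpha>: "0 < \<alpha>" "\<alpha> < 1" and c: "c = std_normal_quantile (1 - \<alpha> / 2) * sqrt var"
  shows "asymptotically_optimal n1 n2
      (implicit_hypotheses \<P> \<Q> k P0 Q0) (implicit_alternatives \<P> \<Q> k P0 Q0)
      {\<phi> \<in> test_sequences M1 M2 n1 n2.
        asymptotically_unbiased n1 n2 \<alpha>
          (implicit_hypotheses \<P> \<Q> k P0 Q0) (implicit_alternatives \<P> \<Q> k P0 Q0) \<phi>}
      (stat_test c)"
    (is "asymptotically_optimal n1 n2 ?H ?K ?C _")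
proof -
  note c0 = two_sided_0[OF var_pos \<alpha> c]
  have const_power: "test_power n1 n2 (\<lambda>n \<omega>. \<alpha>) Ps Qs n = \<alpha>" if "(Ps, Qs) \<in> F" for Ps Qs n
  proof -
    have "Ps n \<in> \<P>" "Qs n \<in> \<Q>" using that by (auto simp: F2_def)
    then have "prob_space (Ps n)" "prob_space (Qs n)"
      using prob_algebraD(1)[OF subsetD[OF \<P>]] prob_algebraD(1)[OF subsetD[OF \<Q>]] by auto
    then interpret prob_space "two_sample (n1 n) (n2 n) (Ps n) (Qs n)" by (rule prob_space_two_sample)
    show ?thesis by (simp add: test_power_def prob_space)
  qed
  have const: "tests (\<lambda>n \<omega>. \<alpha>)" using \<alpha> by (simp add: tests_def)
  \<comment> \<open>The constant test \<alpha> satisfies both constraints, so the upper bound for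
    unbiased tests applies to it and yields a lower bound for the power of the two-sided
    test.\<close>
  have power_ge: "\<alpha> \<le> two_sided c var (\<integral>z. kt z * h z \<partial>R0)"
    if F: "(Ps, Qs) \<in> F" and rep: "represents Ps Qs h" and nz: "(\<integral>z. kt z * h z \<partial>R0) \<noteq> 0" for Ps Qs h
  proof (rule field_le_epsilon)
    fix e :: real assume e: "0 < e"
    have "\<forall>\<^sub>F n in sequentially. test_power n1 n2 (\<lambda>n \<omega>. \<alpha>) Ps Qs n < two_sided c var (\<integral>z. kt z * h z \<partial>R0) + e"
      by (rule unbiased_power_upper[OF const _ _ c0 rep nz e]) (simp_all add: const_power)
    then show "\<alpha> \<le> two_sided c var (\<integral>z. kt z * h z \<partial>R0) + e"
      by (simp add: const_power[OF F] less_imp_le)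
  qed
  have unbiased: "asymptotically_unbiased n1 n2 \<alpha> ?H ?K (stat_test c)"
    unfolding asymptotically_unbiased_def
  proof safe
    fix Ps Qs assume "(Ps, Qs) \<in> ?H"
    then obtain h where h: "represents Ps Qs h" "(\<integral>z. kt z * h z \<partial>R0) = 0"
      unfolding implicit_hypotheses_iff by blast
    have L: "(\<lambda>n. ereal (test_power n1 n2 (stat_test c) Ps Qs n)) \<longlonglongrightarrow> ereal \<alpha>"
      using stat_test_power[OF h(1), of c] h(2) c0 by simp
    then show "limsup (\<lambda>n. ereal (test_power n1 n2 (stat_test c) Ps Qs n)) \<le> ereal \<alpha>"
      using lim_imp_Limsup[OF _ L] by simp
  next
    fix Ps Qs assume "(Ps, Qs) \<in> ?K"
    then obtain h where h: "(Ps, Qs) \<in> F" "represents Ps Qs h" "(\<integral>z. kt z * h z \<partial>R0) \<noteq> 0"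
      unfolding implicit_alternatives_iff by blast
    have L: "(\<lambda>n. ereal (test_power n1 n2 (stat_test c) Ps Qs n)) \<longlonglongrightarrow> ereal (two_sided c var (\<integral>z. kt z * h z \<partial>R0))"
      using stat_test_power[OF h(2), of c] by simp
    then show "ereal \<alpha> \<le> liminf (\<lambda>n. ereal (test_power n1 n2 (stat_test c) Ps Qs n))"
      using power_ge[OF h] lim_imp_Liminf[OF _ L] by simp
  qed
  have conv: "convergent (test_power n1 n2 (stat_test c) Ps Qs)" if "(Ps, Qs) \<in> ?H \<union> ?K" for Ps Qs
    using that stat_test_power[of Ps Qs _ c] unfolding Un_iff implicit_hypotheses_iff implicit_alternatives_iff
    by (auto intro: convergentI)
  have alt: "\<forall>\<^sub>F n in sequentially. \<alpha> - e < test_power n1 n2 \<phi> Ps Qs n"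
    if \<phi>: "asymptotically_unbiased n1 n2 \<alpha> ?H ?K \<phi>" and r: "(Ps, Qs) \<in> F" "represents Ps Qs h" "(\<integral>z. kt z * h z \<partial>R0) \<noteq> 0"
      and e: "0 < e" for \<phi> Ps Qs h e
  proof -
    have "(Ps, Qs) \<in> ?K" using r unfolding implicit_alternatives_iff by blast
    then have "ereal \<alpha> \<le> liminf (\<lambda>n. ereal (test_power n1 n2 \<phi> Ps Qs n))"
      using \<phi> by (auto simp: asymptotically_unbiased_def)
    then show ?thesis using e unfolding ereal_liminf_ge_iff by blast
  qed
  have hyp: "\<forall>\<^sub>F n in sequentially. test_power n1 n2 \<phi> Ps Qs n < \<alpha> + e"
    if \<phi>: "asymptotically_unbiased n1 n2 \<alpha> ?H ?K \<phi>" and r: "(Ps, Qs) \<in> F" "represents Ps Qs h" "(\<integral>z. kt z * h z \<partial>R0) = 0"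
      and e: "0 < e" for \<phi> Ps Qs h e
  proof -
    have "(Ps, Qs) \<in> ?H" using r unfolding implicit_hypotheses_iff by blast
    then have "limsup (\<lambda>n. ereal (test_power n1 n2 \<phi> Ps Qs n)) \<le> ereal \<alpha>"
      using \<phi> by (auto simp: asymptotically_unbiased_def)
    then show ?thesis using e unfolding ereal_limsup_le_iff by blast
  qed
  show ?thesis
    unfolding asymptotically_optimal_def
  proof (intro conjI ballI)
    show "stat_test c \<in> ?C" using unbiased tests_stat_test by (simp add: tests_iff)
    show "case x of (Ps, Qs) \<Rightarrow> convergent (test_power n1 n2 (stat_test c) Ps Qs)" if "x \<in> ?H \<union> ?K" for x
      using conv that by (cases x) simp
  next
    fix \<phi> x assume \<phi>: "\<phi> \<in> ?C" and x: "x \<in> ?K"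
    obtain Ps Qs where PQ: "x = (Ps, Qs)" by (cases x)
    then obtain h where h: "(Ps, Qs) \<in> F" "represents Ps Qs h" "(\<integral>z. kt z * h z \<partial>R0) \<noteq> 0"
      using x[unfolded PQ implicit_alternatives_iff] by blast
    have \<phi>': "tests \<phi>" "asymptotically_unbiased n1 n2 \<alpha> ?H ?K \<phi>" using \<phi> by (auto simp: tests_iff)
    have "\<forall>e>0. \<forall>\<^sub>F n in sequentially. test_power n1 n2 \<phi> Ps Qs n < two_sided c var (\<integral>z. kt z * h z \<partial>R0) + e"
      by (intro allI impI, rule unbiased_power_upper[OF \<phi>'(1) _ _ c0 h(2,3)])
        (blast intro: alt[OF \<phi>'(2)] hyp[OF \<phi>'(2)])+
    then show "case x of (Ps, Qs) \<Rightarrow> limsup (\<lambda>n. ereal (test_power n1 n2 \<phi> Ps Qs n)) \<le> ereal (lim (test_power n1 n2 (stat_test c) Ps Qs))"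
      unfolding PQ prod.case limI[OF stat_test_power[OF h(2)]] ereal_limsup_le_iff .
  next
    fix \<phi> x assume \<phi>: "\<phi> \<in> ?C" and x: "x \<in> ?H"
    obtain Ps Qs where PQ: "x = (Ps, Qs)" by (cases x)
    then obtain h where h: "(Ps, Qs) \<in> F" "represents Ps Qs h" "(\<integral>z. kt z * h z \<partial>R0) = 0"
      using x[unfolded PQ implicit_hypotheses_iff] by blast
    have \<phi>': "tests \<phi>" "asymptotically_unbiased n1 n2 \<alpha> ?H ?K \<phi>" using \<phi> by (auto simp: tests_iff)
    have "\<forall>e>0. \<forall>\<^sub>F n in sequentially. \<alpha> - e < test_power n1 n2 \<phi> Ps Qs n"
      by (intro allI impI, rule unbiased_power_lower[OF \<phi>'(1) _ _ c0 h(2,3)])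
        (blast intro: alt[OF \<phi>'(2)] hyp[OF \<phi>'(2)])+
    then show "case x of (Ps, Qs) \<Rightarrow> ereal (lim (test_power n1 n2 (stat_test c) Ps Qs)) \<le> liminf (\<lambda>n. ereal (test_power n1 n2 \<phi> Ps Qs n))"
      unfolding PQ prod.case limI[OF stat_test_power[OF h(2)]] h(3) c0(2) ereal_liminf_ge_iff .
  qed
qed

end

theorem mainTheorem14:
  fixes M1 :: "'a measure" and M2 :: "'b measure"
    and \<P> :: "'a measure set" and \<Q> :: "'b measure set"
    and P0 :: "'a measure" and Q0 :: "'b measure"
    and k :: "('a \<times> 'b) measure \<Rightarrow> real"
    and kt :: "'a \<times> 'b \<Rightarrow> real" and kt1 :: "'a \<Rightarrow> real" and kt2 :: "'b \<Rightarrow> real"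
    and \<alpha> d c :: real and n1 n2 :: "nat \<Rightarrow> nat"
    and T \<psi> :: "nat \<Rightarrow> (nat \<Rightarrow> 'a) \<times> (nat \<Rightarrow> 'b) \<Rightarrow> real"
  assumes "\<P> \<subseteq> space (prob_algebra M1)" and "\<Q> \<subseteq> space (prob_algebra M2)"
    and "P0 \<in> \<P>" and "Q0 \<in> \<Q>"
    and "is_canonical_gradient (\<P> \<otimes>\<^sub>F \<Q>) k (P0 \<Otimes>\<^sub>M Q0) kt"
    and "kt1 \<in> L2_0 P0" and "kt2 \<in> L2_0 Q0"
    and "AE \<omega> in P0 \<Otimes>\<^sub>M Q0. kt \<omega> = kt1 (fst \<omega>) + kt2 (snd \<omega>)"
    and "L2_norm (P0 \<Otimes>\<^sub>M Q0) kt \<noteq> 0"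
    and "0 < \<alpha>" and "\<alpha> < 1"
    and "\<And>n. n1 n + n2 n = n"
    and "(\<lambda>n. real (n2 n) / real n) \<longlonglongrightarrow> d" and "0 < d" and "d < 1"
    and "tangent_cone (P0 \<Otimes>\<^sub>M Q0) (\<P> \<otimes>\<^sub>F \<Q>) = tangent_space (P0 \<Otimes>\<^sub>M Q0) (\<P> \<otimes>\<^sub>F \<Q>)"
    and "\<And>n \<omega>. T n \<omega> = sqrt (real n) / real (n1 n) * (\<Sum>i=1..n1 n. kt1 (fst \<omega> i))
                      + sqrt (real n) / real (n2 n) * (\<Sum>j=1..n2 n. kt2 (snd \<omega> j))"
    and "c = std_normal_quantile (1 - \<alpha> / 2)
             * sqrt (1 / (1 - d) * (\<integral>x. (kt1 x)\<^sup>2 \<partial>P0) + 1 / d * (\<integral>y. (kt2 y)\<^sup>2 \<partial>Q0))"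
    and "\<And>n \<omega>. \<psi> n \<omega> = (if \<bar>T n \<omega>\<bar> > c then 1 else 0)"
  shows "asymptotically_optimal n1 n2
           (implicit_hypotheses \<P> \<Q> k P0 Q0) (implicit_alternatives \<P> \<Q> k P0 Q0)
           {\<phi> \<in> test_sequences M1 M2 n1 n2.
              asymptotically_unbiased n1 n2 \<alpha>
                (implicit_hypotheses \<P> \<Q> k P0 Q0) (implicit_alternatives \<P> \<Q> k P0 Q0) \<phi>}
           \<psi>"
proof -
  have prob: "prob_space P0" "prob_space Q0"
    using assms(1-4) prob_algebraD(1) by blast+
  interpret product_model P0 Q0 n1 n2 d M1 M2 \<P> \<Q> k kt kt1 kt2
    using assms prob
    by (simp add: product_model_def product_model_axioms_def two_sample_design_def two_sample_design_axioms_def)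
  have "\<psi> = stat_test c"
    by (intro ext) (simp only: assms(17,19) stat_test_def stat_eq)
  moreover have "c = std_normal_quantile (1 - \<alpha> / 2) * sqrt var"
    using assms(18) by (simp only: var_def)
  ultimately show ?thesis using stat_test_optimal[OF assms(10,11)] by simp
qed

end
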